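(* Let $X$ be a Banach function space over the unit circle $\mathbb{T}$ with associate space $X'$. If the Riesz projection $P$ is bounded on $X$, then for every $f\in X$, \[ \|f\|_X=\sup\{|\langle f,p\rangle|\ :\ p\in\mathcal{P},\ \|p\|_{X'}\le1\}, \] where $\mathcal{P}$ denotes the set of all trigonometric polynomials on $\mathbb{T}$.
   Context: $\mathbb{T}$ is the unit circle in $\mathbb{C}$ with normalized Lebesgue measure $dm(t)=|dt|/(2\pi)$; $L^p=L^p(\mathbb{T})$ with respect to $m$; $L^0$ is the space of measurable complex-valued functions on $\mathbb{T}$, and $L^0_+$ is the set of measurable functions on $\mathbb{T}$ with values in $[0,\infty]$. $\mathbb{I}_E$ is the indicator function of $E$. A Banach function norm is a mapping $\rho:L^0_+\to[0,\infty]$ such that for all $f,g,f_n\in L^0_+$ ($n\in\mathbb{N}$), all constants $c\ge 0$ and all measurable $E\subset\mathbb{T}$: (A1) $\rho(f)=0\Leftrightarrow f=0$ a.e., $\rho(cf)=c\rho(f)$, $\rho(f+g)\le\rho(f)+\rho(g)$; (A2) $0\le g\le f$ a.e. implies $\rho(g)\le\rho(f)$; (A3) $0\le f_n\uparrow f$ a.e. implies $\rho(f_n)\uparrow\rho(f)$; (A4) $\rho(\mathbb{I}_E)<\infty$; (A5) $\int_E f\,dm\le C_E\,\rho(f)$ with a constant $C_E\in(0,\infty)$ independent of $f$. The Banach function space determined by $\rho$ is $X=\{f\in L^0:\rho(|f|)<\infty\}$ (functions equal a.e. are identified) with norm $\|f\|_X=\rho(|f|)$. The associate space $X'$ is the Banach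 function space determined by the Banach function norm $\rho'(g)=\sup\{\int_{\mathbb{T}}fg\,dm: f\in L^0_+,\ \rho(f)\le1\}$, $g\in L^0_+$. For $f\in X$, $g\in X'$: $\langle f,g\rangle=\int_{\mathbb{T}}f\overline g\,dm$. A trigonometric polynomial is a function $\sum_{k=-n}^n\alpha_kt^k$ with $n\ge0$ and $\alpha_k\in\mathbb{C}$. The Riesz projection is defined for $f\in L^1$ and a.e. $t\in\mathbb{T}$ by $(Pf)(t)=\frac12\big(f(t)+(Sf)(t)\big)$, where $(Sf)(t)=\frac1{\pi i}\,\mathrm{p.v.}\int_{\mathbb{T}}\frac{f(\tau)}{\tau-t}\,d\tau$. "$P$ is bounded on $X$" means that $P$ maps $X$ to $X$ and is a bounded operator there. *)

theory Defs
  imports "HOL-Analysis.Analysis"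
begin

text \<open>The measure is completed, so that ``measurable'' means Lebesgue measurable. Functions on the
  circle are represented by functions on the complex plane; all notions below depend only on their
  values on the circle (up to null sets).\<close>

definition circle :: "complex measure" where
  "circle = completion
     (distr (uniform_measure lborel {0..<2 * pi}) (restrict_space borel (sphere 0 1)) cis)"

abbreviation L0 :: "(complex \<Rightarrow> complex) set" where
  "L0 \<equiv> borel_measurable circle"

abbreviation L0_plus :: "(complex \<Rightarrow> ennreal) set" where
  "L0_plus \<equiv> borel_measurable circle"

text \<open>Only the values of the functional on measurable functions matter.\<close>

definition banach_function_norm :: "((complex \<Rightarrow> ennreal) \<Rightarrow> ennreal) \<Rightarrow> bool" where
  "banach_function_norm \<rho> \<longleftrightarrow>
     (\<forall>f\<in>L0_plus. \<rho> f = 0 \<longleftrightarrow> (AE t in circle. f t = 0)) \<and>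
     (\<forall>f\<in>L0_plus. \<forall>c::real. c \<ge> 0 \<longrightarrow> \<rho> (\<lambda>t. ennreal c * f t) = ennreal c * \<rho> f) \<and>
     (\<forall>f\<in>L0_plus. \<forall>g\<in>L0_plus. \<rho> (\<lambda>t. f t + g t) \<le> \<rho> f + \<rho> g) \<and>
     (\<forall>f\<in>L0_plus. \<forall>g\<in>L0_plus. (AE t in circle. g t \<le> f t) \<longrightarrow> \<rho> g \<le> \<rho> f) \<and>
     (\<forall>F f. (\<forall>n::nat. F n \<in> L0_plus) \<and> f \<in> L0_plus \<and>
        (AE t in circle. incseq (\<lambda>n. F n t) \<and> (\<lambda>n. F n t) \<longlonglongrightarrow> f t) \<longrightarrow>
        incseq (\<lambda>n. \<rho> (F n)) \<and> (\<lambda>n. \<rho> (F n)) \<longlonglongrightarrow> \<rho> f) \<and>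
     (\<forall>E\<in>sets circle. \<rho> (indicator E) < \<infinity>) \<and>
     (\<forall>E\<in>sets circle. \<exists>C::real. C > 0 \<and>
        (\<forall>f\<in>L0_plus. (\<integral>\<^sup>+t\<in>E. f t \<partial>circle) \<le> ennreal C * \<rho> f))"

definition associate_norm :: "((complex \<Rightarrow> ennreal) \<Rightarrow> ennreal) \<Rightarrow> (complex \<Rightarrow> ennreal) \<Rightarrow> ennreal" where
  "associate_norm \<rho> g = (SUP f\<in>{f\<in>L0_plus. \<rho> f \<le> 1}. \<integral>\<^sup>+t. f t * g t \<partial>circle)"

text \<open>The norm is kept extended-valued; it is finite exactly on the space.\<close>

definition bfs_norm :: "((complex \<Rightarrow> ennreal) \<Rightarrow> ennreal) \<Rightarrow> (complex \<Rightarrow> complex) \<Rightarrow> ennreal" where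
  "bfs_norm \<rho> f = \<rho> (\<lambda>t. ennreal (cmod (f t)))"

definition bfs :: "((complex \<Rightarrow> ennreal) \<Rightarrow> ennreal) \<Rightarrow> (complex \<Rightarrow> complex) set" where
  "bfs \<rho> = {f \<in> L0. bfs_norm \<rho> f < \<infinity>}"

definition pairing :: "(complex \<Rightarrow> complex) \<Rightarrow> (complex \<Rightarrow> complex) \<Rightarrow> complex" where
  "pairing f g = (LINT t|circle. f t * cnj (g t))"

definition trig_polynomials :: "(complex \<Rightarrow> complex) set" where
  "trig_polynomials =
     {p. \<exists>(n::nat) \<alpha>. p = (\<lambda>t. \<Sum>k\<in>{-int n..int n}. \<alpha> k * t powi k)}"

text \<open>On the positively oriented circle, \<open>\<tau> = cis \<theta>\<close> gives
  \<open>d\<tau> = \<i> \<tau> d\<theta> = 2 \<pi> \<i> \<tau> dm(\<tau>)\<close>.\<close>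

definition circle_line_integral :: "complex set \<Rightarrow> (complex \<Rightarrow> complex) \<Rightarrow> complex" where
  "circle_line_integral E g = (LINT \<tau>:E|circle. g \<tau> * (2 * of_real pi * \<i> * \<tau>))"

text \<open>The principal value exists for almost every \<open>t\<close> on the circle if \<open>f\<close> is integrable; elsewhere
  \<open>Lim\<close> returns an unspecified value.\<close>

definition cauchy_singular :: "(complex \<Rightarrow> complex) \<Rightarrow> complex \<Rightarrow> complex" where
  "cauchy_singular f t = 1 / (of_real pi * \<i>) *
     Lim (at_right (0::real))
       (\<lambda>\<epsilon>. circle_line_integral {\<tau> \<in> sphere 0 1. \<epsilon> < dist \<tau> t} (\<lambda>\<tau>. f \<tau> / (\<tau> - t)))"

definition riesz_projection :: "(complex \<Rightarrow> complex) \<Rightarrow> complex \<Rightarrow> complex" where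
  "riesz_projection f t = (f t + cauchy_singular f t) / 2"

definition bounded_on_bfs ::
  "((complex \<Rightarrow> complex) \<Rightarrow> complex \<Rightarrow> complex) \<Rightarrow> ((complex \<Rightarrow> ennreal) \<Rightarrow> ennreal) \<Rightarrow> bool" where
  "bounded_on_bfs T \<rho> \<longleftrightarrow>
     (\<forall>f\<in>bfs \<rho>. T f \<in> bfs \<rho>) \<and>
     (\<exists>C::real. C \<ge> 0 \<and> (\<forall>f\<in>bfs \<rho>. bfs_norm \<rho> (T f) \<le> ennreal C * bfs_norm \<rho> f))"

end

theory Submission
  imports Defs "HOL-Complex_Analysis.Complex_Analysis"
begin

text \<open>By the Lorentz--Luxemburg theorem the norm of \<open>f\<close> is the supremum of the pairings with
  bounded \<open>g\<close> in the unit ball of \<open>X'\<close>, so it suffices to approximate such a \<open>g\<close>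
  by trigonometric polynomials, boundedly almost everywhere and in the norm of \<open>X'\<close>. This is
  possible once the indicator of \<open>E\<close> tends to 0 in \<open>X'\<close> as the measure of \<open>E\<close> tends to 0.
  Boundedness of \<open>P\<close> on trigonometric polynomials forces this: for \<open>m(E) = \<delta>\<close> there is a trigonometric
  polynomial bounded by 3 whose Riesz projection has size at least a multiple of \<open>ln (1 / \<delta>)\<close> on \<open>E\<close>.
  To transfer the boundedness of \<open>P\<close> from \<open>X\<close> to \<open>X'\<close> by duality one needs the same
  approximation property for \<open>X\<close> itself; working only with polynomials avoids all questions about the
  existence of principal values.\<close>

section \<open>The measure on the circle\<close>

text \<open>\<open>X\<close> need not be translation-invariant, so Fejer means and other
  convolutions may fail to be bounded on \<open>X'\<close>, and a polynomial close to g in L^1 may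
  be far too large in \<open>X'\<close>. The way out is to keep the error g - p uniformly bounded
  and small in L^1: it is then small outside a set of small measure, and on that set only the norm
  of an indicator matters. The rate obtained is (6C + 20) N(1) / ln (1 + 1/\<delta>) for sets of
  measure below \<delta>: a polynomial bounded by 3 costs at most 3 N(1) in any such norm N, whereas
  its projection is logarithmically large on the set. The rate is slow, but any rate suffices. The
  approximants have norm at most 1 + e rather than 1, so every estimate through them carries an e
  that is removed at the end. The Lorentz-Luxemburg theorem is obtained from a nearest point in L^2
  instead of the Hahn-Banach theorem; the separating functional is then explicitly a bounded
  function, as the approximation requires.\<close>

definition circle0 :: "complex measure" where
  "circle0 = distr (uniform_measure lborel {0..<2 * pi}) (restrict_space borel (sphere 0 1)) cis"

text \<open>Changes of variables are carried out on the Borel measure \<open>circle0\<close>; this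
  equation carries the results over to its completion.\<close>

lemma circle_eq: "circle = completion circle0"
  by (simp add: circle_def circle0_def)

lemma cis_measurable_circle0:
  "cis \<in> measurable (uniform_measure lborel {0..<2 * pi}) (restrict_space borel (sphere 0 1))"
proof (rule measurable_restrict_space2)
  have "cis \<in> borel_measurable borel"
    by (intro borel_measurable_continuous_onI continuous_intros)
  then show "cis \<in> borel_measurable (uniform_measure lborel {0..<2 * pi})"
    by simp
qed auto

lemma space_circle0: "space circle0 = sphere 0 1"
  by (auto simp: circle0_def space_restrict_space)

lemma space_circle [simp]: "space circle = sphere 0 1"
  by (simp add: circle_eq space_circle0)

lemma sets_circle0: "sets circle0 = sets (restrict_space borel (sphere 0 1))"
  by (simp add: circle0_def)

lemma emeasure_circle0: "emeasure circle0 (sphere 0 1) = 1"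
proof -
  have "sphere 0 1 \<in> sets (restrict_space borel (sphere (0::complex) 1))"
    using sets.top[of "restrict_space borel (sphere (0::complex) 1)"]
    by (simp add: space_restrict_space)
  then show ?thesis
    unfolding circle0_def
    by (subst emeasure_distr[OF cis_measurable_circle0])
       (auto simp: vimage_def emeasure_uniform_measure ennreal_divide_self)
qed

lemma emeasure_circle: "emeasure circle (sphere 0 1) = 1"
proof -
  have "sphere (0::complex) 1 \<in> sets circle0"
    using sets.top[of circle0] by (simp add: space_circle0)
  then show ?thesis
    by (simp add: circle_eq emeasure_circle0)
qed

lemma measure_circle [simp]: "measure circle (sphere 0 1) = 1"
  by (simp add: measure_def emeasure_circle)

interpretation circle: finite_measure circle
  by standard (simp add: emeasure_circle)

lemma measurable_circle0: "f \<in> borel_measurable borel \<Longrightarrow> f \<in> borel_measurable circle0"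
  unfolding measurable_cong_sets[OF sets_circle0 refl] by (rule measurable_restrict_space1)

lemma measurable_circleI: "f \<in> borel_measurable borel \<Longrightarrow> f \<in> borel_measurable circle"
  unfolding circle_eq by (intro measurable_completion measurable_circle0)

lemma continuous_measurable_circle:
  fixes f :: "complex \<Rightarrow> 'b::topological_space"
  assumes "continuous_on (sphere 0 1) f"
  shows "f \<in> borel_measurable circle"
  unfolding circle_eq
proof (rule measurable_completion)
  show "f \<in> borel_measurable circle0"
    unfolding measurable_cong_sets[OF sets_circle0 refl]
    using assms by (rule borel_measurable_continuous_on_restrict)
qed

lemma continuous_integrable_circle:
  fixes f :: "complex \<Rightarrow> complex"
  assumes "continuous_on (sphere 0 1) f"
  shows "integrable circle f"
proof -
  have "compact (f ` sphere 0 1)"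
    by (intro compact_continuous_image assms compact_sphere)
  then obtain B where "\<forall>x\<in>sphere 0 1. norm (f x) \<le> B"
    by (meson bounded_iff compact_imp_bounded imageI)
  then show ?thesis
    by (intro circle.integrable_const_bound[of _ B] continuous_measurable_circle assms) auto
qed

lemma nn_integral_circle0:
  assumes "g \<in> borel_measurable borel"
  shows "(\<integral>\<^sup>+ t. g t \<partial>circle0) = (\<integral>\<^sup>+ \<theta>. g (cis \<theta>) * indicator {0..<2 * pi} \<theta> \<partial>lborel) / ennreal (2 * pi)"
proof -
  have g: "g \<in> borel_measurable (restrict_space borel (sphere 0 1))"
    by (rule measurable_restrict_space1[OF assms])
  have [measurable]: "cis \<in> borel_measurable borel"
    by (intro borel_measurable_continuous_onI continuous_intros)
  note assms[measurable]
  have "(\<integral>\<^sup>+ t. g t \<partial>circle0) = (\<integral>\<^sup>+ \<theta>. g (cis \<theta>) \<partial>uniform_measure lborel {0..<2 * pi})"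
    unfolding circle0_def by (rule nn_integral_distr[OF cis_measurable_circle0]) (use g in simp)
  also have "\<dots> = (\<integral>\<^sup>+ \<theta>. g (cis \<theta>) * indicator {0..<2 * pi} \<theta> \<partial>lborel) / ennreal (2 * pi)"
    by (subst nn_integral_uniform_measure) auto
  finally show ?thesis .
qed

text \<open>In terms of angles this is \<theta> \<mapsto> a - \<theta> with c = cis a. The same
  symmetry later yields both the means of monomials and the principal value for the constant
  function.\<close>

lemma nn_integral_circle0_reflect:
  assumes [measurable]: "g \<in> borel_measurable borel" and c: "cmod c = 1"
  shows "(\<integral>\<^sup>+ t. g (c * cnj t) \<partial>circle0) = (\<integral>\<^sup>+ t. g t \<partial>circle0)"
proof -
  define a where "a = Arg2pi c"
  have a: "0 \<le> a" "a < 2 * pi" and ca: "c = cis a"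
    using Arg2pi[of c] c by (auto simp: a_def cis_conv_exp is_Arg_def)
  have [measurable]: "cis \<in> borel_measurable borel" "cnj \<in> borel_measurable borel"
    by (intro borel_measurable_continuous_onI continuous_intros)+
  define h where "h \<theta> = g (cis \<theta>)" for \<theta>
  have [measurable]: "h \<in> borel_measurable borel" unfolding h_def by measurable
  have per: "h (\<theta> - 2 * pi) = h \<theta>" for \<theta>
    by (simp add: h_def cis_divide[symmetric])
  have "(\<integral>\<^sup>+ \<theta>. g (c * cnj (cis \<theta>)) * indicator {0..<2 * pi} \<theta> \<partial>lborel)
      = (\<integral>\<^sup>+ \<theta>. h (a + (-1) * \<theta>) * indicator {a - 2 * pi<..a} (a + (-1) * \<theta>) \<partial>lborel)"
    by (intro nn_integral_cong)
       (auto simp: h_def ca cis_cnj cis_mult indicator_def)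
  also have "\<dots> = (\<integral>\<^sup>+ x. h x * indicator {a - 2 * pi<..a} x \<partial>lborel)"
    by (subst nn_integral_real_affine[of _ "-1" a]) auto
  also have "\<dots> = (\<integral>\<^sup>+ x. h x * indicator {a - 2 * pi<..<0} x + h x * indicator {0..a} x \<partial>lborel)"
    using a by (intro nn_integral_cong) (auto simp: indicator_def)
  also have "\<dots> = (\<integral>\<^sup>+ x. h x * indicator {a - 2 * pi<..<0} x \<partial>lborel) + (\<integral>\<^sup>+ x. h x * indicator {0..a} x \<partial>lborel)"
    by (rule nn_integral_add) auto
  \<comment> \<open>The reflected interval is (a - 2 pi, a]. Periodicity moves its negative part to
    (a, 2 pi), which together with [0, a] fills [0, 2 pi).\<close>
  also have "(\<integral>\<^sup>+ x. h x * indicator {a - 2 * pi<..<0} x \<partial>lborel)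
     = (\<integral>\<^sup>+ x. h x * indicator {a<..<2 * pi} x \<partial>lborel)"
  proof (subst nn_integral_real_affine[of _ 1 "-(2*pi)"])
    show "ennreal \<bar>1\<bar> * (\<integral>\<^sup>+ x. h (- (2 * pi) + 1 * x) * indicator {a - 2 * pi<..<0} (- (2 * pi) + 1 * x) \<partial>lborel)
      = (\<integral>\<^sup>+ x. h x * indicator {a<..<2 * pi} x \<partial>lborel)"
      by (auto simp: per indicator_def intro!: nn_integral_cong)
  qed auto
  also have "(\<integral>\<^sup>+ x. h x * indicator {a<..<2 * pi} x \<partial>lborel) + (\<integral>\<^sup>+ x. h x * indicator {0..a} x \<partial>lborel)
     = (\<integral>\<^sup>+ x. h x * indicator {a<..<2 * pi} x + h x * indicator {0..a} x \<partial>lborel)"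
    by (rule nn_integral_add[symmetric]) auto
  also have "\<dots> = (\<integral>\<^sup>+ x. g (cis x) * indicator {0..<2 * pi} x \<partial>lborel)"
    using a by (intro nn_integral_cong) (auto simp: indicator_def h_def)
  finally show ?thesis
    by (simp add: nn_integral_circle0)
qed

lemma distr_circle0_reflect:
  assumes c: "cmod c = 1"
  shows "distr circle0 circle0 (\<lambda>t. c * cnj t) = circle0"
proof (rule measure_eqI)
  have cont: "(\<lambda>t. c * cnj t) \<in> borel_measurable borel"
    by (intro borel_measurable_continuous_onI continuous_intros)
  have m: "(\<lambda>t. c * cnj t) \<in> measurable circle0 circle0"
    unfolding measurable_cong_sets[OF refl sets_circle0]
    by (rule measurable_restrict_space2)
       (use c in \<open>auto simp: space_circle0 norm_mult intro: measurable_circle0 cont\<close>)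
  fix A assume A: "A \<in> sets (distr circle0 circle0 (\<lambda>t. c * cnj t))"
  then have A0: "A \<in> sets circle0" by simp
  then have Ab: "A \<in> sets borel"
    by (auto simp: sets_circle0 sets_restrict_space)
  have "emeasure (distr circle0 circle0 (\<lambda>t. c * cnj t)) A
      = (\<integral>\<^sup>+ t. indicator A t \<partial>distr circle0 circle0 (\<lambda>t. c * cnj t))"
    using A by (simp only: nn_integral_indicator)
  also have "\<dots> = (\<integral>\<^sup>+ t. indicator A (c * cnj t) \<partial>circle0)"
    using A0 by (intro nn_integral_distr m) auto
  also have "\<dots> = (\<integral>\<^sup>+ t. indicator A t \<partial>circle0)"
    using Ab by (intro nn_integral_circle0_reflect c) auto
  also have "\<dots> = emeasure circle0 A"
    using A0 by simp
  finally show "emeasure (distr circle0 circle0 (\<lambda>t. c * cnj t)) A = emeasure circle0 A" .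
qed simp

lemma integral_circle_reflect:
  fixes g :: "complex \<Rightarrow> complex"
  assumes g: "g \<in> borel_measurable borel" and c: "cmod c = 1"
  shows "(LINT t|circle. g (c * cnj t)) = (LINT t|circle. g t)"
proof -
  have cont: "(\<lambda>t. c * cnj t) \<in> borel_measurable borel"
    by (intro borel_measurable_continuous_onI continuous_intros)
  have m: "(\<lambda>t. c * cnj t) \<in> measurable circle0 circle0"
    unfolding measurable_cong_sets[OF refl sets_circle0]
    by (rule measurable_restrict_space2)
       (use c in \<open>auto simp: space_circle0 norm_mult intro: measurable_circle0 cont\<close>)
  have "(LINT t|circle. g (c * cnj t)) = (LINT t|circle0. g (c * cnj t))"
    unfolding circle_eq
    by (rule integral_completion) (rule measurable_circle0[OF measurable_compose[OF cont g]])
  also have "\<dots> = (LINT t|distr circle0 circle0 (\<lambda>t. c * cnj t). g t)"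
    using m measurable_circle0[OF g] by (simp add: integral_distr)
  also have "\<dots> = (LINT t|circle. g t)"
    unfolding distr_circle0_reflect[OF c] circle_eq
    by (rule integral_completion[symmetric]) (rule measurable_circle0[OF g])
  finally show ?thesis .
qed

lemma powi_continuous_circle: "continuous_on (sphere 0 1) (\<lambda>t::complex. t powi k)"
  by (intro continuous_intros) auto

lemma powi_measurable [measurable]: "(\<lambda>t::complex. t powi k) \<in> borel_measurable borel"
  by (cases "0 \<le> k") (simp_all add: power_int_def)

text \<open>With b the mean of cnj(t)^k, reflection by any unimodular c shows that c^k * b is the
  wanted mean. Taking c = 1 and a c with c^k = -1 gives both b and -b, so the mean vanishes for k
  \<noteq> 0.\<close>

lemma integral_powi_circle:
  "(LINT t|circle. t powi k) = (if k = 0 then 1 else 0)"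
proof (cases "k = 0")
  case True
  then show ?thesis by simp
next
  case False
  define b where "b = (LINT t|circle. (cnj t) powi k)"
  have eq: "c powi k * b = (LINT t|circle. t powi k)" if "cmod c = 1" for c
  proof -
    have "(LINT t|circle. (c * cnj t) powi k) = (LINT t|circle. t powi k)"
      by (rule integral_circle_reflect) (use that in auto)
    then show ?thesis by (simp add: b_def power_int_mult_distrib)
  qed
  have "cis (pi / of_int k) powi k = -1"
    using False by (simp add: cis_power_int)
  then have "- b = (LINT t|circle. t powi k)" and "b = (LINT t|circle. t powi k)"
    using eq[of "cis (pi / of_int k)"] eq[of 1] by simp_all
  then show ?thesis using False
    by (metis add_self_div_2 add_neg_numeral_special(7) eq_neg_iff_add_eq_0 mult_2 mult_eq_0_iff zero_neq_numeral)
qed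

section \<open>The Riesz projection of a trigonometric polynomial\<close>

definition laurent :: "nat \<Rightarrow> (int \<Rightarrow> complex) \<Rightarrow> complex \<Rightarrow> complex" where
  "laurent n \<alpha> t = (\<Sum>k\<in>{-int n..int n}. \<alpha> k * t powi k)"

text \<open>The Riesz projection of \<open>laurent n \<alpha>\<close>, written on the coefficients:
  in this form it is defined at every point without a principal value.\<close>

definition laurent_plus :: "nat \<Rightarrow> (int \<Rightarrow> complex) \<Rightarrow> complex \<Rightarrow> complex" where
  "laurent_plus n \<alpha> t = (\<Sum>k\<in>{0..int n}. \<alpha> k * t powi k)"

lemma trig_polynomials_eq: "trig_polynomials = {p. \<exists>n \<alpha>. p = laurent n \<alpha>}"
  by (simp add: trig_polynomials_def laurent_def[abs_def])

lemma laurent_continuous: "continuous_on (sphere 0 1) (laurent n \<alpha>)"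
  unfolding laurent_def[abs_def]
  by (intro continuous_intros powi_continuous_circle) auto

lemma laurent_plus_continuous: "continuous_on (sphere 0 1) (laurent_plus n \<alpha>)"
  unfolding laurent_plus_def[abs_def]
  by (intro continuous_intros powi_continuous_circle) auto

lemma sets_circle0_Int: "A \<in> sets borel \<Longrightarrow> A \<inter> sphere 0 1 \<in> sets circle0"
  unfolding sets_circle0 sets_restrict_space by (metis Int_commute imageI)

lemma AE_circle_neq: "AE \<tau> in circle. \<tau> \<noteq> t"
proof -
  let ?A = "{t} \<inter> sphere 0 1"
  have s: "?A \<in> sets circle0"
    by (rule sets_circle0_Int) simp
  have b: "?A \<in> sets borel"
    by simp
  have "emeasure circle0 ?A = (\<integral>\<^sup>+ \<tau>. indicator ?A \<tau> \<partial>circle0)"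
    using s by (simp only: nn_integral_indicator)
  also have "\<dots> = (\<integral>\<^sup>+ \<theta>. indicator ?A (cis \<theta>) * indicator {0..<2 * pi} \<theta> \<partial>lborel) / ennreal (2 * pi)"
    by (rule nn_integral_circle0) (rule borel_measurable_indicator[OF b])
  also have "(\<integral>\<^sup>+ \<theta>. indicator ?A (cis \<theta>) * indicator {0..<2 * pi} \<theta> \<partial>lborel) = 0"
  proof -
    have "(\<integral>\<^sup>+ \<theta>. indicator ?A (cis \<theta>) * indicator {0..<2 * pi} \<theta> \<partial>lborel)
        \<le> (\<integral>\<^sup>+ \<theta>. indicator {Arg2pi t} \<theta> \<partial>lborel)"
    proof (rule nn_integral_mono)
      fix \<theta> :: real
      have "\<theta> = Arg2pi t" if "cis \<theta> = t" "0 \<le> \<theta>" "\<theta> < 2 * pi"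
        using Arg2pi_unique[of 1 \<theta> t] that by (simp add: cis_conv_exp)
      then show "indicator ?A (cis \<theta>) * indicator {0..<2 * pi} \<theta>
           \<le> (indicator {Arg2pi t} \<theta> :: ennreal)"
        by (cases "cis \<theta> = t \<and> 0 \<le> \<theta> \<and> \<theta> < 2 * pi") (auto simp: indicator_def)
    qed
    then show ?thesis by simp
  qed
  finally have "emeasure circle0 ?A = 0" by simp
  with s have "AE \<tau> in circle0. \<tau> \<notin> ?A"
    by (intro AE_not_in) (simp add: null_sets_def)
  then have "AE \<tau> in circle. \<tau> \<notin> ?A"
    unfolding circle_eq by (rule AE_completion)
  then show ?thesis
    by (rule AE_mp) (rule AE_I2, simp)
qed

text \<open>Points have measure zero, so the truncated integrands converge almost everywhere,
  dominated by |h|. This removes the truncation from the nonsingular terms of the recursion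
  below.\<close>

lemma tendsto_integral_off_point:
  fixes h :: "complex \<Rightarrow> complex"
  assumes h: "continuous_on (sphere 0 1) h"
  shows "((\<lambda>\<epsilon>. LINT \<tau>:{\<tau> \<in> sphere 0 1. \<epsilon> < dist \<tau> t}|circle. h \<tau>) \<longlongrightarrow> (LINT \<tau>|circle. h \<tau>)) (at_right (0::real))"
proof (rule tendsto_at_right_sequentially[of 0 1])
  fix S :: "nat \<Rightarrow> real"
  assume S: "\<And>n. 0 < S n" "S \<longlonglongrightarrow> 0"
  have E: "{\<tau> \<in> sphere 0 1. S n < dist \<tau> t} \<in> sets circle" for n
  proof -
    have "{\<tau>. S n < dist \<tau> t} \<in> sets borel"
      by (intro borel_open open_Collect_less continuous_intros)
    then have "{\<tau>. S n < dist \<tau> t} \<inter> sphere 0 1 \<in> sets circle0"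
      by (rule sets_circle0_Int)
    moreover have "{\<tau> \<in> sphere 0 1. S n < dist \<tau> t} = {\<tau>. S n < dist \<tau> t} \<inter> sphere 0 1"
      by (rule set_eqI) (simp only: Int_iff mem_Collect_eq conj_commute)
    ultimately have "{\<tau> \<in> sphere 0 1. S n < dist \<tau> t} \<in> sets circle0"
      by (simp only:)
    then show ?thesis unfolding circle_eq by auto
  qed
  show "(\<lambda>n. LINT \<tau>:{\<tau> \<in> sphere 0 1. S n < dist \<tau> t}|circle. h \<tau>) \<longlonglongrightarrow> (LINT \<tau>|circle. h \<tau>)"
    unfolding set_lebesgue_integral_def
  proof (rule integral_dominated_convergence)
    show hm: "h \<in> borel_measurable circle" by (rule continuous_measurable_circle[OF h])
    show "(\<lambda>\<tau>. indicator {\<tau> \<in> sphere 0 1. S n < dist \<tau> t} \<tau> *\<^sub>R h \<tau>) \<in> borel_measurable circle" for n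
      using E[of n] hm by simp
    show "integrable circle (\<lambda>\<tau>. cmod (h \<tau>))"
      using continuous_integrable_circle[OF h] by simp
    show "AE \<tau> in circle. (\<lambda>n. indicator {\<tau> \<in> sphere 0 1. S n < dist \<tau> t} \<tau> *\<^sub>R h \<tau>) \<longlonglongrightarrow> h \<tau>"
      using AE_circle_neq[of t] AE_space
    proof eventually_elim
      case (elim \<tau>)
      have "eventually (\<lambda>n. S n < dist \<tau> t) sequentially"
        using S(2) elim by (intro order_tendstoD(2)[of S 0]) auto
      then have "eventually (\<lambda>n. indicator {\<tau> \<in> sphere 0 1. S n < dist \<tau> t} \<tau> *\<^sub>R h \<tau> = h \<tau>) sequentially"
        using elim by (auto elim!: eventually_mono)
      then show ?case by (rule tendsto_eventually)
    qed
    show "AE \<tau> in circle. cmod (indicator {\<tau> \<in> sphere 0 1. S n < dist \<tau> t} \<tau> *\<^sub>R h \<tau>) \<le> cmod (h \<tau>)" for n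
      by (auto simp: indicator_def)
  qed
qed auto

lemma Cauchy_kernel_integrable:
  assumes "0 < \<epsilon>" and h: "continuous_on (sphere 0 1) h" and "h \<in> borel_measurable borel"
  shows "integrable circle (\<lambda>\<tau>. indicator {\<tau> \<in> sphere 0 1. \<epsilon> < dist \<tau> t} \<tau> *\<^sub>R (h \<tau> / (\<tau> - t)))"
proof -
  note assms(3)[measurable]
  have [measurable]: "{\<tau> \<in> sphere 0 1. \<epsilon> < dist \<tau> t} \<in> sets borel" by measurable
  have m: "(\<lambda>\<tau>. indicator {\<tau> \<in> sphere 0 1. \<epsilon> < dist \<tau> t} \<tau> *\<^sub>R (h \<tau> / (\<tau> - t))) \<in> borel_measurable circle"
    by (rule measurable_circleI) measurable
  show ?thesis
  proof (rule Bochner_Integration.integrable_bound[OF _ m])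
    show "integrable circle (\<lambda>\<tau>. h \<tau> / \<epsilon>)"
      using continuous_integrable_circle[OF h] by simp
    show "AE \<tau> in circle. cmod (indicator {\<tau> \<in> sphere 0 1. \<epsilon> < dist \<tau> t} \<tau> *\<^sub>R (h \<tau> / (\<tau> - t))) \<le> cmod (h \<tau> / \<epsilon>)"
      using \<open>0 < \<epsilon>\<close>
      by (intro AE_I2) (auto simp: indicator_def norm_divide dist_norm intro!: divide_left_mono mult_pos_pos)
  qed
qed

section \<open>Truncated Cauchy integrals of monomials\<close>

definition truncated_cauchy :: "complex \<Rightarrow> int \<Rightarrow> real \<Rightarrow> complex" where
  "truncated_cauchy t k \<epsilon> =
    circle_line_integral {\<tau> \<in> sphere 0 1. \<epsilon> < dist \<tau> t} (\<lambda>\<tau>. \<tau> powi k / (\<tau> - t))"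

lemma truncated_cauchy_integrable:
  assumes "0 < \<epsilon>"
  shows "set_integrable circle {\<tau> \<in> sphere 0 1. \<epsilon> < dist \<tau> t}
    (\<lambda>\<tau>. \<tau> powi k / (\<tau> - t) * (2 * of_real pi * \<i> * \<tau>))"
proof -
  have "integrable circle (\<lambda>\<tau>. indicator {\<tau> \<in> sphere 0 1. \<epsilon> < dist \<tau> t} \<tau> *\<^sub>R
     ((\<tau> powi k * (2 * of_real pi * \<i> * \<tau>)) / (\<tau> - t)))"
    by (intro Cauchy_kernel_integrable assms continuous_intros powi_continuous_circle) measurable
  then show ?thesis unfolding set_integrable_def by (simp add: field_simps)
qed

text \<open>From \<tau> / (\<tau> - t) = 1 + t / (\<tau> - t): raising the exponent splits off a
  nonsingular integral. Only the exponent 0 then needs an argument about the singularity.\<close>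

lemma truncated_cauchy_step:
  assumes "0 < \<epsilon>"
  shows "truncated_cauchy t (k + 1) \<epsilon> =
    (LINT \<tau>:{\<tau> \<in> sphere 0 1. \<epsilon> < dist \<tau> t}|circle. 2 * of_real pi * \<i> * \<tau> powi (k + 1)) + t * truncated_cauchy t k \<epsilon>"
proof -
  let ?E = "{\<tau> \<in> sphere 0 1. \<epsilon> < dist \<tau> t}"
  have [measurable]: "?E \<in> sets borel" by measurable
  have pw: "indicator ?E \<tau> *\<^sub>R (\<tau> powi (k + 1) / (\<tau> - t) * (2 * of_real pi * \<i> * \<tau>))
     = indicator ?E \<tau> *\<^sub>R (2 * of_real pi * \<i> * \<tau> powi (k + 1)) +
       t * (indicator ?E \<tau> *\<^sub>R (\<tau> powi k / (\<tau> - t) * (2 * of_real pi * \<i> * \<tau>)))" for \<tau>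
  proof (cases "\<tau> \<in> ?E")
    case True
    then have "\<tau> \<noteq> 0" "\<tau> \<noteq> t" using assms by auto
    then show ?thesis using True
      by (simp add: power_int_add divide_simps) (simp add: algebra_simps)
  qed auto
  have i1: "integrable circle (\<lambda>\<tau>. indicator ?E \<tau> *\<^sub>R (2 * of_real pi * \<i> * \<tau> powi (k + 1)))"
  proof (rule Bochner_Integration.integrable_bound)
    show "integrable circle (\<lambda>\<tau>. 2 * of_real pi * \<i> * \<tau> powi (k + 1))"
      by (intro continuous_integrable_circle continuous_intros powi_continuous_circle)
    show "(\<lambda>\<tau>. indicator ?E \<tau> *\<^sub>R (2 * of_real pi * \<i> * \<tau> powi (k + 1))) \<in> borel_measurable circle"
      by (rule measurable_circleI) measurable
  qed (auto simp: indicator_def)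
  let ?v = "\<lambda>\<tau>. indicator ?E \<tau> *\<^sub>R (\<tau> powi k / (\<tau> - t) * (2 * of_real pi * \<i> * \<tau>))"
  have i2: "integrable circle ?v"
    using truncated_cauchy_integrable[OF assms, of t k] unfolding set_integrable_def .
  show ?thesis
    unfolding truncated_cauchy_def circle_line_integral_def set_lebesgue_integral_def pw
    by (subst Bochner_Integration.integral_add[OF i1 integrable_mult_right[OF i2]])
       (simp only: integral_mult_right_zero)
qed

text \<open>The reflection \<open>\<tau> \<mapsto> t\<^sup>2 / \<tau>\<close> preserves the measure and the truncation, and
  \<open>\<tau> / (\<tau> - t)\<close> and its reflection add up to 1.\<close>

lemma truncated_cauchy_0:
  assumes "0 < \<epsilon>" "cmod t = 1"
  shows "truncated_cauchy t 0 \<epsilon> = (LINT \<tau>:{\<tau> \<in> sphere 0 1. \<epsilon> < dist \<tau> t}|circle. of_real pi * \<i>)"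
proof -
  let ?E = "{\<tau> \<in> sphere 0 1. \<epsilon> < dist \<tau> t}"
  have [measurable]: "?E \<in> sets borel" by measurable
  define g where "g \<tau> = indicator ?E \<tau> *\<^sub>R (\<tau> / (\<tau> - t))" for \<tau>
  have gm [measurable]: "g \<in> borel_measurable borel" unfolding g_def by measurable
  have gi: "integrable circle g"
    unfolding g_def by (intro Cauchy_kernel_integrable assms continuous_intros) auto
  have pw: "g (t\<^sup>2 * cnj \<tau>) = indicator ?E \<tau> - g \<tau>" if \<tau>: "\<tau> \<in> sphere 0 1" for \<tau>
  proof -
    have n: "\<tau> \<noteq> 0" "t \<noteq> 0" "cmod \<tau> = 1" using \<tau> assms by auto
    have c: "cnj \<tau> = 1 / \<tau>"
      using n(1,3) by (simp add: field_simps complex_norm_square[symmetric])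
    have e: "t\<^sup>2 * cnj \<tau> - t = t * (t - \<tau>) / \<tau>"
      using n by (simp add: c field_simps power2_eq_square)
    have d: "dist (t\<^sup>2 * cnj \<tau>) t = dist \<tau> t"
      unfolding dist_norm e using n assms by (simp add: norm_mult norm_divide norm_minus_commute)
    have "t\<^sup>2 * cnj \<tau> \<in> ?E \<longleftrightarrow> \<tau> \<in> ?E"
      using d n assms by (auto simp: norm_mult norm_power)
    moreover have "(t\<^sup>2 * cnj \<tau>) / (t\<^sup>2 * cnj \<tau> - t) = 1 - \<tau> / (\<tau> - t)" if "\<tau> \<in> ?E"
    proof -
      have "\<tau> \<noteq> t" using that assms by auto
      then show ?thesis
        unfolding e unfolding c using n by (simp add: divide_simps) (simp add: algebra_simps power2_eq_square)
    qed
    ultimately show ?thesis by (auto simp: g_def indicator_def)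
  qed
  have Ei: "integrable circle (\<lambda>\<tau>. indicator ?E \<tau> :: complex)"
    by (rule circle.integrable_const_bound[of _ 1]) (auto simp: indicator_def intro: measurable_circleI)
  have "(LINT \<tau>|circle. g \<tau>) = (LINT \<tau>|circle. g (t\<^sup>2 * cnj \<tau>))"
    by (rule integral_circle_reflect[symmetric]) (use assms in \<open>auto simp: norm_power\<close>)
  also have "\<dots> = (LINT \<tau>|circle. indicator ?E \<tau> - g \<tau>)"
    using pw by (intro Bochner_Integration.integral_cong) auto
  also have "\<dots> = (LINT \<tau>|circle. indicator ?E \<tau>) - (LINT \<tau>|circle. g \<tau>)"
    using Ei gi by simp
  finally have 2: "2 * (LINT \<tau>|circle. g \<tau>) = (LINT \<tau>|circle. indicator ?E \<tau>)" by simp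
  have "truncated_cauchy t 0 \<epsilon> = (LINT \<tau>|circle. of_real pi * \<i> * (2 * g \<tau>))"
    unfolding truncated_cauchy_def circle_line_integral_def set_lebesgue_integral_def g_def
    by (intro Bochner_Integration.integral_cong) (auto simp: field_simps)
  also have "\<dots> = of_real pi * \<i> * (LINT \<tau>|circle. indicator ?E \<tau>)"
    using 2 by simp
  also have "\<dots> = (LINT \<tau>|circle. of_real pi * \<i> * indicator ?E \<tau>)" by simp
  also have "\<dots> = (LINT \<tau>:?E|circle. of_real pi * \<i>)"
    unfolding set_lebesgue_integral_def
    by (intro Bochner_Integration.integral_cong) (auto simp: indicator_def)
  finally show ?thesis .
qed

text \<open>The recursion is run upwards and downwards from k = 0. Its inhomogeneous term tends to 2
  pi i times the mean of \<tau>^k, hence to 0 for k \<noteq> 0; the step from 0 down to -1 subtracts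
  2 pi i and turns pi i into -pi i.\<close>

lemma truncated_cauchy_tendsto:
  assumes t: "cmod t = 1"
  shows "(truncated_cauchy t k \<longlongrightarrow> (if k \<ge> 0 then 1 else -1) * (of_real pi * \<i> * t powi k)) (at_right 0)"
proof -
  define b where "b k = (if k = 0 then 2 * of_real pi * \<i> else 0 :: complex)" for k :: int
  define c where "c k \<epsilon> = (LINT \<tau>:{\<tau> \<in> sphere 0 1. \<epsilon> < dist \<tau> t}|circle. 2 * of_real pi * \<i> * \<tau> powi k)" for k :: int and \<epsilon>
  have t0: "t \<noteq> 0" using t by auto
  have c_lim: "(c k \<longlongrightarrow> b k) (at_right 0)" for k
  proof -
    have "(c k \<longlongrightarrow> (LINT \<tau>|circle. 2 * of_real pi * \<i> * \<tau> powi k)) (at_right 0)"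
      unfolding c_def by (intro tendsto_integral_off_point continuous_intros powi_continuous_circle)
    then show ?thesis
      by (cases "k = 0") (simp_all add: integral_powi_circle b_def)
  qed
  have pos: "eventually (\<lambda>\<epsilon>. 0 < \<epsilon>) (at_right (0::real))"
    by (simp add: eventually_at_right_less)
  have step: "eventually (\<lambda>\<epsilon>. truncated_cauchy t (k + 1) \<epsilon> = c (k + 1) \<epsilon> + t * truncated_cauchy t k \<epsilon>) (at_right 0)" for k
    using pos by eventually_elim (simp add: truncated_cauchy_step c_def)
  show ?thesis
  proof (induction k rule: int_induct[of _ 0])
    case base
    have "((\<lambda>\<epsilon>. LINT \<tau>:{\<tau> \<in> sphere 0 1. \<epsilon> < dist \<tau> t}|circle. of_real pi * \<i>) \<longlongrightarrow> (LINT \<tau>|circle. of_real pi * \<i>)) (at_right 0)"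
      by (intro tendsto_integral_off_point continuous_intros)
    moreover have "eventually (\<lambda>\<epsilon>. (LINT \<tau>:{\<tau> \<in> sphere 0 1. \<epsilon> < dist \<tau> t}|circle. of_real pi * \<i>) = truncated_cauchy t 0 \<epsilon>) (at_right 0)"
      using pos by eventually_elim (simp add: truncated_cauchy_0 t)
    ultimately have "(truncated_cauchy t 0 \<longlongrightarrow> (LINT \<tau>|circle. of_real pi * \<i>)) (at_right 0)"
      by (rule Lim_transform_eventually)
    then show ?case by simp
  next
    case (step1 k)
    have "((\<lambda>\<epsilon>. c (k + 1) \<epsilon> + t * truncated_cauchy t k \<epsilon>) \<longlongrightarrow> b (k + 1) + t * ((if k \<ge> 0 then 1 else -1) * (of_real pi * \<i> * t powi k))) (at_right 0)"
      by (intro tendsto_intros c_lim step1.IH)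
    then have "(truncated_cauchy t (k + 1) \<longlongrightarrow> b (k + 1) + t * ((if k \<ge> 0 then 1 else -1) * (of_real pi * \<i> * t powi k))) (at_right 0)"
      by (rule Lim_transform_eventually) (use step[of k] in \<open>auto elim: eventually_mono\<close>)
    then show ?case using step1.hyps t0 by (simp add: b_def power_int_add mult_ac)
  next
    case (step2 k)
    have "((\<lambda>\<epsilon>. (truncated_cauchy t k \<epsilon> - c k \<epsilon>) / t) \<longlongrightarrow> ((if k \<ge> 0 then 1 else -1) * (of_real pi * \<i> * t powi k) - b k) / t) (at_right 0)"
      by (intro tendsto_intros c_lim step2.IH t0)
    then have "(truncated_cauchy t (k - 1) \<longlongrightarrow> ((if k \<ge> 0 then 1 else -1) * (of_real pi * \<i> * t powi k) - b k) / t) (at_right 0)"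
      by (rule Lim_transform_eventually) (use step[of "k - 1"] t0 in \<open>auto elim!: eventually_mono\<close>)
    then show ?case using step2.hyps t0 by (auto simp: b_def power_int_diff mult_ac split: if_splits)
  qed
qed

text \<open>The singular integral multiplies t^k by 1 for k \<ge> 0 and by -1 for k < 0, so its
  half-sum with the identity keeps exactly the nonnegative frequencies.\<close>

lemma riesz_projection_laurent:
  assumes t: "cmod t = 1"
  shows "riesz_projection (laurent n \<alpha>) t = laurent_plus n \<alpha> t"
proof -
  let ?s = "\<lambda>k::int. if k \<ge> 0 then 1 else -1 :: complex"
  let ?E = "\<lambda>\<epsilon>. {\<tau> \<in> sphere 0 1. \<epsilon> < dist \<tau> t}"
  have eq: "circle_line_integral (?E \<epsilon>) (\<lambda>\<tau>. laurent n \<alpha> \<tau> / (\<tau> - t))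
      = (\<Sum>k\<in>{-int n..int n}. \<alpha> k * truncated_cauchy t k \<epsilon>)" if "0 < \<epsilon>" for \<epsilon>
  proof -
    have "circle_line_integral (?E \<epsilon>) (\<lambda>\<tau>. laurent n \<alpha> \<tau> / (\<tau> - t)) =
      (LINT \<tau>|circle. (\<Sum>k\<in>{-int n..int n}. \<alpha> k * (indicator (?E \<epsilon>) \<tau> *\<^sub>R (\<tau> powi k / (\<tau> - t) * (2 * of_real pi * \<i> * \<tau>)))))"
      unfolding circle_line_integral_def set_lebesgue_integral_def laurent_def
      by (intro Bochner_Integration.integral_cong)
         (auto simp: indicator_def sum_divide_distrib sum_distrib_right mult.assoc)
    also have "\<dots> = (\<Sum>k\<in>{-int n..int n}. \<alpha> k * truncated_cauchy t k \<epsilon>)"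
      unfolding truncated_cauchy_def circle_line_integral_def set_lebesgue_integral_def
      by (subst Bochner_Integration.integral_sum)
         (rule integrable_mult_right truncated_cauchy_integrable[OF that, unfolded set_integrable_def]
           | simp only: integral_mult_right_zero)+
    finally show ?thesis .
  qed
  have "((\<lambda>\<epsilon>. \<Sum>k\<in>{-int n..int n}. \<alpha> k * truncated_cauchy t k \<epsilon>) \<longlongrightarrow>
      (\<Sum>k\<in>{-int n..int n}. \<alpha> k * (?s k * (of_real pi * \<i> * t powi k)))) (at_right 0)"
    by (intro tendsto_intros truncated_cauchy_tendsto t)
  then have "((\<lambda>\<epsilon>. circle_line_integral (?E \<epsilon>) (\<lambda>\<tau>. laurent n \<alpha> \<tau> / (\<tau> - t))) \<longlongrightarrow>
      (\<Sum>k\<in>{-int n..int n}. \<alpha> k * (?s k * (of_real pi * \<i> * t powi k)))) (at_right 0)"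
  proof (rule Lim_transform_eventually)
    have "eventually (\<lambda>\<epsilon>. 0 < \<epsilon>) (at_right (0::real))"
      by (simp add: eventually_at_right_less)
    then show "eventually (\<lambda>\<epsilon>. (\<Sum>k\<in>{-int n..int n}. \<alpha> k * truncated_cauchy t k \<epsilon>)
        = circle_line_integral (?E \<epsilon>) (\<lambda>\<tau>. laurent n \<alpha> \<tau> / (\<tau> - t))) (at_right 0)"
      by eventually_elim (simp only: eq)
  qed
  then have "cauchy_singular (laurent n \<alpha>) t =
      1 / (of_real pi * \<i>) * (\<Sum>k\<in>{-int n..int n}. \<alpha> k * (?s k * (of_real pi * \<i> * t powi k)))"
    unfolding cauchy_singular_def by (subst tendsto_Lim) auto
  also have "\<dots> = (\<Sum>k\<in>{-int n..int n}. ?s k * (\<alpha> k * t powi k))"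
  proof -
    have cancel: "1 / c * (a * (s * (c * x))) = s * (a * x)" if "c \<noteq> 0" for a c s x :: complex
      using that by simp
    then show ?thesis
      unfolding sum_distrib_left by (intro sum.cong refl) (rule cancel, simp)
  qed
  finally have "riesz_projection (laurent n \<alpha>) t = (\<Sum>k\<in>{-int n..int n}. (\<alpha> k * t powi k + ?s k * (\<alpha> k * t powi k)) / 2)"
    by (simp add: riesz_projection_def laurent_def sum.distrib add_divide_distrib flip: sum_divide_distrib)
  also have "\<dots> = (\<Sum>k\<in>{0..int n}. \<alpha> k * t powi k)"
    by (intro sum.mono_neutral_cong_right) auto
  finally show ?thesis by (simp add: laurent_plus_def)
qed

section \<open>Approximation by trigonometric polynomials\<close>

lemma cnj_on_circle:
  assumes "cmod t = 1"
  shows "cnj t = inverse t"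
proof -
  have "t \<noteq> 0" using assms by auto
  then show ?thesis using assms by (simp add: field_simps complex_norm_square[symmetric])
qed

lemma sum_int_symmetric:
  fixes f :: "int \<Rightarrow> 'a::comm_monoid_add"
  shows "(\<Sum>k\<in>{-int n..int n}. f k) = f 0 + (\<Sum>k=1..n. f (int k) + f (- int k))"
proof (induction n)
  case (Suc n)
  have "{-int (Suc n)..int (Suc n)} = insert (int (Suc n)) (insert (- int (Suc n)) {-int n..int n})"
    by auto
  then have "(\<Sum>k\<in>{-int (Suc n)..int (Suc n)}. f k) =
      f (int (Suc n)) + (f (- int (Suc n)) + (\<Sum>k\<in>{-int n..int n}. f k))"
    by simp
  then show ?case using Suc by (simp add: ac_simps)
qed simp

lemma sum_int_nonneg: "(\<Sum>k\<in>{0..int n}. f k) = (\<Sum>k\<le>n. f (int k))"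
  by (rule sum.reindex_bij_witness[of _ int nat]) auto

text \<open>Agreement is required on the circle only: products of Laurent sums collapse to Laurent
  sums only away from 0, and cnj t is t^(-1) only for |t| = 1.\<close>

definition trig_on_circle :: "(complex \<Rightarrow> complex) \<Rightarrow> bool" where
  "trig_on_circle p \<longleftrightarrow> (\<exists>n \<alpha>. \<forall>t\<in>sphere 0 1. p t = laurent n \<alpha> t)"

lemma laurent_extend:
  assumes "n \<le> m"
  shows "laurent n \<alpha> = laurent m (\<lambda>k. if \<bar>k\<bar> \<le> int n then \<alpha> k else 0)"
proof
  fix t
  show "laurent n \<alpha> t = laurent m (\<lambda>k. if \<bar>k\<bar> \<le> int n then \<alpha> k else 0) t"
    unfolding laurent_def using assms by (intro sum.mono_neutral_cong_left) auto
qed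

lemma trig_on_circle_add:
  assumes "trig_on_circle p" "trig_on_circle q"
  shows "trig_on_circle (\<lambda>t. p t + q t)"
proof -
  obtain n \<alpha> m \<beta> where p: "\<forall>t\<in>sphere 0 1. p t = laurent n \<alpha> t" and q: "\<forall>t\<in>sphere 0 1. q t = laurent m \<beta> t"
    using assms by (auto simp: trig_on_circle_def)
  define \<gamma> where "\<gamma> k = (if \<bar>k\<bar> \<le> int n then \<alpha> k else 0) + (if \<bar>k\<bar> \<le> int m then \<beta> k else 0)" for k
  have "laurent n \<alpha> t + laurent m \<beta> t = laurent (max n m) \<gamma> t" for t
    unfolding laurent_extend[of n "max n m", simplified] laurent_extend[of m "max n m", simplified]
    by (simp add: laurent_def \<gamma>_def sum.distrib distrib_right)
  then show ?thesis using p q unfolding trig_on_circle_def by auto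
qed

lemma trig_on_circle_monomial: "trig_on_circle (\<lambda>t. c * t powi k)"
proof -
  have "c * t powi k = laurent (nat \<bar>k\<bar>) (\<lambda>j. if j = k then c else 0) t" for t
    unfolding laurent_def by (subst sum.remove[of _ k]) (auto intro!: sum.neutral)
  then show ?thesis unfolding trig_on_circle_def by blast
qed

lemma trig_on_circle_sum:
  "(\<And>i. i \<in> I \<Longrightarrow> trig_on_circle (f i)) \<Longrightarrow> trig_on_circle (\<lambda>t. \<Sum>i\<in>I. f i t)"
proof (induction I rule: infinite_finite_induct)
  case (insert i I)
  then show ?case by (simp add: trig_on_circle_add)
qed (use trig_on_circle_monomial[of 0 0] in auto)

lemma trig_on_circle_cong:
  "trig_on_circle p \<Longrightarrow> (\<And>t. cmod t = 1 \<Longrightarrow> q t = p t) \<Longrightarrow> trig_on_circle q"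
  unfolding trig_on_circle_def by auto

lemma trig_on_circle_mult:
  assumes "trig_on_circle p" "trig_on_circle q"
  shows "trig_on_circle (\<lambda>t. p t * q t)"
proof -
  obtain n \<alpha> m \<beta> where p: "\<forall>t\<in>sphere 0 1. p t = laurent n \<alpha> t" and q: "\<forall>t\<in>sphere 0 1. q t = laurent m \<beta> t"
    using assms by (auto simp: trig_on_circle_def)
  have "trig_on_circle (\<lambda>t. \<Sum>i\<in>{-int n..int n}. \<Sum>j\<in>{-int m..int m}. (\<alpha> i * \<beta> j) * t powi (i + j))"
    by (intro trig_on_circle_sum trig_on_circle_monomial)
  then show ?thesis
  proof (rule trig_on_circle_cong)
    fix t :: complex assume t: "cmod t = 1"
    then have "t \<noteq> 0" by auto
    then show "p t * q t = (\<Sum>i\<in>{-int n..int n}. \<Sum>j\<in>{-int m..int m}. (\<alpha> i * \<beta> j) * t powi (i + j))"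
      using p q t by (simp add: laurent_def sum_product power_int_add mult_ac)
  qed
qed

text \<open>Links the Stone-Weierstrass theorem for real polynomials in the plane with Laurent sums.
  Since sums and products are settled, only real-linear functionals need work, and these are
  combinations of t and cnj t.\<close>

lemma trig_on_circle_real_polynomial:
  "real_polynomial_function g \<Longrightarrow> trig_on_circle (\<lambda>t. of_real (g t))"
proof (induction rule: real_polynomial_function.induct)
  case (linear f)
  interpret bounded_linear f by fact
  \<comment> \<open>The coefficients come from Re t = (t + t^(-1)) / 2 and Im t = (t - t^(-1)) / (2
    i).\<close>
  have "trig_on_circle (\<lambda>t. (of_real (f 1) / 2 - \<i> * of_real (f \<i>) / 2) * t powi 1
      + (of_real (f 1) / 2 + \<i> * of_real (f \<i>) / 2) * t powi (-1))"
    by (intro trig_on_circle_add trig_on_circle_monomial)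
  then show ?case
  proof (rule trig_on_circle_cong)
    fix t :: complex assume t: "cmod t = 1"
    then have n: "t \<noteq> 0" by auto
    have c: "t powi (-1) = cnj t"
      using cnj_on_circle[OF t] by (simp add: power_int_minus)
    have "t = Re t *\<^sub>R 1 + Im t *\<^sub>R \<i>" by (simp add: complex_eq_iff)
    then have "f t = Re t * f 1 + Im t * f \<i>"
      by (metis add scaleR real_scaleR_def)
    then show "of_real (f t) = (of_real (f 1) / 2 - \<i> * of_real (f \<i>) / 2) * t powi 1
      + (of_real (f 1) / 2 + \<i> * of_real (f \<i>) / 2) * t powi (-1)"
      unfolding c by (simp add: complex_eq_iff algebra_simps)
  qed
next
  case (const c)
  show ?case using trig_on_circle_monomial[of "of_real c" 0] by simp
qed (simp_all add: trig_on_circle_add trig_on_circle_mult)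

lemma laurent_approx_real:
  fixes f :: "complex \<Rightarrow> real"
  assumes "continuous_on (sphere 0 1) f" "0 < e"
  obtains n \<alpha> where "\<And>t. cmod t = 1 \<Longrightarrow> cmod (of_real (f t) - laurent n \<alpha> t) < e"
proof -
  obtain g where g: "real_polynomial_function g" "\<And>x. x \<in> sphere 0 1 \<Longrightarrow> \<bar>f x - g x\<bar> < e"
    using Stone_Weierstrass_real_polynomial_function[OF compact_sphere assms] by blast
  obtain n \<alpha> where "\<forall>t\<in>sphere 0 1. of_real (g t) = laurent n \<alpha> t"
    using trig_on_circle_real_polynomial[OF g(1)] by (auto simp: trig_on_circle_def)
  then have "cmod (of_real (f t) - laurent n \<alpha> t) < e" if "cmod t = 1" for t
    using g(2)[of t] that by (metis dist_0_norm mem_sphere norm_of_real of_real_diff)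
  then show thesis by (rule that)
qed

lemma laurent_approx:
  fixes f :: "complex \<Rightarrow> complex"
  assumes "continuous_on (sphere 0 1) f" "0 < e"
  obtains n \<alpha> where "\<And>t. cmod t = 1 \<Longrightarrow> cmod (f t - laurent n \<alpha> t) < e"
proof -
  obtain n \<alpha> where 1: "\<And>t. cmod t = 1 \<Longrightarrow> cmod (of_real (Re (f t)) - laurent n \<alpha> t) < e / 2"
    using laurent_approx_real[of "\<lambda>t. Re (f t)" "e / 2"] assms by (auto intro: continuous_intros)
  obtain m \<beta> where 2: "\<And>t. cmod t = 1 \<Longrightarrow> cmod (of_real (Im (f t)) - laurent m \<beta> t) < e / 2"
    using laurent_approx_real[of "\<lambda>t. Im (f t)" "e / 2"] assms by (auto intro: continuous_intros)
  have "trig_on_circle (\<lambda>t. laurent n \<alpha> t + (\<i> * t powi 0) * laurent m \<beta> t)"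
    by (intro trig_on_circle_add trig_on_circle_mult trig_on_circle_monomial) (auto simp: trig_on_circle_def)
  then obtain l \<gamma> where 3: "\<forall>t\<in>sphere 0 1. laurent n \<alpha> t + \<i> * laurent m \<beta> t = laurent l \<gamma> t"
    by (auto simp: trig_on_circle_def)
  have "cmod (f t - laurent l \<gamma> t) < e" if t: "cmod t = 1" for t
  proof -
    have "f t - laurent l \<gamma> t = (of_real (Re (f t)) - laurent n \<alpha> t) + \<i> * (of_real (Im (f t)) - laurent m \<beta> t)"
      using 3 t by (subst (1) complex_eq[of "f t"]) (simp add: algebra_simps)
    then have "cmod (f t - laurent l \<gamma> t) \<le> cmod (of_real (Re (f t)) - laurent n \<alpha> t) + cmod (of_real (Im (f t)) - laurent m \<beta> t)"
      by (metis norm_triangle_ineq norm_mult norm_ii mult_1)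
    then show ?thesis using 1[OF t] 2[OF t] by simp
  qed
  then show thesis by (rule that)
qed

section \<open>Orthogonality of monomials\<close>

lemma integral_monomials:
  "(LINT t|circle. t powi i * cnj (t powi j)) = (if i = j then 1 else 0)"
proof -
  have "(LINT t|circle. t powi i * cnj (t powi j)) = (LINT t|circle. t powi (i - j))"
  proof (intro Bochner_Integration.integral_cong refl)
    fix t assume "t \<in> space circle"
    then have t: "cmod t = 1" "t \<noteq> 0" by auto
    then have "cnj t = inverse t" by (intro cnj_on_circle)
    then show "t powi i * cnj (t powi j) = t powi (i - j)"
      using t by (simp add: power_int_diff power_int_inverse divide_inverse)
  qed
  then show ?thesis by (simp add: integral_powi_circle)
qed

lemma integral_sum_monomials:
  assumes "finite I" "finite J"
  shows "(LINT t|circle. (\<Sum>i\<in>I. \<alpha> i * t powi i) * cnj (\<Sum>j\<in>J. \<beta> j * t powi j)) = (\<Sum>k\<in>I \<inter> J. \<alpha> k * cnj (\<beta> k))"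
proof -
  have i: "integrable circle (\<lambda>t. (\<alpha> i * cnj (\<beta> j)) * (t powi i * cnj (t powi j)))" for i j
    by (intro continuous_integrable_circle continuous_intros powi_continuous_circle)
  have "(LINT t|circle. (\<Sum>i\<in>I. \<alpha> i * t powi i) * cnj (\<Sum>j\<in>J. \<beta> j * t powi j))
     = (LINT t|circle. (\<Sum>i\<in>I. \<Sum>j\<in>J. (\<alpha> i * cnj (\<beta> j)) * (t powi i * cnj (t powi j))))"
    by (simp add: sum_product mult_ac)
  also have "\<dots> = (\<Sum>i\<in>I. \<Sum>j\<in>J. (\<alpha> i * cnj (\<beta> j)) * (LINT t|circle. t powi i * cnj (t powi j)))"
    using i by (subst Bochner_Integration.integral_sum; (intro Bochner_Integration.integrable_sum)?)
      (auto simp del: complex_cnj_power_int)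
  also have "\<dots> = (\<Sum>i\<in>I. \<Sum>j\<in>J. if i = j then \<alpha> i * cnj (\<beta> i) else 0)"
    by (intro sum.cong refl) (simp add: integral_monomials del: complex_cnj_power_int)
  also have "\<dots> = (\<Sum>i\<in>I. if i \<in> J then \<alpha> i * cnj (\<beta> i) else 0)"
    using assms by (intro sum.cong refl) (simp add: sum.delta')
  also have "\<dots> = (\<Sum>k\<in>I \<inter> J. \<alpha> k * cnj (\<beta> k))"
    using assms by (simp add: sum.inter_restrict)
  finally show ?thesis .
qed

text \<open>By orthogonality both sides are the sum of \<open>\<alpha> k * cnj (\<beta> k)\<close>
  over 0 \<le> k \<le> min n m. This self-adjointness is what moves the projection across the
  pairing in the duality argument.\<close>

lemma pairing_laurent_plus:
  "pairing (laurent n \<alpha>) (laurent_plus m \<beta>) = pairing (laurent_plus n \<alpha>) (laurent m \<beta>)"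
proof -
  have "{-int n..int n} \<inter> {0..int m} = {0..int n} \<inter> {-int m..int m}" by auto
  then show ?thesis
    unfolding pairing_def laurent_def laurent_plus_def by (simp add: integral_sum_monomials del: cnj_sum)
qed

lemma integral_laurent: "(LINT t|circle. laurent n \<alpha> t) = \<alpha> 0"
  using integral_sum_monomials[of "{-int n..int n}" "{0}" \<alpha> "\<lambda>_. 1"]
  by (simp add: laurent_def)

section \<open>Conjugate functions\<close>

text \<open>On the circle Im Q = (Q - cnj Q) / (2 i) for the analytic polynomial Q, and cnj Q has
  only frequencies \<le> 0. Projecting Im Q therefore recovers Q up to constants, and with it a real
  part that may be large although Im Q is bounded.\<close>

lemma laurent_conjugate_parts:
  fixes a :: "nat \<Rightarrow> complex"
  obtains \<alpha> where
    "\<And>t. cmod t = 1 \<Longrightarrow> laurent n \<alpha> t = of_real (Im (\<Sum>k\<le>n. a k * t ^ k))"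
    "\<And>t. laurent_plus n \<alpha> t = ((\<Sum>k\<le>n. a k * t ^ k) - a 0) / (2 * \<i>) + of_real (Im (a 0))"
proof -
  define \<alpha> where "\<alpha> k = (if k = 0 then of_real (Im (a 0)) else if k > 0 then a (nat k) / (2 * \<i>)
     else - cnj (a (nat (- k))) / (2 * \<i>))" for k :: int
  have *: "(\<Sum>k\<le>n. b k) = b 0 + (\<Sum>k=1..n. b k)" for b :: "nat \<Rightarrow> complex"
    by (simp add: sum.atMost_shift lessThan_Suc_atMost sum.atLeast1_atMost_eq)
  have "laurent n \<alpha> t = of_real (Im (\<Sum>k\<le>n. a k * t ^ k))" if t: "cmod t = 1" for t
  proof -
    have t': "t \<noteq> 0" "cnj t = inverse t"
      using t cnj_on_circle[OF t] by auto
    have im: "(w - cnj w) / (2 * \<i>) = of_real (Im w)" for w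
      by (simp add: complex_eq_iff)
    have "laurent n \<alpha> t = of_real (Im (a 0)) + (\<Sum>k=1..n. of_real (Im (a k * t ^ k)))"
      unfolding laurent_def sum_int_symmetric
    proof (intro arg_cong2[of _ _ _ _ "(+)"] sum.cong refl)
      fix k :: nat assume k: "k \<in> {1..n}"
      have "t powi (- int k) = cnj (t ^ k)"
        using t' by (simp add: power_int_minus power_inverse)
      then have "\<alpha> (int k) * t powi int k + \<alpha> (- int k) * t powi - int k
         = (a k * t ^ k - cnj (a k * t ^ k)) / (2 * \<i>)"
        using k by (simp add: \<alpha>_def diff_divide_distrib right_diff_distrib mult.assoc)
      also have "\<dots> = of_real (Im (a k * t ^ k))"
        by (rule im)
      finally show "\<alpha> (int k) * t powi int k + \<alpha> (- int k) * t powi - int k = of_real (Im (a k * t ^ k))" .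
    qed (simp add: \<alpha>_def)
    then show ?thesis by (simp add: *)
  qed
  moreover have "laurent_plus n \<alpha> t = ((\<Sum>k\<le>n. a k * t ^ k) - a 0) / (2 * \<i>) + of_real (Im (a 0))" for t
    by (simp add: laurent_plus_def sum_int_nonneg * \<alpha>_def sum_divide_distrib sum_distrib_left mult.assoc sum_negf)
  ultimately show thesis by (rule that)
qed

text \<open>The maximum modulus principle is applied to exp (- G), whose modulus is exp (- Re
  G).\<close>

lemma Re_nonneg_cball:
  fixes G :: "complex \<Rightarrow> complex"
  assumes hol: "G holomorphic_on UNIV" and pos: "\<And>t. cmod t = 1 \<Longrightarrow> 0 \<le> Re (G t)" and z: "cmod z \<le> 1"
  shows "0 \<le> Re (G z)"
proof -
  have "norm (exp (- G z)) \<le> 1"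
  proof (rule maximum_modulus_frontier[of "\<lambda>z. exp (- G z)" "cball 0 1"])
    show "(\<lambda>z. exp (- G z)) holomorphic_on interior (cball 0 1)"
      by (intro holomorphic_intros holomorphic_on_subset[OF hol]) auto
    show "continuous_on (closure (cball 0 1)) (\<lambda>z. exp (- G z))"
      by (intro continuous_intros continuous_on_subset[OF holomorphic_on_imp_continuous_on[OF hol]]) auto
  qed (use z pos in auto)
  then show ?thesis by simp
qed

text \<open>Since R > 1, the Taylor series at 0 converges uniformly on the closed unit disc. The
  value of \<open>a 0\<close> is recorded because the application needs a bound on the constant
  term.\<close>

lemma polynomial_approx_holomorphic:
  assumes F: "F holomorphic_on ball 0 R" and R: "1 < R" and e: "0 < e"
  obtains n and a :: "nat \<Rightarrow> complex" where "a 0 = F 0"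
    "\<And>z. cmod z \<le> 1 \<Longrightarrow> cmod (F z - (\<Sum>k\<le>n. a k * z ^ k)) < e"
proof -
  define a where "a k = (deriv ^^ k) F 0 / fact k" for k
  have sums: "(\<lambda>k. a k * z ^ k) sums F z" if "cmod z < R" for z
    using holomorphic_power_series[OF F, of z] that by (simp add: a_def)
  have "ereal R \<le> conv_radius a"
  proof (rule conv_radius_geI_ex)
    fix r :: real assume r: "0 < r" "ereal r < ereal R"
    then have "summable (\<lambda>k. a k * of_real r ^ k)"
      using sums[of "of_real r"] by (auto simp: sums_iff)
    then show "\<exists>z. cmod z = r \<and> summable (\<lambda>k. a k * z ^ k)"
      using r by (intro exI[of _ "of_real r"]) auto
  qed
  then have "ereal 1 < conv_radius a"
    using R by (meson ereal_less(2) ereal_less_eq(3) less_ereal.simps(1) less_le_trans)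
  from powser_uniform_limit[OF this, of 0]
  have "uniform_limit (cball 0 1) (\<lambda>n z. \<Sum>i<n. a i * z ^ i) (\<lambda>z. \<Sum>i. a i * z ^ i) sequentially"
    by simp
  from uniform_limitD[OF this e]
  obtain N where N: "\<And>n. n \<ge> N \<Longrightarrow> \<forall>z\<in>cball 0 1. dist (\<Sum>i<n. a i * z ^ i) (\<Sum>i. a i * z ^ i) < e"
    by (auto simp: eventually_sequentially)
  have "cmod (F z - (\<Sum>k\<le>N. a k * z ^ k)) < e" if "cmod z \<le> 1" for z
  proof -
    have "(\<Sum>i. a i * z ^ i) = F z"
      using sums[of z] that R by (simp add: sums_iff)
    moreover have "dist (\<Sum>i<Suc N. a i * z ^ i) (\<Sum>i. a i * z ^ i) < e"
      by (rule bspec[OF N]) (use that in auto)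
    ultimately show ?thesis
      by (simp add: lessThan_Suc_atMost dist_norm norm_minus_commute[of "F z"])
  qed
  moreover have "a 0 = F 0" by (simp add: a_def)
  ultimately show thesis using that by blast
qed

text \<open>Given \<open>\<phi> \<ge> 0\<close> of small mean \<open>\<delta>\<close>, let \<open>G\<close> be analytic with real part \<open>\<phi> / \<delta>\<close> and put
  \<open>F = Ln (1 + G)\<close>. Then \<open>Im F\<close> is bounded by \<open>\<pi> / 2\<close>, whereas \<open>Re F\<close>, which is essentially the
  conjugate function of \<open>Im F\<close>, is at least \<open>ln (1 + 1 / \<delta>)\<close> where \<open>\<phi> = 1\<close>.\<close>

lemma large_laurent_plus:
  fixes \<phi> :: "complex \<Rightarrow> real"
  assumes cont: "continuous_on (sphere 0 1) \<phi>" and range: "\<And>t. cmod t = 1 \<Longrightarrow> 0 \<le> \<phi> t \<and> \<phi> t \<le> 1"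
    and \<delta>: "0 < \<delta>" and mean: "(LINT t|circle. \<phi> t) \<le> \<delta>"
  obtains n \<alpha> where "\<And>t. cmod t = 1 \<Longrightarrow> cmod (laurent n \<alpha> t) \<le> 3"
    "\<And>t. cmod t = 1 \<Longrightarrow> \<phi> t * ln (1 + 1 / \<delta>) \<le> 2 * cmod (laurent_plus n \<alpha> t) + 20"
proof -
  \<comment> \<open>The shift by \<delta> / 4 makes the error one-sided: the real part stays above
    \<phi>, hence nonnegative, and the modulus exceeds \<phi> by at most \<delta> / 2.\<close>
  obtain m \<beta> where \<beta>: "\<And>t. cmod t = 1 \<Longrightarrow> cmod (of_real (\<phi> t + \<delta> / 4) - laurent m \<beta> t) < \<delta> / 4"
    by (rule laurent_approx_real[of "\<lambda>t. \<phi> t + \<delta> / 4" "\<delta> / 4"]) (use cont \<delta> in \<open>auto intro: continuous_intros\<close>)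
  have lower: "\<phi> t \<le> Re (laurent m \<beta> t)" if "cmod t = 1" for t
    using \<beta>[OF that] abs_Re_le_cmod[of "of_real (\<phi> t + \<delta> / 4) - laurent m \<beta> t"] by simp
  have upper: "cmod (laurent m \<beta> t) \<le> \<phi> t + \<delta> / 2" if "cmod t = 1" for t
  proof -
    have "cmod (laurent m \<beta> t) \<le> cmod (of_real (\<phi> t + \<delta> / 4)) + cmod (of_real (\<phi> t + \<delta> / 4) - laurent m \<beta> t)"
      by (metis norm_minus_commute norm_triangle_sub)
    moreover have "cmod (of_real (\<phi> t + \<delta> / 4)) = \<phi> t + \<delta> / 4"
      using range[OF that] \<delta> by (simp del: of_real_add)
    ultimately show ?thesis using \<beta>[OF that] by simp
  qed
  have \<phi>i: "integrable circle \<phi>"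
    using range by (intro circle.integrable_const_bound[of _ 1] continuous_measurable_circle cont) auto
  \<comment> \<open>Here the mean of \<phi> enters: \<beta> 0 is the mean of the Laurent sum, at
    most \<delta> + \<delta> / 2, so \<open>G 0\<close> = \<beta> 0 / \<delta> is bounded by 2
    whatever \<delta> is.\<close>
  have "cmod (\<beta> 0) \<le> (LINT t|circle. cmod (laurent m \<beta> t))"
    unfolding integral_laurent[of m, symmetric] by (rule integral_norm_bound)
  also have "\<dots> \<le> (LINT t|circle. \<phi> t + \<delta> / 2)"
    using upper continuous_integrable_circle[OF laurent_continuous] \<phi>i
    by (intro integral_mono) auto
  also have "\<dots> \<le> 2 * \<delta>"
    using \<phi>i mean \<delta> by simp
  finally have \<beta>0: "cmod (\<beta> 0) \<le> 2 * \<delta>" .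
  \<comment> \<open>The negative frequencies are folded over: on the circle the conjugate of
    \<open>\<beta> (- int k) * t powi (- int k)\<close> is a multiple of t^k with the same real
    part. Thus G is a polynomial in z.\<close>
  define G where "G z = (\<beta> 0 + (\<Sum>k=1..m. (\<beta> (int k) + cnj (\<beta> (- int k))) * z ^ k)) / of_real \<delta>" for z :: complex
  have Re_G: "Re (G t) = Re (laurent m \<beta> t) / \<delta>" if t: "cmod t = 1" for t
  proof -
    have t': "t \<noteq> 0" "cnj t = inverse t"
      using t cnj_on_circle[OF t] by auto
    have "Re (\<beta> 0 + (\<Sum>k=1..m. (\<beta> (int k) + cnj (\<beta> (- int k))) * t ^ k)) = Re (laurent m \<beta> t)"
      unfolding laurent_def sum_int_symmetric plus_complex.sel Re_sum
    proof (intro arg_cong2[of _ _ _ _ "(+)"] sum.cong refl)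
      fix k
      have e: "t powi (- int k) = cnj (t ^ k)"
        using t' by (simp add: power_int_minus power_inverse)
      show "Re ((\<beta> (int k) + cnj (\<beta> (- int k))) * t ^ k)
          = Re (\<beta> (int k) * t powi int k) + Re (\<beta> (- int k) * t powi - int k)"
        unfolding e power_int_of_nat by (simp add: algebra_simps del: complex_cnj_power)
    qed simp
    then show ?thesis by (simp add: G_def)
  qed
  have hol: "G holomorphic_on UNIV"
    unfolding G_def by (intro holomorphic_intros) (use \<delta> in auto)
  have "0 \<le> Re (G t)" if "cmod t = 1" for t
    using lower[OF that] range[OF that] \<delta> by (simp add: Re_G that)
  then have Re_G_pos: "0 \<le> Re (G z)" if "cmod z \<le> 1" for z
    by (rule Re_nonneg_cball[OF hol _ that])
  \<comment> \<open>By compactness 1 + G keeps a positive real part on a disc of radius 1 + r, so F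
    is holomorphic beyond the closed unit disc and its Taylor sums converge uniformly on that
    disc.\<close>
  have "open {z. 0 < Re (1 + G z)}"
    using holomorphic_on_imp_continuous_on[OF hol]
    by (intro open_Collect_less continuous_intros) auto
  moreover have "cball 0 1 \<subseteq> {z. 0 < Re (1 + G z)}"
    using Re_G_pos by (auto simp: add_pos_nonneg)
  ultimately obtain r where r: "0 < r" "(\<Union>x\<in>cball 0 1. ball x r) \<subseteq> {z. 0 < Re (1 + G z)}"
    using compact_subset_open_imp_ball_epsilon_subset[OF compact_cball] by metis
  have R: "0 < Re (1 + G z)" if z: "cmod z < 1 + r" for z
  proof (cases "cmod z \<le> 1")
    case True
    then show ?thesis using Re_G_pos by (simp add: add_pos_nonneg)
  next
    case False
    have "dist (sgn z) z = cmod z - 1"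
    proof -
      have "sgn z - z = of_real (1 - cmod z) * sgn z"
        using False by (auto simp: sgn_eq divide_simps algebra_simps)
      moreover have "z \<noteq> 0" using False by auto
      ultimately show ?thesis
        using False by (simp add: dist_norm norm_mult norm_sgn del: of_real_diff)
    qed
    then have "z \<in> (\<Union>x\<in>cball 0 1. ball x r)"
      using z by (intro UN_I[of "sgn z"]) (auto simp: norm_sgn)
    then show ?thesis using r by blast
  qed
  define F where "F z = Ln (1 + G z)" for z :: complex
  have hol_F: "F holomorphic_on ball 0 (1 + r)"
    unfolding F_def
  proof (intro holomorphic_intros holomorphic_on_subset[OF hol])
    fix z :: complex assume "z \<in> ball 0 (1 + r)"
    then have "0 < Re (1 + G z)" using R by simp
    then show "1 + G z \<notin> \<real>\<^sub>\<le>\<^sub>0" by (auto simp: complex_nonpos_Reals_iff)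
  qed auto
  obtain n a where a0: "a 0 = F 0"
    and approx: "\<And>z. cmod z \<le> 1 \<Longrightarrow> cmod (F z - (\<Sum>k\<le>n. a k * z ^ k)) < 1"
    by (rule polynomial_approx_holomorphic[where e = 1, OF hol_F]) (use r in auto)
  obtain \<alpha> where \<alpha>: "\<And>t. cmod t = 1 \<Longrightarrow> laurent n \<alpha> t = of_real (Im (\<Sum>k\<le>n. a k * t ^ k))"
    "\<And>t. laurent_plus n \<alpha> t = ((\<Sum>k\<le>n. a k * t ^ k) - a 0) / (2 * \<i>) + of_real (Im (a 0))"
    using laurent_conjugate_parts[of n a] by blast
  have Im_F: "\<bar>Im (F z)\<bar> < pi / 2" if "cmod z \<le> 1" for z :: complex
    using Re_Ln_pos_lt[of "1 + G z"] Re_G_pos[OF that] by (auto simp: F_def complex_eq_iff)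
  \<comment> \<open>From 1 \<le> |1 + G 0| \<le> 3 and ln x \<le> x - 1 follows 0 \<le> Re (F 0)
    \<le> 2, and |Im (F 0)| < pi / 2 < 2.\<close>
  have "cmod (a 0) \<le> 6"
  proof -
    have g0: "G 0 = \<beta> 0 / of_real \<delta>" by (simp add: G_def)
    have "cmod (G 0) \<le> 2" unfolding g0 using \<beta>0 \<delta> by (simp add: norm_divide divide_le_eq)
    then have "cmod (1 + G 0) \<le> 3" by (smt (verit) norm_one norm_triangle_ineq)
    moreover have "1 \<le> cmod (1 + G 0)"
      using Re_G_pos[of 0] complex_Re_le_cmod[of "1 + G 0"] by simp
    ultimately have "0 < cmod (1 + G 0)" "0 \<le> ln (cmod (1 + G 0))" "ln (cmod (1 + G 0)) \<le> 2"
      by (linarith, simp, smt (verit) ln_le_minus_one)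
    moreover have "Re (F 0) = ln (cmod (1 + G 0))"
      unfolding F_def using \<open>1 \<le> cmod (1 + G 0)\<close> by (intro Re_Ln) auto
    moreover have "\<bar>Im (F 0)\<bar> \<le> 2"
      using Im_F[of 0] pi_less_4 by simp
    ultimately show ?thesis using cmod_le[of "F 0"] by (simp add: a0)
  qed
  show thesis
  proof (rule that)
    fix t :: complex assume t: "cmod t = 1"
    define Q where "Q = (\<Sum>k\<le>n. a k * t ^ k)"
    have FQ: "cmod (F t - Q) < 1" using approx[of t] t by (simp add: Q_def)
    have "cmod (laurent n \<alpha> t) = \<bar>Im Q\<bar>" unfolding \<alpha>(1)[OF t] Q_def by (simp only: norm_of_real)
    also have "\<dots> \<le> \<bar>Im (F t)\<bar> + \<bar>Im (F t - Q)\<bar>" by simp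
    \<comment> \<open>The bound pi / 2 on Im F plus the error 1 of the polynomial approximation,
      with pi < 4.\<close>
    also have "\<dots> \<le> 3"
      using Im_F[of t] t FQ abs_Im_le_cmod[of "F t - Q"] pi_less_4 by simp
    finally show "cmod (laurent n \<alpha> t) \<le> 3" .
    have "\<phi> t * ln (1 + 1 / \<delta>) \<le> ln (1 + \<phi> t / \<delta>)"
    proof -
      have "(1 - \<phi> t) * ln 1 + \<phi> t * ln (1 + 1 / \<delta>) \<le> ln ((1 - \<phi> t) *\<^sub>R 1 + \<phi> t *\<^sub>R (1 + 1 / \<delta>))"
        using concave_onD[OF ln_concave, of "\<phi> t" 1 "1 + 1 / \<delta>"] range[OF t] \<delta> by (auto simp: add_pos_pos)
      also have "(1 - \<phi> t) *\<^sub>R 1 + \<phi> t *\<^sub>R (1 + 1 / \<delta>) = 1 + \<phi> t / \<delta>"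
        by (simp add: algebra_simps)
      finally show ?thesis by simp
    qed
    also have "\<dots> \<le> ln (cmod (1 + G t))"
    proof (intro ln_mono)
      have "1 + \<phi> t / \<delta> \<le> Re (1 + G t)"
        using lower[OF t] \<delta> by (simp add: Re_G t divide_right_mono)
      also have "\<dots> \<le> cmod (1 + G t)" by (rule complex_Re_le_cmod)
      finally show "1 + \<phi> t / \<delta> \<le> cmod (1 + G t)" .
      show "0 < 1 + \<phi> t / \<delta>" using range[OF t] \<delta> by (simp add: add_pos_nonneg)
    qed
    also have "\<dots> = Re (F t)"
      unfolding F_def using Re_G_pos[of t] t by (intro Re_Ln[symmetric]) (auto simp: complex_eq_iff)
    also have "\<dots> \<le> cmod (F t)" by (rule complex_Re_le_cmod)
    also have "\<dots> \<le> cmod Q + 1" using FQ norm_triangle_sub[of "F t" Q] by simp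
    also have "Q = 2 * \<i> * laurent_plus n \<alpha> t - 2 * \<i> * of_real (Im (a 0)) + a 0"
      using \<alpha>(2)[of t] by (simp add: Q_def field_simps)
    also have "cmod \<dots> \<le> cmod (2 * \<i> * laurent_plus n \<alpha> t) + cmod (2 * \<i> * of_real (Im (a 0))) + cmod (a 0)"
      by (intro order_trans[OF norm_triangle_ineq] add_right_mono norm_triangle_ineq4)
    \<comment> \<open>The constants are 1 from the approximation, 2 * 6 from Im (a 0) and 6 from a
      0, together below 20.\<close>
    also have "\<dots> + 1 \<le> 2 * cmod (laurent_plus n \<alpha> t) + 20"
      using \<open>cmod (a 0) \<le> 6\<close> abs_Im_le_cmod[of "a 0"] by (simp add: norm_mult)
    finally show "\<phi> t * ln (1 + 1 / \<delta>) \<le> 2 * cmod (laurent_plus n \<alpha> t) + 20" by simp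
  qed
qed

section \<open>Density in \<open>L\<^sup>1\<close>\<close>

text \<open>Outer regularity supplies the open set, and multiples of the distance to its complement,
  cut off at 1, increase to its indicator. Such a monotone sequence of continuous functions is what
  the Fatou property can be applied to.\<close>

lemma open_majorant:
  assumes D: "D \<in> sets circle" and \<delta>: "measure circle D < \<delta>"
  obtains U and \<phi> :: "nat \<Rightarrow> complex \<Rightarrow> real" where
    "D \<subseteq> U" "U \<in> sets circle" "measure circle U < \<delta>"
    "\<And>n. continuous_on (sphere 0 1) (\<phi> n)" "\<And>n t. 0 \<le> \<phi> n t" "\<And>n t. cmod t = 1 \<Longrightarrow> \<phi> n t \<le> indicator U t"
    "\<And>t. incseq (\<lambda>n. \<phi> n t)" "\<And>t. cmod t = 1 \<Longrightarrow> (\<lambda>n. \<phi> n t) \<longlonglongrightarrow> indicator U t"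
proof -
  \<comment> \<open>D is measurable for the completion only; a Borel superset of equal measure
    replaces it before regularity is invoked.\<close>
  obtain S where S: "S \<in> sets circle0" "D \<subseteq> S" "emeasure circle D = emeasure circle0 S"
    using completion_upper[of D circle0] D unfolding circle_eq by blast
  then obtain B where B: "B \<in> sets borel" "S = B \<inter> sphere 0 1"
    unfolding sets_circle0 sets_restrict_space by (auto simp: Int_commute)
  define \<mu> where "\<mu> = distr circle0 borel (\<lambda>t. t)"
  have id: "(\<lambda>t. t) \<in> borel_measurable circle0" by (rule measurable_circle0) simp
  have \<mu>: "emeasure \<mu> A = emeasure circle0 (A \<inter> sphere 0 1)" if "A \<in> sets borel" for A
    unfolding \<mu>_def using that by (subst emeasure_distr[OF id]) (auto simp: space_circle0)
  have "emeasure \<mu> (space \<mu>) \<noteq> \<infinity>"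
    by (simp add: \<mu>_def[THEN arg_cong, of space] \<mu> emeasure_circle0)
  then have "emeasure \<mu> B = (INF U \<in> {U. B \<subseteq> U \<and> open U}. emeasure \<mu> U)"
    using outer_regular[of \<mu> B] B by (simp add: \<mu>_def)
  moreover have "emeasure \<mu> B < ennreal \<delta>"
    using S(3) \<delta> unfolding \<mu>[OF B(1)] B(2)[symmetric]
    by (metis circle.emeasure_eq_measure ennreal_lessI measure_nonneg order_le_less_trans)
  ultimately obtain V where V: "B \<subseteq> V" "open V" "emeasure \<mu> V < ennreal \<delta>"
    by (auto simp: INF_less_iff)
  \<comment> \<open>Intersecting with a disc that contains the circle makes the complement nonempty;
    \<open>infdist\<close> to the empty set is 0 by convention, and every \<phi> n would
    vanish.\<close>
  define A where "A = - (V \<inter> ball 0 2)"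
  have A: "closed A" "A \<noteq> {}"
  proof -
    show "closed A" unfolding A_def by (intro closed_Compl open_Int open_ball V(2))
    have "3 \<in> A" by (simp add: A_def)
    then show "A \<noteq> {}" by blast
  qed
  define \<phi> where "\<phi> n t = min 1 (real n * infdist t A)" for n t
  define U where "U = V \<inter> sphere 0 1"
  have mem: "t \<in> A \<longleftrightarrow> t \<notin> U" if "cmod t = 1" for t
    using that by (auto simp: A_def U_def)
  have U0: "U \<in> sets circle0"
    unfolding U_def by (rule sets_circle0_Int) (use V in simp)
  show thesis
  proof (rule that)
    show "D \<subseteq> U" using S B V by (auto simp: U_def)
    show "U \<in> sets circle" using U0 by (simp add: circle_eq)
    have "emeasure circle U < ennreal \<delta>"
      using V(2,3) U0 \<mu>[of V] by (simp add: circle_eq U_def)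
    then show "measure circle U < \<delta>"
      by (metis circle.emeasure_eq_measure ennreal_less_iff measure_nonneg)
    show "continuous_on (sphere 0 1) (\<phi> n)" for n
      unfolding \<phi>_def by (intro continuous_intros)
    show "0 \<le> \<phi> n t" for n t by (simp add: \<phi>_def infdist_nonneg)
    show "\<phi> n t \<le> indicator U t" if "cmod t = 1" for n t
      using mem[OF that] by (cases "t \<in> U") (auto simp: \<phi>_def)
    show "incseq (\<lambda>n. \<phi> n t)" for t
    proof (rule incseq_SucI)
      fix n
      have "real n * infdist t A \<le> real (Suc n) * infdist t A"
        by (intro mult_right_mono) (auto simp: infdist_nonneg)
      then show "\<phi> n t \<le> \<phi> (Suc n) t"
        unfolding \<phi>_def by (rule min.mono[OF order_refl])
    qed
    show "(\<lambda>n. \<phi> n t) \<longlonglongrightarrow> indicator U t" if t: "cmod t = 1" for t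
    proof (cases "t \<in> U")
      case True
      then have "t \<notin> A" using mem t by simp
      then have pos: "0 < infdist t A" using A infdist_pos_not_in_closed by blast
      obtain N where N: "1 < real N * infdist t A"
        using reals_Archimedean3[OF pos] by blast
      have "\<phi> n t = 1" if "n \<ge> N" for n
      proof -
        have "real N * infdist t A \<le> real n * infdist t A"
          using that pos by (intro mult_right_mono) auto
        then show ?thesis using N by (simp add: \<phi>_def)
      qed
      then have "eventually (\<lambda>n. \<phi> n t = 1) sequentially"
        by (auto simp: eventually_sequentially)
      then show ?thesis using True by (simp add: tendsto_eventually)
    qed (use mem[OF t] in \<open>simp add: \<phi>_def\<close>)
  qed
qed

text \<open>For an indicator, \<open>open_majorant\<close> with excess measure d yields a continuous
  function at L^1 distance below 2 d; sums and dominated limits extend this to all integrable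
  functions.\<close>

lemma continuous_dense_L1:
  fixes g :: "complex \<Rightarrow> complex"
  assumes "integrable circle g" "0 < e"
  shows "\<exists>h. continuous_on (sphere 0 1) h \<and> (LINT t|circle. cmod (g t - h t)) < e"
  using assms
proof (induction arbitrary: e rule: integrable_induct)
  case (base A c)
  \<comment> \<open>Chosen so that 2 * d * |c| < e; the summand 1 guards against c = 0.\<close>
  define d where "d = e / (2 * (cmod c + 1))"
  have c1: "0 < cmod c + 1" by (simp add: add_nonneg_pos)
  then have d0: "0 < d" using base.prems by (simp add: d_def)
  have "2 * d * cmod c < 2 * d * (cmod c + 1)" using d0 by simp
  also have "\<dots> = e" using c1 by (simp add: d_def field_simps)
  finally have d: "0 < d" "2 * d * cmod c < e" using d0 by auto
  obtain U and \<phi> :: "nat \<Rightarrow> complex \<Rightarrow> real" where U: "A \<subseteq> U" "U \<in> sets circle" "measure circle U < measure circle A + d"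
    and \<phi>: "\<And>n. continuous_on (sphere 0 1) (\<phi> n)" "\<And>n t. 0 \<le> \<phi> n t" "\<And>n t. cmod t = 1 \<Longrightarrow> \<phi> n t \<le> indicator U t"
    "\<And>t. cmod t = 1 \<Longrightarrow> (\<lambda>n. \<phi> n t) \<longlonglongrightarrow> indicator U t"
    using open_majorant[OF base.hyps(1), of "measure circle A + d"] d(1) by (metis less_add_same_cancel1)
  have \<phi>i: "integrable circle (\<phi> n)" for n
  proof (rule circle.integrable_const_bound[of _ 1])
    have "\<phi> n t \<le> 1" if "cmod t = 1" for t
      using \<phi>(3)[OF that, of n] by (cases "t \<in> U") auto
    then show "AE t in circle. norm (\<phi> n t) \<le> 1"
      using \<phi>(2) by auto
  qed (rule continuous_measurable_circle[OF \<phi>(1)])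
  have Ui: "integrable circle (indicator U :: complex \<Rightarrow> real)" "integrable circle (indicator A :: complex \<Rightarrow> real)"
    using U(2) base.hyps by (auto simp: less_top[symmetric])
  have "(\<lambda>n. LINT t|circle. \<phi> n t) \<longlonglongrightarrow> (LINT t|circle. indicator U t)"
  proof (rule integral_dominated_convergence[where w = "indicator U"])
    show "AE t in circle. norm (\<phi> n t) \<le> indicator U t" for n
      using \<phi>(2,3) by auto
  qed (use \<phi> Ui U in \<open>auto intro: continuous_measurable_circle\<close>)
  then have "eventually (\<lambda>n. \<bar>(LINT t|circle. \<phi> n t) - measure circle U\<bar> < d) sequentially"
    using d(1) sets.sets_into_space[OF U(2)] by (auto simp: tendsto_iff dist_real_def Int_absorb2)
  then obtain n where n: "\<bar>(LINT t|circle. \<phi> n t) - measure circle U\<bar> < d"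
    by (auto simp: eventually_sequentially)
  have "(LINT t|circle. \<bar>indicator A t - \<phi> n t\<bar>) \<le> (LINT t|circle. (indicator U t - indicator A t) + (indicator U t - \<phi> n t))"
  proof (rule integral_mono)
    fix t assume "t \<in> space circle"
    then have "\<phi> n t \<le> indicator U t" "(indicator A t :: real) \<le> indicator U t"
      using \<phi>(3)[of t n] U(1) by (auto simp: indicator_def)
    then show "\<bar>indicator A t - \<phi> n t\<bar> \<le> (indicator U t - indicator A t) + (indicator U t - \<phi> n t)"
      by linarith
  qed (use \<phi>i Ui in auto)
  also have "\<dots> = (measure circle U - measure circle A) + (measure circle U - (LINT t|circle. \<phi> n t))"
    using \<phi>i Ui sets.sets_into_space[OF U(2)] sets.sets_into_space[OF base.hyps(1)]
    by (simp add: Int_absorb2)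
  also have "\<dots> < 2 * d" using U(3) n by linarith
  finally have *: "(LINT t|circle. \<bar>indicator A t - \<phi> n t\<bar>) < 2 * d" .
  have "(LINT t|circle. cmod (indicator A t *\<^sub>R c - of_real (\<phi> n t) * c)) = (LINT t|circle. \<bar>indicator A t - \<phi> n t\<bar> * cmod c)"
    by (intro Bochner_Integration.integral_cong refl)
       (metis left_diff_distrib norm_mult norm_of_real of_real_diff scaleR_conv_of_real)
  also have "\<dots> = (LINT t|circle. \<bar>indicator A t - \<phi> n t\<bar>) * cmod c" by simp
  also have "\<dots> \<le> 2 * d * cmod c"
    using * by (intro mult_right_mono) auto
  also have "\<dots> < e" by (rule d)
  finally show ?case
    using \<phi>(1) by (intro exI[of _ "\<lambda>t. of_real (\<phi> n t) * c"]) (auto intro: continuous_intros)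
next
  case (add f g)
  obtain h k where h: "continuous_on (sphere 0 1) h" "(LINT t|circle. cmod (f t - h t)) < e / 2"
    and k: "continuous_on (sphere 0 1) k" "(LINT t|circle. cmod (g t - k t)) < e / 2"
    using add.IH(1)[of "e / 2"] add.IH(2)[of "e / 2"] add.prems by auto
  have i: "integrable circle (\<lambda>t. cmod (f t - h t))" "integrable circle (\<lambda>t. cmod (g t - k t))"
    by (rule integrable_norm, rule Bochner_Integration.integrable_diff, rule add.hyps,
        rule continuous_integrable_circle, rule h k)+
  have "(LINT t|circle. cmod ((f t + g t) - (h t + k t))) \<le> (LINT t|circle. cmod (f t - h t) + cmod (g t - k t))"
  proof (rule integral_mono)
    show "integrable circle (\<lambda>t. cmod ((f t + g t) - (h t + k t)))"
      by (intro integrable_norm Bochner_Integration.integrable_diff Bochner_Integration.integrable_add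
          add.hyps continuous_integrable_circle h k)
  qed (use i in \<open>auto simp: norm_diff_triangle_ineq\<close>)
  also have "\<dots> < e" using i h(2) k(2) by simp
  finally show ?case
    using h(1) k(1) by (intro exI[of _ "\<lambda>t. h t + k t"]) (auto intro: continuous_intros)
next
  case (lim f s)
  have "(\<lambda>i. LINT t|circle. cmod (f t - s i t)) \<longlonglongrightarrow> (LINT t|circle. 0)"
  \<comment> \<open>The approximating simple functions satisfy |s i| \<le> 2 |f|, whence the factor
    3.\<close>
  proof (rule integral_dominated_convergence[where w = "\<lambda>t. 3 * cmod (f t)"])
    show "AE t in circle. (\<lambda>i. cmod (f t - s i t)) \<longlonglongrightarrow> 0"
    proof (rule AE_I2)
      fix t assume "t \<in> space circle"
      then have "(\<lambda>i. s i t) \<longlonglongrightarrow> f t" by (rule lim.hyps)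
      then have "(\<lambda>i. cmod (f t - s i t)) \<longlonglongrightarrow> cmod (f t - f t)" by (intro tendsto_intros)
      then show "(\<lambda>i. cmod (f t - s i t)) \<longlonglongrightarrow> 0" by simp
    qed
    show "AE t in circle. norm (cmod (f t - s i t)) \<le> 3 * cmod (f t)" for i
    proof (rule AE_I2)
      fix t assume "t \<in> space circle"
      then have "cmod (s i t) \<le> 2 * cmod (f t)" by (rule lim.hyps)
      then show "norm (cmod (f t - s i t)) \<le> 3 * cmod (f t)"
        using norm_triangle_ineq4[of "f t" "s i t"] by simp
    qed
  qed (use lim.hyps in auto)
  then have "eventually (\<lambda>i. (LINT t|circle. cmod (f t - s i t)) < e / 2) sequentially"
    using lim.prems by (intro order_tendstoD(2)) auto
  then obtain i where i: "(LINT t|circle. cmod (f t - s i t)) < e / 2"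
    by (auto simp: eventually_sequentially)
  obtain h where h: "continuous_on (sphere 0 1) h" "(LINT t|circle. cmod (s i t - h t)) < e / 2"
    using lim.IH[of "e / 2" i] lim.prems by auto
  have ii: "integrable circle (\<lambda>t. cmod (f t - s i t))" "integrable circle (\<lambda>t. cmod (s i t - h t))"
    using lim.hyps continuous_integrable_circle[OF h(1)]
    by (intro integrable_norm Bochner_Integration.integrable_diff; simp)+
  have "(LINT t|circle. cmod (f t - h t)) \<le> (LINT t|circle. cmod (f t - s i t) + cmod (s i t - h t))"
  proof (rule integral_mono)
    show "integrable circle (\<lambda>t. cmod (f t - h t))"
      by (intro integrable_norm Bochner_Integration.integrable_diff lim.hyps
          continuous_integrable_circle h)
    show "cmod (f t - h t) \<le> cmod (f t - s i t) + cmod (s i t - h t)" for t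
      using norm_triangle_ineq[of "f t - s i t" "s i t - h t"] by simp
  qed (use ii in auto)
  also have "\<dots> < e" using ii i h(2) by simp
  finally show ?case using h(1) by blast
qed

text \<open>Density alone loses the bound on g. The nearest-point map of the disc of radius B
  restores it at no cost in L^1, being nonexpansive and fixing the values of g. The extra 1 is the
  uniform error in passing to a Laurent sum.\<close>

lemma laurent_dense_L1:
  fixes g :: "complex \<Rightarrow> complex"
  assumes g: "g \<in> borel_measurable circle" and B: "\<And>t. cmod t = 1 \<Longrightarrow> cmod (g t) \<le> B" and e: "0 < e"
  obtains n \<alpha> where "(LINT t|circle. cmod (g t - laurent n \<alpha> t)) < e" "\<And>t. cmod t = 1 \<Longrightarrow> cmod (laurent n \<alpha> t) \<le> B + 1"
proof -
  have B0: "0 \<le> B" using order_trans[OF norm_ge_zero B[of 1]] by simp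
  have gi: "integrable circle g"
    using B by (intro circle.integrable_const_bound[of _ B] g) auto
  obtain h where h: "continuous_on (sphere 0 1) h" "(LINT t|circle. cmod (g t - h t)) < e / 2"
    using continuous_dense_L1[OF gi, of "e / 2"] e by auto
  define k where "k t = closest_point (cball 0 B) (h t)" for t
  have cl: "closed (cball (0::complex) B)" "convex (cball (0::complex) B)" "cball (0::complex) B \<noteq> {}"
    using B0 by auto
  have kc: "continuous_on (sphere 0 1) k"
    unfolding k_def
    by (rule continuous_on_compose2[OF continuous_on_closest_point[OF cl(2,1,3)] h(1)]) auto
  have kB: "cmod (k t) \<le> B" for t
    using closest_point_in_set[OF cl(1,3), of "h t"] by (simp add: k_def)
  obtain n \<alpha> where a: "\<And>t. cmod t = 1 \<Longrightarrow> cmod (k t - laurent n \<alpha> t) < min 1 (e / 2)"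
    using laurent_approx[OF kc, of "min 1 (e / 2)"] e by auto
  have lc: "integrable circle (laurent n \<alpha>)"
    by (rule continuous_integrable_circle[OF laurent_continuous])
  show thesis
  proof (rule that)
    have "(LINT t|circle. cmod (g t - laurent n \<alpha> t)) \<le> (LINT t|circle. cmod (g t - h t) + e / 2)"
    proof (rule integral_mono)
      show "integrable circle (\<lambda>t. cmod (g t - laurent n \<alpha> t))" "integrable circle (\<lambda>t. cmod (g t - h t) + e / 2)"
        using gi lc continuous_integrable_circle[OF h(1)] by auto
      fix t assume "t \<in> space circle"
      then have t: "cmod t = 1" by simp
      have "closest_point (cball 0 B) (g t) = g t"
        using B[OF t] by (intro closest_point_self) simp
      then have "cmod (g t - k t) \<le> cmod (g t - h t)"
        using closest_point_lipschitz[OF cl(2,1,3), of "g t" "h t"] by (simp add: k_def dist_norm)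
      moreover have "cmod (k t - laurent n \<alpha> t) < e / 2" using a[OF t] by simp
      ultimately show "cmod (g t - laurent n \<alpha> t) \<le> cmod (g t - h t) + e / 2"
        using norm_triangle_ineq[of "g t - k t" "k t - laurent n \<alpha> t"] by simp
    qed
    also have "\<dots> = (LINT t|circle. cmod (g t - h t)) + e / 2"
      using gi continuous_integrable_circle[OF h(1)] by simp
    also have "\<dots> < e" using h(2) by simp
    finally show "(LINT t|circle. cmod (g t - laurent n \<alpha> t)) < e" .
    show "cmod (laurent n \<alpha> t) \<le> B + 1" if "cmod t = 1" for t
      using a[OF that] kB[of t] norm_triangle_ineq2[of "laurent n \<alpha> t" "k t"]
      by (simp add: norm_minus_commute)
  qed
qed

text \<open>A subsequence of L^1 approximants converges almost everywhere as well. The latter serves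
  dominated convergence in pairings, the former makes norms of errors small.\<close>

lemma laurent_seq_L1:
  fixes g :: "complex \<Rightarrow> complex"
  assumes g: "g \<in> borel_measurable circle" and B: "\<And>t. cmod t = 1 \<Longrightarrow> cmod (g t) \<le> B"
  obtains n \<alpha> where
    "\<And>j t. cmod t = 1 \<Longrightarrow> cmod (laurent (n j) (\<alpha> j) t) \<le> B + 1"
    "(\<lambda>j. LINT t|circle. cmod (g t - laurent (n j) (\<alpha> j) t)) \<longlonglongrightarrow> 0"
    "AE t in circle. (\<lambda>j. laurent (n j) (\<alpha> j) t) \<longlonglongrightarrow> g t"
proof -
  have "\<exists>n \<alpha>. (LINT t|circle. cmod (g t - laurent n \<alpha> t)) < inverse (real (Suc j)) \<and> (\<forall>t. cmod t = 1 \<longrightarrow> cmod (laurent n \<alpha> t) \<le> B + 1)" for j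
    using laurent_dense_L1[OF g B, of "inverse (real (Suc j))"] by (metis inverse_positive_iff_positive of_nat_0_less_iff zero_less_Suc)
  then obtain n \<alpha> where *: "\<And>j. (LINT t|circle. cmod (g t - laurent (n j) (\<alpha> j) t)) < inverse (real (Suc j))"
    "\<And>j t. cmod t = 1 \<Longrightarrow> cmod (laurent (n j) (\<alpha> j) t) \<le> B + 1"
    by metis
  have lim: "(\<lambda>j. LINT t|circle. cmod (g t - laurent (n j) (\<alpha> j) t)) \<longlonglongrightarrow> 0"
    by (rule tendsto_sandwich[OF _ _ tendsto_const LIMSEQ_inverse_real_of_nat])
       (use *(1) in \<open>auto intro!: eventuallyI less_imp_le\<close>)
  have gi: "integrable circle g"
    using B by (intro circle.integrable_const_bound[of _ B] g) auto
  then have i: "integrable circle (\<lambda>t. g t - laurent (n j) (\<alpha> j) t)" for j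
    using continuous_integrable_circle[OF laurent_continuous] by auto
  obtain r where r: "strict_mono r" "AE t in circle. (\<lambda>j. g t - laurent (n (r j)) (\<alpha> (r j)) t) \<longlonglongrightarrow> 0"
    using tendsto_L1_AE_subseq[OF i lim] by blast
  show thesis
  proof (rule that[of "n \<circ> r" "\<alpha> \<circ> r"])
    show "(\<lambda>j. LINT t|circle. cmod (g t - laurent ((n \<circ> r) j) ((\<alpha> \<circ> r) j) t)) \<longlonglongrightarrow> 0"
      using LIMSEQ_subseq_LIMSEQ[OF lim r(1)] by (simp add: o_def)
    show "AE t in circle. (\<lambda>j. laurent ((n \<circ> r) j) ((\<alpha> \<circ> r) j) t) \<longlonglongrightarrow> g t"
      using r(2)
    proof eventually_elim
      case (elim t)
      from tendsto_diff[OF tendsto_const[of "g t"] this] show ?case by simp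
    qed
  qed (use *(2) in auto)
qed

section \<open>Function norms for which the Riesz projection is bounded\<close>

text \<open>Collects properties that \<rho> and its associate norm share, so that the estimates
  below apply to both.\<close>

locale function_norm =
  fixes N :: "(complex \<Rightarrow> ennreal) \<Rightarrow> ennreal"
  assumes mono: "f \<in> L0_plus \<Longrightarrow> g \<in> L0_plus \<Longrightarrow> AE t in circle. g t \<le> f t \<Longrightarrow> N g \<le> N f"
    and cmult: "f \<in> L0_plus \<Longrightarrow> 0 \<le> c \<Longrightarrow> N (\<lambda>t. ennreal c * f t) = ennreal c * N f"
    and add: "f \<in> L0_plus \<Longrightarrow> g \<in> L0_plus \<Longrightarrow> N (\<lambda>t. f t + g t) \<le> N f + N g"
    and Fatou: "(\<And>n::nat. F n \<in> L0_plus) \<Longrightarrow> f \<in> L0_plus \<Longrightarrow>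
      AE t in circle. incseq (\<lambda>n. F n t) \<and> (\<lambda>n. F n t) \<longlonglongrightarrow> f t \<Longrightarrow> (\<lambda>n. N (F n)) \<longlonglongrightarrow> N f"
    and one_finite: "N (\<lambda>_. 1) < \<infinity>"
begin

lemma cong: "f \<in> L0_plus \<Longrightarrow> g \<in> L0_plus \<Longrightarrow> AE t in circle. g t = f t \<Longrightarrow> N g = N f"
  by (intro antisym mono) auto

definition unit :: real where "unit = enn2real (N (\<lambda>_. 1))"

lemma unit: "0 \<le> unit" "N (\<lambda>_. 1) = ennreal unit"
  using one_finite by (auto simp: unit_def less_top)

lemma N_const: "0 \<le> c \<Longrightarrow> N (\<lambda>_. ennreal c) = ennreal (c * unit)"
  using cmult[of "\<lambda>_. 1" c] unit by (simp add: ennreal_mult)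

lemma bounded_le:
  assumes "f \<in> L0_plus" "0 \<le> c" "AE t in circle. f t \<le> ennreal c"
  shows "N f \<le> ennreal (c * unit)"
  unfolding N_const[OF assms(2), symmetric] by (rule mono) (use assms in auto)

end

text \<open>Boundedness is expressed on coefficients of polynomials, with C as a parameter: the same
  constant is later passed on to the associate norm.\<close>

locale riesz_bounded_norm = function_norm +
  fixes C :: real
  assumes C: "0 \<le> C" "bfs_norm N (laurent_plus n \<alpha>) \<le> ennreal C * bfs_norm N (laurent n \<alpha>)"
begin

text \<open>The polynomial p of \<open>large_laurent_plus\<close> gives ln (1 + 1 / \<delta>) *
  \<phi> \<le> 2 |P p| + 20 with |p| \<le> 3. In norm the right-hand side is at most 2 * C * 3 *
  N(1) + 20 * N(1), whence the factor 6 * C + 20.\<close>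

lemma continuous_small:
  fixes \<phi> :: "complex \<Rightarrow> real"
  assumes cont: "continuous_on (sphere 0 1) \<phi>" and range: "\<And>t. cmod t = 1 \<Longrightarrow> 0 \<le> \<phi> t \<and> \<phi> t \<le> 1"
    and \<delta>: "0 < \<delta>" and mean: "(LINT t|circle. \<phi> t) \<le> \<delta>"
  shows "N (\<lambda>t. ennreal (\<phi> t)) \<le> ennreal ((6 * C + 20) * unit / ln (1 + 1 / \<delta>))"
proof -
  obtain n \<alpha> where \<alpha>: "\<And>t. cmod t = 1 \<Longrightarrow> cmod (laurent n \<alpha> t) \<le> 3"
    "\<And>t. cmod t = 1 \<Longrightarrow> \<phi> t * ln (1 + 1 / \<delta>) \<le> 2 * cmod (laurent_plus n \<alpha> t) + 20"
    using large_laurent_plus[OF cont range \<delta> mean] by blast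
  define L where "L = ln (1 + 1 / \<delta>)"
  have L: "0 < L" using \<delta> by (auto simp: L_def intro!: ln_gt_zero)
  have \<phi>m: "(\<lambda>t. ennreal (\<phi> t)) \<in> L0_plus"
    using continuous_measurable_circle[OF cont] by measurable
  have pm: "(\<lambda>t. ennreal (cmod (laurent_plus n \<alpha> t))) \<in> L0_plus"
    and lm: "(\<lambda>t. ennreal (cmod (laurent n \<alpha> t))) \<in> L0_plus"
    using continuous_measurable_circle[OF laurent_plus_continuous]
      continuous_measurable_circle[OF laurent_continuous] by measurable
  have "ennreal L * N (\<lambda>t. ennreal (\<phi> t)) = N (\<lambda>t. ennreal L * ennreal (\<phi> t))"
    using L by (simp add: cmult \<phi>m)
  also have "\<dots> \<le> N (\<lambda>t. ennreal 2 * ennreal (cmod (laurent_plus n \<alpha> t)) + ennreal 20)"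
  proof (intro mono AE_I2)
    fix t assume "t \<in> space circle"
    then have t: "cmod t = 1" by simp
    have "ennreal L * ennreal (\<phi> t) = ennreal (\<phi> t * L)"
      using range[OF t] L by (simp add: ennreal_mult mult.commute)
    also have "\<dots> \<le> ennreal (2 * cmod (laurent_plus n \<alpha> t) + 20)"
      using \<alpha>(2)[OF t] by (intro ennreal_leI) (simp add: L_def)
    also have "\<dots> = ennreal 2 * ennreal (cmod (laurent_plus n \<alpha> t)) + ennreal 20"
      by (simp only: ennreal_plus ennreal_mult norm_ge_zero mult_nonneg_nonneg zero_le_numeral)
    finally show "ennreal L * ennreal (\<phi> t) \<le> ennreal 2 * ennreal (cmod (laurent_plus n \<alpha> t)) + ennreal 20" .
  qed (use \<phi>m pm in measurable)
  also have "\<dots> \<le> N (\<lambda>t. ennreal 2 * ennreal (cmod (laurent_plus n \<alpha> t))) + N (\<lambda>t. ennreal 20)"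
    by (rule add) (use pm in measurable)
  also have "\<dots> = ennreal 2 * bfs_norm N (laurent_plus n \<alpha>) + ennreal (20 * unit)"
    by (simp only: cmult[OF pm zero_le_numeral] N_const[OF zero_le_numeral] bfs_norm_def)
  also have "\<dots> \<le> ennreal 2 * (ennreal C * ennreal (3 * unit)) + ennreal (20 * unit)"
  proof (intro add_right_mono mult_left_mono order_trans[OF C(2)])
    show "bfs_norm N (laurent n \<alpha>) \<le> ennreal (3 * unit)"
      unfolding bfs_norm_def using \<alpha>(1) by (intro bounded_le lm AE_I2 ennreal_leI) auto
  qed auto
  also have "\<dots> = ennreal (2 * (C * (3 * unit)) + 20 * unit)"
    using C(1) unit(1)
    by (simp only: ennreal_plus ennreal_mult mult_nonneg_nonneg zero_le_numeral)
  also have "2 * (C * (3 * unit)) + 20 * unit = (6 * C + 20) * unit"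
    by (simp add: algebra_simps)
  finally have *: "ennreal L * N (\<lambda>t. ennreal (\<phi> t)) \<le> ennreal ((6 * C + 20) * unit)" .
  have "N (\<lambda>t. ennreal (\<phi> t)) = ennreal (1 / L) * (ennreal L * N (\<lambda>t. ennreal (\<phi> t)))"
    using L by (simp add: mult.assoc[symmetric] ennreal_mult'[symmetric])
  also have "\<dots> \<le> ennreal (1 / L) * ennreal ((6 * C + 20) * unit)"
    by (intro mult_left_mono *) auto
  also have "\<dots> = ennreal ((6 * C + 20) * unit / L)"
    using L C(1) unit(1) by (simp add: ennreal_mult'[symmetric])
  finally show ?thesis by (simp add: L_def)
qed

text \<open>An open majorant of measure below \<delta> is an increasing limit of continuous
  functions of mean at most \<delta>, so the Fatou property passes on their common bound. It tends
  to 0 with \<delta>.\<close>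

lemma indicator_small:
  assumes D: "D \<in> sets circle" and \<delta>: "measure circle D < \<delta>"
  shows "N (indicator D) \<le> ennreal ((6 * C + 20) * unit / ln (1 + 1 / \<delta>))"
proof -
  have \<delta>0: "0 < \<delta>" using \<delta> measure_nonneg[of circle D] by linarith
  obtain U and \<phi> :: "nat \<Rightarrow> complex \<Rightarrow> real" where U: "D \<subseteq> U" "U \<in> sets circle" "measure circle U < \<delta>"
    and \<phi>: "\<And>n. continuous_on (sphere 0 1) (\<phi> n)" "\<And>n t. 0 \<le> \<phi> n t" "\<And>n t. cmod t = 1 \<Longrightarrow> \<phi> n t \<le> indicator U t"
    "\<And>t. incseq (\<lambda>n. \<phi> n t)" "\<And>t. cmod t = 1 \<Longrightarrow> (\<lambda>n. \<phi> n t) \<longlonglongrightarrow> indicator U t"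
    using open_majorant[OF D \<delta>] by metis
  have \<phi>1: "\<phi> n t \<le> 1" if "cmod t = 1" for n t
    using \<phi>(3)[OF that, of n] by (cases "t \<in> U") auto
  have le: "N (\<lambda>t. ennreal (\<phi> n t)) \<le> ennreal ((6 * C + 20) * unit / ln (1 + 1 / \<delta>))" for n
  proof (rule continuous_small[OF \<phi>(1) _ \<delta>0])
    have "(LINT t|circle. \<phi> n t) \<le> (LINT t|circle. indicator U t)"
    proof (rule integral_mono)
      show "integrable circle (\<phi> n)"
        using \<phi>1 \<phi>(2) by (intro circle.integrable_const_bound[of _ 1] continuous_measurable_circle \<phi>(1)) auto
    qed (use U \<phi>(3) in \<open>auto simp: less_top[symmetric]\<close>)
    then show "(LINT t|circle. \<phi> n t) \<le> \<delta>" using U(3) sets.sets_into_space[OF U(2)] by (simp add: Int_absorb2)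
  qed (use \<phi>(2) \<phi>1 in auto)
  have "(\<lambda>n. N (\<lambda>t. ennreal (\<phi> n t))) \<longlonglongrightarrow> N (indicator U)"
  proof (rule Fatou)
    show "(\<lambda>t. ennreal (\<phi> n t)) \<in> L0_plus" for n
      using continuous_measurable_circle[OF \<phi>(1)] by measurable
    show "AE t in circle. incseq (\<lambda>n. ennreal (\<phi> n t)) \<and> (\<lambda>n. ennreal (\<phi> n t)) \<longlonglongrightarrow> indicator U t"
    proof (intro AE_I2 conjI)
      fix t assume "t \<in> space circle"
      then have t: "cmod t = 1" by simp
      show "incseq (\<lambda>n. ennreal (\<phi> n t))"
        using \<phi>(4)[of t] by (auto simp: incseq_def intro: ennreal_leI)
      have "(\<lambda>n. ennreal (\<phi> n t)) \<longlonglongrightarrow> ennreal (indicator U t)"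
        by (intro tendsto_ennrealI \<phi>(5) t)
      then show "(\<lambda>n. ennreal (\<phi> n t)) \<longlonglongrightarrow> indicator U t" by (simp add: ennreal_indicator)
    qed
  qed (use U in auto)
  then have "N (indicator U) \<le> ennreal ((6 * C + 20) * unit / ln (1 + 1 / \<delta>))"
    by (rule LIMSEQ_le_const2) (use le in auto)
  moreover have "N (indicator D) \<le> N (indicator U)"
    using U D by (intro mono AE_I2) (auto simp: indicator_def)
  ultimately show ?thesis by simp
qed

text \<open>Split at a level s: where \<psi> < s the contribution is at most s * N(1), and by
  Markov's inequality the set where \<psi> \<ge> s has measure below \<delta>, so B times its
  indicator has small norm.\<close>

lemma bounded_small:
  assumes e: "0 < e" and B: "0 \<le> B"
  obtains d where "0 < d"
    "\<And>\<psi>. \<psi> \<in> borel_measurable circle \<Longrightarrow> (\<And>t. cmod t = 1 \<Longrightarrow> 0 \<le> \<psi> t \<and> \<psi> t \<le> B) \<Longrightarrow>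
      (LINT t|circle. \<psi> t) < d \<Longrightarrow> N (\<lambda>t. ennreal (\<psi> t)) \<le> ennreal e"
proof -
  define K where "K = (6 * C + 20) * unit"
  have K: "0 \<le> K" using C(1) unit(1) by (simp add: K_def)
  define s where "s = e / (2 * (unit + 1))"
  have s: "0 < s" "s * unit \<le> e / 2"
    using e unit(1) by (auto simp: s_def field_simps)
  \<comment> \<open>The value wanted for ln (1 + 1 / \<delta>), from which \<delta> is then solved:
    it makes B * K / X at most e / 2, and the summand 1 keeps it positive.\<close>
  define X where "X = 2 * B * K / e + 1"
  have X0: "0 < X"
    unfolding X_def using e B K by (intro add_nonneg_pos divide_nonneg_pos) auto
  have "e * X = 2 * B * K + e"
    using e by (simp add: X_def field_simps)
  then have X: "0 < X" "B * (K / X) \<le> e / 2"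
    using e X0 by (auto simp: field_simps)
  define \<delta> where "\<delta> = 1 / (exp X - 1)"
  have \<delta>: "0 < \<delta>" "ln (1 + 1 / \<delta>) = X"
    using X(1) by (auto simp: \<delta>_def)
  show thesis
  proof (rule that[of "\<delta> * s"])
    show "0 < \<delta> * s" using \<delta> s by simp
    fix \<psi> :: "complex \<Rightarrow> real"
    assume m: "\<psi> \<in> borel_measurable circle" and b: "\<And>t. cmod t = 1 \<Longrightarrow> 0 \<le> \<psi> t \<and> \<psi> t \<le> B"
      and small: "(LINT t|circle. \<psi> t) < \<delta> * s"
    note m[measurable]
    define D where "D = {t \<in> space circle. s \<le> \<psi> t}"
    have D: "D \<in> sets circle" unfolding D_def by measurable
    have \<psi>i: "integrable circle \<psi>"
      using b by (intro circle.integrable_const_bound[of _ B] m) auto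
    have "measure circle D \<le> (LINT t|circle. \<psi> t) / s"
      unfolding D_def by (rule integral_Markov_inequality_measure[OF \<psi>i sets.empty_sets])
        (use b s in auto)
    also have "\<dots> < \<delta>" using small s by (simp add: divide_less_eq)
    finally have ND: "N (indicator D) \<le> ennreal (K / X)"
      using indicator_small[OF D, of \<delta>] \<delta> by (simp add: K_def)
    have "N (\<lambda>t. ennreal (\<psi> t)) \<le> N (\<lambda>t. ennreal s + ennreal B * indicator D t)"
    proof (intro mono AE_I2)
      fix t assume t: "t \<in> space circle"
      then have bt: "0 \<le> \<psi> t" "\<psi> t \<le> B" using b by auto
      show "ennreal (\<psi> t) \<le> ennreal s + ennreal B * indicator D t"
      proof (cases "t \<in> D")
        case True
        have "ennreal (\<psi> t) \<le> ennreal B" using bt by (intro ennreal_leI)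
        then show ?thesis using True by (simp add: add_increasing)
      next
        case False
        then have "\<psi> t \<le> s" using t by (simp add: D_def)
        then show ?thesis using False by (simp add: ennreal_leI)
      qed
    qed (use D in measurable)
    also have "\<dots> \<le> N (\<lambda>t. ennreal s) + N (\<lambda>t. ennreal B * indicator D t)"
      by (rule add) (use D in measurable)
    also have "\<dots> = ennreal (s * unit) + ennreal B * N (indicator D)"
      using s B D by (simp add: N_const cmult)
    also have "\<dots> \<le> ennreal (e / 2) + ennreal B * ennreal (K / X)"
      using s by (intro add_mono mult_left_mono ND ennreal_leI) auto
    also have "ennreal B * ennreal (K / X) = ennreal (B * (K / X))"
      using B K X by (intro ennreal_mult[symmetric]) auto
    also have "ennreal (e / 2) + \<dots> = ennreal (e / 2 + B * (K / X))"
      using B K X e by (intro ennreal_plus[symmetric]) auto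
    also have "\<dots> \<le> ennreal e"
      by (intro ennreal_leI) (use X(2) in linarith)
    finally show "N (\<lambda>t. ennreal (\<psi> t)) \<le> ennreal e" .
  qed
qed

text \<open>The error is bounded by 2 * B + 1 and tends to 0 in L^1, so \<open>bounded_small\<close>
  makes its norm small and the triangle inequality concludes. It is applied to \<rho> in the duality
  argument and to the associate norm in the theorem.\<close>

lemma laurent_seq:
  assumes g: "g \<in> borel_measurable circle" and B: "\<And>t. cmod t = 1 \<Longrightarrow> cmod (g t) \<le> B"
  obtains n \<alpha> where
    "\<And>j t. cmod t = 1 \<Longrightarrow> cmod (laurent (n j) (\<alpha> j) t) \<le> B + 1"
    "AE t in circle. (\<lambda>j. laurent (n j) (\<alpha> j) t) \<longlonglongrightarrow> g t"
    "\<And>e. 0 < e \<Longrightarrow> eventually (\<lambda>j. bfs_norm N (laurent (n j) (\<alpha> j)) \<le> bfs_norm N g + ennreal e) sequentially"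
proof -
  obtain n \<alpha> where p: "\<And>j t. cmod t = 1 \<Longrightarrow> cmod (laurent (n j) (\<alpha> j) t) \<le> B + 1"
    "(\<lambda>j. LINT t|circle. cmod (g t - laurent (n j) (\<alpha> j) t)) \<longlonglongrightarrow> 0"
    "AE t in circle. (\<lambda>j. laurent (n j) (\<alpha> j) t) \<longlonglongrightarrow> g t"
    using laurent_seq_L1[OF g B] by blast
  have lm [measurable]: "laurent n \<alpha> \<in> borel_measurable circle" for n \<alpha>
    by (rule continuous_measurable_circle[OF laurent_continuous])
  note g[measurable]
  have B0: "0 \<le> B" using order_trans[OF norm_ge_zero B[of 1]] by simp
  have "eventually (\<lambda>j. bfs_norm N (laurent (n j) (\<alpha> j)) \<le> bfs_norm N g + ennreal e) sequentially" if e: "0 < e" for e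
  proof -
    obtain d where d: "0 < d"
      "\<And>\<psi>. \<psi> \<in> borel_measurable circle \<Longrightarrow> (\<And>t. cmod t = 1 \<Longrightarrow> 0 \<le> \<psi> t \<and> \<psi> t \<le> 2 * B + 1) \<Longrightarrow>
      (LINT t|circle. \<psi> t) < d \<Longrightarrow> N (\<lambda>t. ennreal (\<psi> t)) \<le> ennreal e"
      using bounded_small[OF e, of "2 * B + 1"] B0 by auto
    have "eventually (\<lambda>j. (LINT t|circle. cmod (g t - laurent (n j) (\<alpha> j) t)) < d) sequentially"
      using order_tendstoD(2)[OF p(2) d(1)] .
    then show ?thesis
    proof eventually_elim
      case (elim j)
      have "bfs_norm N (laurent (n j) (\<alpha> j)) \<le> N (\<lambda>t. ennreal (cmod (g t)) + ennreal (cmod (g t - laurent (n j) (\<alpha> j) t)))"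
        unfolding bfs_norm_def
      proof (intro mono AE_I2)
        fix t
        have "cmod (laurent (n j) (\<alpha> j) t) \<le> cmod (g t) + cmod (g t - laurent (n j) (\<alpha> j) t)"
          by (metis norm_minus_commute norm_triangle_sub)
        then show "ennreal (cmod (laurent (n j) (\<alpha> j) t)) \<le> ennreal (cmod (g t)) + ennreal (cmod (g t - laurent (n j) (\<alpha> j) t))"
          by (metis ennreal_leI ennreal_plus norm_ge_zero)
      qed measurable
      also have "\<dots> \<le> bfs_norm N g + N (\<lambda>t. ennreal (cmod (g t - laurent (n j) (\<alpha> j) t)))"
        unfolding bfs_norm_def by (rule add) measurable
      also have "N (\<lambda>t. ennreal (cmod (g t - laurent (n j) (\<alpha> j) t))) \<le> ennreal e"
      proof (rule d(2)[OF _ _ elim])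
        fix t :: complex assume t: "cmod t = 1"
        show "0 \<le> cmod (g t - laurent (n j) (\<alpha> j) t) \<and> cmod (g t - laurent (n j) (\<alpha> j) t) \<le> 2 * B + 1"
          using norm_triangle_ineq4[of "g t" "laurent (n j) (\<alpha> j) t"] B[OF t] p(1)[OF t, of j] by simp
      qed measurable
      finally show ?case by (simp add: add_left_mono)
    qed
  qed
  then show thesis using that p by blast
qed

end

section \<open>The associate norm\<close>

lemma borel_measurable_cnj [measurable (raw)]:
  "f \<in> borel_measurable M \<Longrightarrow> (\<lambda>x. cnj (f x)) \<in> borel_measurable M"
  by (rule measurable_compose[of f M borel cnj])
     (auto intro!: borel_measurable_continuous_onI continuous_intros)

lemma function_norm_of_banach_function_norm:
  assumes "banach_function_norm \<rho>"
  shows "function_norm \<rho>"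
proof
  show mono: "\<rho> g \<le> \<rho> f" if "f \<in> L0_plus" "g \<in> L0_plus" "AE t in circle. g t \<le> f t" for f g
    using assms that unfolding banach_function_norm_def by blast
  show "\<rho> (\<lambda>t. ennreal c * f t) = ennreal c * \<rho> f" if "f \<in> L0_plus" "0 \<le> c" for f c
    using assms that unfolding banach_function_norm_def by blast
  show "\<rho> (\<lambda>t. f t + g t) \<le> \<rho> f + \<rho> g" if "f \<in> L0_plus" "g \<in> L0_plus" for f g
    using assms that unfolding banach_function_norm_def by blast
  show "(\<lambda>n. \<rho> (F n)) \<longlonglongrightarrow> \<rho> f" if "\<And>n::nat. F n \<in> L0_plus" "f \<in> L0_plus"
    "AE t in circle. incseq (\<lambda>n. F n t) \<and> (\<lambda>n. F n t) \<longlonglongrightarrow> f t" for F f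
    using assms that unfolding banach_function_norm_def by blast
  have "\<rho> (\<lambda>_. 1) \<le> \<rho> (indicator (space circle))"
    using sets.top[of circle] by (intro mono AE_I2 borel_measurable_indicator) auto
  also have "\<dots> < \<infinity>"
    using assms sets.top[of circle] unfolding banach_function_norm_def by blast
  finally show "\<rho> (\<lambda>_. 1) < \<infinity>" .
qed

text \<open>This is (A5) for the whole circle. It makes the associate norm of 1 finite and the
  elements of \<open>bfs \<rho>\<close> integrable.\<close>

lemma banach_function_norm_L1:
  assumes "banach_function_norm \<rho>"
  obtains c :: real where "0 < c" "\<And>f. f \<in> L0_plus \<Longrightarrow> (\<integral>\<^sup>+t. f t \<partial>circle) \<le> ennreal c * \<rho> f"
proof -
  have "\<forall>E\<in>sets circle. \<exists>c::real. c > 0 \<and>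
      (\<forall>f\<in>L0_plus. (\<integral>\<^sup>+t\<in>E. f t \<partial>circle) \<le> ennreal c * \<rho> f)"
    using assms unfolding banach_function_norm_def by (elim conjE) assumption
  from bspec[OF this sets.top] obtain c :: real where c: "0 < c"
    "\<And>f. f \<in> L0_plus \<Longrightarrow> (\<integral>\<^sup>+t\<in>space circle. f t \<partial>circle) \<le> ennreal c * \<rho> f"
    by auto
  have "(\<integral>\<^sup>+t. f t \<partial>circle) \<le> ennreal c * \<rho> f" if "f \<in> L0_plus" for f
  proof -
    have "(\<integral>\<^sup>+t. f t \<partial>circle) = (\<integral>\<^sup>+t\<in>space circle. f t \<partial>circle)"
      by (intro nn_integral_cong) simp
    then show ?thesis using c(2)[OF that] by simp
  qed
  with c(1) show thesis by (rule that)
qed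

text \<open>The definition of the associate norm is applied to h / r. A positive majorant r stands
  in for \<rho> h, so that nothing is divided by a vanishing norm.\<close>

lemma associate_norm_Hoelder:
  assumes \<rho>: "function_norm \<rho>" and [measurable]: "h \<in> L0_plus" "g \<in> L0_plus" and h: "\<rho> h \<le> ennreal r" and r: "0 < r"
  shows "(\<integral>\<^sup>+t. h t * g t \<partial>circle) \<le> ennreal r * associate_norm \<rho> g"
proof -
  interpret function_norm \<rho> by fact
  define k where "k t = ennreal (1 / r) * h t" for t
  have [measurable]: "k \<in> L0_plus" unfolding k_def by measurable
  have one: "ennreal r * ennreal (1 / r) = 1" "ennreal (1 / r) * ennreal r = 1"
    using r by (simp_all add: ennreal_mult'[symmetric])
  have "\<rho> k \<le> ennreal (1 / r) * ennreal r"
    unfolding k_def using r h by (subst cmult) (auto intro: mult_left_mono)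
  then have k: "\<rho> k \<le> 1" using one by simp
  have "(\<integral>\<^sup>+t. h t * g t \<partial>circle) = (\<integral>\<^sup>+t. ennreal r * (k t * g t) \<partial>circle)"
    by (simp add: k_def mult.assoc[symmetric] one)
  also have "\<dots> = ennreal r * (\<integral>\<^sup>+t. k t * g t \<partial>circle)"
    by (rule nn_integral_cmult) measurable
  also have "\<dots> \<le> ennreal r * associate_norm \<rho> g"
    unfolding associate_norm_def using k by (intro mult_left_mono SUP_upper) auto
  finally show ?thesis .
qed

text \<open>The inequalities and homogeneity hold for g \<mapsto> \<integral> k g with k fixed and
  pass to the supremum over k; for monotone limits two suprema are interchanged. Finiteness at 1
  comes from (A5).\<close>

lemma function_norm_associate_norm:
  assumes \<rho>: "banach_function_norm \<rho>"
  shows "function_norm (associate_norm \<rho>)"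
proof
  show mono: "associate_norm \<rho> g \<le> associate_norm \<rho> f" if "f \<in> L0_plus" "g \<in> L0_plus" "AE t in circle. g t \<le> f t" for f g
    unfolding associate_norm_def
  proof (intro SUP_mono bexI)
    show "(\<integral>\<^sup>+t. k t * g t \<partial>circle) \<le> (\<integral>\<^sup>+t. k t * f t \<partial>circle)" for k
      by (rule nn_integral_mono_AE) (use that(3) in \<open>eventually_elim, auto intro: mult_left_mono\<close>)
  qed
  show "associate_norm \<rho> (\<lambda>t. ennreal c * f t) = ennreal c * associate_norm \<rho> f" if "f \<in> L0_plus" "0 \<le> c" for f c
  proof -
    have "(\<integral>\<^sup>+t. k t * (ennreal c * f t) \<partial>circle) = ennreal c * (\<integral>\<^sup>+t. k t * f t \<partial>circle)" if "k \<in> L0_plus" for k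
      using that \<open>f \<in> L0_plus\<close> by (subst nn_integral_cmult[symmetric]) (auto simp: mult_ac)
    then have "associate_norm \<rho> (\<lambda>t. ennreal c * f t) = (SUP k\<in>{k\<in>L0_plus. \<rho> k \<le> 1}. ennreal c * (\<integral>\<^sup>+t. k t * f t \<partial>circle))"
      unfolding associate_norm_def by (intro SUP_cong) auto
    also have "\<dots> = ennreal c * associate_norm \<rho> f"
      unfolding associate_norm_def by (rule SUP_mult_left_ennreal[symmetric])
    finally show ?thesis .
  qed
  show "associate_norm \<rho> (\<lambda>t. f t + g t) \<le> associate_norm \<rho> f + associate_norm \<rho> g" if [measurable]: "f \<in> L0_plus" "g \<in> L0_plus" for f g
    unfolding associate_norm_def
  proof (rule SUP_least)
    fix k assume k: "k \<in> {k\<in>L0_plus. \<rho> k \<le> 1}"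
    then have [measurable]: "k \<in> L0_plus" by simp
    have "(\<integral>\<^sup>+t. k t * (f t + g t) \<partial>circle) = (\<integral>\<^sup>+t. k t * f t \<partial>circle) + (\<integral>\<^sup>+t. k t * g t \<partial>circle)"
      unfolding distrib_left by (rule nn_integral_add) measurable
    also have "\<dots> \<le> (SUP k\<in>{k\<in>L0_plus. \<rho> k \<le> 1}. \<integral>\<^sup>+t. k t * f t \<partial>circle) + (SUP k\<in>{k\<in>L0_plus. \<rho> k \<le> 1}. \<integral>\<^sup>+t. k t * g t \<partial>circle)"
      using k by (intro add_mono SUP_upper) auto
    finally show "(\<integral>\<^sup>+t. k t * (f t + g t) \<partial>circle) \<le> \<dots>" .
  qed
  show "(\<lambda>n. associate_norm \<rho> (F n)) \<longlonglongrightarrow> associate_norm \<rho> f"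
    if [measurable]: "\<And>n::nat. F n \<in> L0_plus" "f \<in> L0_plus" and
      lim: "AE t in circle. incseq (\<lambda>n. F n t) \<and> (\<lambda>n. F n t) \<longlonglongrightarrow> f t" for F f
  proof -
    have inc: "incseq (\<lambda>n. associate_norm \<rho> (F n))"
    proof (rule incseq_SucI, rule mono)
      show "AE t in circle. F n t \<le> F (Suc n) t" for n
        using lim by eventually_elim (auto simp: incseq_Suc_iff)
    qed auto
    have "associate_norm \<rho> f = (SUP n. associate_norm \<rho> (F n))"
    proof (rule antisym)
      show "associate_norm \<rho> f \<le> (SUP n. associate_norm \<rho> (F n))"
        unfolding associate_norm_def[of \<rho> f]
      proof (rule SUP_least)
        fix k assume k: "k \<in> {k\<in>L0_plus. \<rho> k \<le> 1}"
        then have [measurable]: "k \<in> L0_plus" by simp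
        have "(\<integral>\<^sup>+t. k t * f t \<partial>circle) = (\<integral>\<^sup>+t. (SUP n. k t * F n t) \<partial>circle)"
        proof (rule nn_integral_cong_AE)
          show "AE t in circle. k t * f t = (SUP n. k t * F n t)"
            using lim
          proof eventually_elim
            case (elim t)
            then have "(SUP n. F n t) = f t"
              using LIMSEQ_unique[OF LIMSEQ_SUP] by blast
            then show ?case by (simp add: SUP_mult_left_ennreal[symmetric])
          qed
        qed
        also have "\<dots> = (SUP n. \<integral>\<^sup>+t. k t * F n t \<partial>circle)"
        proof (rule nn_integral_monotone_convergence_SUP_AE)
          show "AE t in circle. k t * F n t \<le> k t * F (Suc n) t" for n
            using lim by eventually_elim (auto simp: incseq_Suc_iff intro: mult_left_mono)
        qed measurable
        also have "\<dots> \<le> (SUP n. associate_norm \<rho> (F n))"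
          unfolding associate_norm_def
          by (rule SUP_mono, rule bexI[rotated], assumption, rule SUP_upper2[OF k], rule order_refl)
        finally show "(\<integral>\<^sup>+t. k t * f t \<partial>circle) \<le> (SUP n. associate_norm \<rho> (F n))" .
      qed
      show "(SUP n. associate_norm \<rho> (F n)) \<le> associate_norm \<rho> f"
      proof (rule SUP_least, rule mono)
        show "AE t in circle. F n t \<le> f t" for n
          using lim by eventually_elim (auto intro: incseq_le)
      qed auto
    qed
    then show ?thesis using LIMSEQ_SUP[OF inc] by simp
  qed
  obtain c :: real where c: "0 < c" "\<And>f. f \<in> L0_plus \<Longrightarrow> (\<integral>\<^sup>+t. f t \<partial>circle) \<le> ennreal c * \<rho> f"
    using banach_function_norm_L1[OF \<rho>] by blast
  have "associate_norm \<rho> (\<lambda>_. 1) \<le> ennreal c"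
    unfolding associate_norm_def
  proof (rule SUP_least)
    fix k assume k: "k \<in> {k\<in>L0_plus. \<rho> k \<le> 1}"
    then have "(\<integral>\<^sup>+t. k t * 1 \<partial>circle) \<le> ennreal c * \<rho> k" using c(2) by simp
    also have "\<dots> \<le> ennreal c * 1" using k by (intro mult_left_mono) auto
    finally show "(\<integral>\<^sup>+t. k t * 1 \<partial>circle) \<le> ennreal c" by simp
  qed
  then show "associate_norm \<rho> (\<lambda>_. 1) < \<infinity>" by (simp add: le_less_trans)
qed

text \<open>By truncation to min (k, j) and monotone convergence, bounded real-valued test functions
  suffice. These are within reach of \<open>laurent_seq\<close>, which requires a bound.\<close>

lemma associate_norm_leI:
  assumes \<rho>: "function_norm \<rho>" and [measurable]: "g \<in> L0_plus"
    and bound: "\<And>h B. h \<in> borel_measurable circle \<Longrightarrow> (\<And>t. 0 \<le> h t) \<Longrightarrow> (\<And>t. h t \<le> B) \<Longrightarrow>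
      \<rho> (\<lambda>t. ennreal (h t)) \<le> 1 \<Longrightarrow> (\<integral>\<^sup>+t. ennreal (h t) * g t \<partial>circle) \<le> c"
  shows "associate_norm \<rho> g \<le> c"
  unfolding associate_norm_def
proof (rule SUP_least)
  interpret function_norm \<rho> by fact
  fix k assume k: "k \<in> {k\<in>L0_plus. \<rho> k \<le> 1}"
  then have [measurable]: "k \<in> L0_plus" by simp
  define h where "h j t = enn2real (min (k t) (of_nat j))" for j :: nat and t
  have h_eq: "ennreal (h j t) = min (k t) (of_nat j)" for j t
  proof -
    have "min (k t) (of_nat j) \<le> of_nat j" by simp
    also have "(of_nat j :: ennreal) < top" by (rule of_nat_less_top)
    finally show ?thesis by (simp add: h_def)
  qed
  have hm [measurable]: "h j \<in> borel_measurable circle" for j unfolding h_def by measurable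
  have "k t = (SUP j. ennreal (h j t))" for t
  proof -
    have "(SUP j. ennreal (h j t)) = (SUP j. inf (k t) (of_nat j))" by (simp add: h_eq inf_min)
    also have "\<dots> = inf (k t) (SUP j. of_nat j)" by (rule inf_SUP[symmetric])
    also have "\<dots> = k t" by (simp add: ennreal_SUP_of_nat_eq_top)
    finally show ?thesis by simp
  qed
  then have "(\<integral>\<^sup>+t. k t * g t \<partial>circle) = (\<integral>\<^sup>+t. (SUP j. ennreal (h j t) * g t) \<partial>circle)"
    by (subst SUP_mult_right_ennreal[symmetric]) simp
  also have "\<dots> = (SUP j. \<integral>\<^sup>+t. ennreal (h j t) * g t \<partial>circle)"
  proof (rule nn_integral_monotone_convergence_SUP)
    show "incseq (\<lambda>j t. ennreal (h j t) * g t)"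
    proof (rule incseq_SucI, rule le_funI, rule mult_right_mono)
      fix j t
      show "ennreal (h j t) \<le> ennreal (h (Suc j) t)"
        unfolding h_eq by (intro min.mono order_refl of_nat_mono) simp
    qed simp
  qed measurable
  also have "\<dots> \<le> c"
  proof (rule SUP_least, rule bound)
    fix j
    show "0 \<le> h j t" for t by (simp add: h_def)
    show "h j t \<le> real j" for t
      by (metis ennreal_le_iff ennreal_of_nat_eq_real_of_nat h_eq min.cobounded2 of_nat_0_le_iff)
    have "\<rho> (\<lambda>t. ennreal (h j t)) \<le> \<rho> k"
      by (intro mono AE_I2) (auto simp: h_eq)
    then show "\<rho> (\<lambda>t. ennreal (h j t)) \<le> 1" using k by auto
  qed measurable
  finally show "(\<integral>\<^sup>+t. k t * g t \<partial>circle) \<le> c" .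
qed

text \<open>A Laurent sum is bounded on the circle and so lies in the space, and its Riesz
  projection agrees with \<open>laurent_plus\<close> on the circle. From here on only the
  coefficient form is estimated.\<close>

lemma riesz_bounded_norm_of_bounded_on_bfs:
  assumes \<rho>: "function_norm \<rho>" and bdd: "bounded_on_bfs riesz_projection \<rho>"
  obtains C where "riesz_bounded_norm \<rho> C"
proof -
  interpret function_norm \<rho> by fact
  obtain C :: real where C: "0 \<le> C" "\<And>f. f \<in> bfs \<rho> \<Longrightarrow> bfs_norm \<rho> (riesz_projection f) \<le> ennreal C * bfs_norm \<rho> f"
    "\<And>f. f \<in> bfs \<rho> \<Longrightarrow> riesz_projection f \<in> bfs \<rho>"
    using bdd by (auto simp: bounded_on_bfs_def)
  have "bfs_norm \<rho> (laurent_plus n \<alpha>) \<le> ennreal C * bfs_norm \<rho> (laurent n \<alpha>)" for n \<alpha>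
  proof -
    have [measurable]: "laurent n \<alpha> \<in> borel_measurable circle" "laurent_plus n \<alpha> \<in> borel_measurable circle"
      by (rule continuous_measurable_circle laurent_continuous laurent_plus_continuous)+
    obtain B where B: "\<And>t. t \<in> sphere 0 1 \<Longrightarrow> cmod (laurent n \<alpha> t) \<le> B"
      using compact_continuous_image[OF laurent_continuous compact_sphere, of n \<alpha>]
      by (meson bounded_iff compact_imp_bounded imageI)
    have "0 \<le> B" using order_trans[OF norm_ge_zero B[of 1]] by simp
    then have "bfs_norm \<rho> (laurent n \<alpha>) \<le> ennreal (B * unit)"
      unfolding bfs_norm_def using B by (intro bounded_le AE_I2 ennreal_leI) auto
    then have mem: "laurent n \<alpha> \<in> bfs \<rho>"
      by (simp add: bfs_def le_less_trans)
    then have [measurable]: "riesz_projection (laurent n \<alpha>) \<in> borel_measurable circle"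
      using C(3) by (simp add: bfs_def)
    have "bfs_norm \<rho> (laurent_plus n \<alpha>) = bfs_norm \<rho> (riesz_projection (laurent n \<alpha>))"
      unfolding bfs_norm_def by (intro cong AE_I2) (auto simp: riesz_projection_laurent)
    then show ?thesis using C(2)[OF mem] by simp
  qed
  with C(1) have "riesz_bounded_norm \<rho> C" by unfold_locales
  then show thesis by (rule that)
qed

lemma le_of_forall_eps:
  fixes x a b :: real
  assumes "\<And>e. 0 < e \<Longrightarrow> x \<le> a + e * b"
  shows "x \<le> a"
proof (rule tendsto_lowerbound)
  show "((\<lambda>e. a + e * b) \<longlongrightarrow> a) (at_right 0)"
    by (rule tendsto_eq_intros refl | simp)+
  show "eventually (\<lambda>e. x \<le> a + e * b) (at_right 0)"
    using assms by (auto simp: eventually_at_right_less intro: eventually_mono[OF eventually_at_right_less])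
qed simp

lemma sgn_mult_cnj: "sgn z * cnj z = of_real (cmod z)"
  by (cases "z = 0") (simp_all add: sgn_eq complex_norm_square[symmetric] power2_eq_square)

text \<open>For h in the unit ball of \<rho> and q = P p, the integral of h |q| is <g, q> with g = h
  * sgn q. Polynomials u tending to g eventually have norm at most 1 + e, and <u, q> = <P u, p> is
  at most C (1 + e) times the associate norm of p.\<close>

lemma riesz_bounded_norm_associate:
  assumes \<rho>: "banach_function_norm \<rho>" and "riesz_bounded_norm \<rho> C"
  shows "riesz_bounded_norm (associate_norm \<rho>) C"
proof -
  interpret X: riesz_bounded_norm \<rho> C by fact
  interpret X': function_norm "associate_norm \<rho>" by (rule function_norm_associate_norm[OF \<rho>])
  show ?thesis
  proof
    fix n \<alpha>
    define p where "p = laurent n \<alpha>"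
    define q where "q = laurent_plus n \<alpha>"
    have [measurable]: "p \<in> borel_measurable circle" "q \<in> borel_measurable circle"
      unfolding p_def q_def by (rule continuous_measurable_circle laurent_continuous laurent_plus_continuous)+
    have qi: "integrable circle q"
      unfolding q_def by (rule continuous_integrable_circle laurent_plus_continuous)+
    obtain B where B: "\<And>t. t \<in> sphere 0 1 \<Longrightarrow> cmod (p t) \<le> B"
      using compact_continuous_image[OF laurent_continuous compact_sphere, of n \<alpha>] unfolding p_def
      by (meson bounded_iff compact_imp_bounded imageI)
    have "0 \<le> B" using order_trans[OF norm_ge_zero B[of 1]] by simp
    then have "bfs_norm (associate_norm \<rho>) p \<le> ennreal (B * X'.unit)"
      unfolding bfs_norm_def using B by (intro X'.bounded_le AE_I2 ennreal_leI) auto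
    then obtain m where m: "0 \<le> m" "bfs_norm (associate_norm \<rho>) p = ennreal m"
      by (metis ennreal_cases ennreal_less_top le_less_trans order_less_irrefl)
    have "bfs_norm (associate_norm \<rho>) q \<le> ennreal (C * m)"
      unfolding bfs_norm_def
    proof (rule associate_norm_leI[OF X.function_norm_axioms])
      fix h :: "complex \<Rightarrow> real" and B
      assume hm [measurable]: "h \<in> borel_measurable circle" and h0: "\<And>t. 0 \<le> h t" and hB: "\<And>t. h t \<le> B"
        and h1: "\<rho> (\<lambda>t. ennreal (h t)) \<le> 1"
      define g where "g t = of_real (h t) * sgn (q t)" for t
      have gm [measurable]: "g \<in> borel_measurable circle" unfolding g_def sgn_eq by measurable
      have gh: "cmod (g t) \<le> h t" for t
        using h0[of t] by (simp add: g_def norm_mult norm_sgn)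
      then have gB: "cmod (g t) \<le> B" for t using hB order_trans by blast
      have "bfs_norm \<rho> g \<le> \<rho> (\<lambda>t. ennreal (h t))"
        unfolding bfs_norm_def using gh by (intro X.mono AE_I2 ennreal_leI) auto
      with h1 have g1: "bfs_norm \<rho> g \<le> 1" by (rule order_trans[rotated])
      obtain k \<beta> where
        kb: "\<And>j t. cmod t = 1 \<Longrightarrow> cmod (laurent (k j) (\<beta> j) t) \<le> B + 1" and
        klim: "AE t in circle. (\<lambda>j. laurent (k j) (\<beta> j) t) \<longlonglongrightarrow> g t" and
        kN: "\<And>e. 0 < e \<Longrightarrow> eventually (\<lambda>j. bfs_norm \<rho> (laurent (k j) (\<beta> j)) \<le> bfs_norm \<rho> g + ennreal e) sequentially"
        using X.laurent_seq[OF gm gB] by blast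
      have km [measurable]: "laurent i \<gamma> \<in> borel_measurable circle" "laurent_plus i \<gamma> \<in> borel_measurable circle" for i \<gamma>
        by (rule continuous_measurable_circle laurent_continuous laurent_plus_continuous)+
      have "(\<lambda>j. pairing (laurent (k j) (\<beta> j)) q) \<longlonglongrightarrow> (LINT t|circle. g t * cnj (q t))"
        unfolding pairing_def
      proof (rule integral_dominated_convergence[where w = "\<lambda>t. (B + 1) * cmod (q t)"])
        show "AE t in circle. (\<lambda>j. laurent (k j) (\<beta> j) t * cnj (q t)) \<longlonglongrightarrow> g t * cnj (q t)"
          using klim by eventually_elim (intro tendsto_intros)
        show "AE t in circle. cmod (laurent (k j) (\<beta> j) t * cnj (q t)) \<le> (B + 1) * cmod (q t)" for j
          using kb by (intro AE_I2) (auto simp: norm_mult intro!: mult_right_mono)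
      qed (use qi in auto)
      then have conv: "(\<lambda>j. cmod (pairing (laurent (k j) (\<beta> j)) q)) \<longlonglongrightarrow> cmod (LINT t|circle. g t * cnj (q t))"
        by (rule tendsto_norm)
      have le: "cmod (LINT t|circle. g t * cnj (q t)) \<le> C * m + e * ((C + 1) * m)" if e: "0 < e" for e
      proof (rule tendsto_upperbound[OF conv])
        show "eventually (\<lambda>j. cmod (pairing (laurent (k j) (\<beta> j)) q) \<le> C * m + e * ((C + 1) * m)) sequentially"
          using kN[OF e]
        proof eventually_elim
          case (elim j)
          let ?u = "laurent_plus (k j) (\<beta> j)"
          have "bfs_norm \<rho> ?u \<le> ennreal C * (1 + ennreal e)"
            by (rule order_trans[OF X.C(2)], rule mult_left_mono)
              (use elim g1 in \<open>auto intro: order_trans add_right_mono\<close>)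
          \<comment> \<open>The added e keeps the bound positive for C = 0, as
            \<open>associate_norm_Hoelder\<close> requires.\<close>
          also have "\<dots> \<le> ennreal (C * (1 + e) + e)"
            using X.C(1) e by (simp add: ennreal_mult'[symmetric] ennreal_1[symmetric] ennreal_plus[symmetric]
                del: ennreal_1 ennreal_plus)
          finally have u: "bfs_norm \<rho> ?u \<le> ennreal (C * (1 + e) + e)" .
          have ui: "integrable circle (\<lambda>t. ?u t * cnj (p t))"
            unfolding p_def by (intro continuous_integrable_circle continuous_intros laurent_plus_continuous laurent_continuous)
          have "ennreal (cmod (pairing ?u p)) \<le> (\<integral>\<^sup>+t. ennreal (cmod (?u t * cnj (p t))) \<partial>circle)"
            unfolding pairing_def by (rule integral_norm_bound_ennreal[OF ui])
          also have "\<dots> = (\<integral>\<^sup>+t. ennreal (cmod (?u t)) * ennreal (cmod (p t)) \<partial>circle)"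
            by (simp add: norm_mult ennreal_mult)
          also have "\<dots> \<le> ennreal (C * (1 + e) + e) * bfs_norm (associate_norm \<rho>) p"
            unfolding bfs_norm_def
            by (rule associate_norm_Hoelder[OF X.function_norm_axioms _ _ u[unfolded bfs_norm_def]])
               (use X.C(1) e in \<open>auto intro: add_nonneg_pos\<close>)
          also have "\<dots> = ennreal ((C * (1 + e) + e) * m)"
            using X.C(1) e m by (simp add: ennreal_mult)
          finally have "cmod (pairing ?u p) \<le> (C * (1 + e) + e) * m"
            using X.C(1) e m by (subst (asm) ennreal_le_iff) auto
          moreover have "pairing (laurent (k j) (\<beta> j)) q = pairing ?u p"
            unfolding p_def q_def by (rule pairing_laurent_plus)
          ultimately show ?case by (simp add: algebra_simps)
        qed
      qed simp
      have hq: "integrable circle (\<lambda>t. h t * cmod (q t))"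
      proof (rule Bochner_Integration.integrable_bound)
        show "integrable circle (\<lambda>t. B * cmod (q t))" using qi by simp
        show "AE t in circle. norm (h t * cmod (q t)) \<le> norm (B * cmod (q t))"
          using h0 hB by (intro AE_I2) (auto simp: abs_mult intro!: mult_right_mono order_trans[OF _ abs_ge_self])
      qed measurable
      have "(LINT t|circle. g t * cnj (q t)) = (LINT t|circle. of_real (h t * cmod (q t)))"
        by (simp add: g_def mult.assoc sgn_mult_cnj)
      also have "\<dots> = of_real (LINT t|circle. h t * cmod (q t))"
        by (rule integral_complex_of_real)
      finally have "cmod (LINT t|circle. g t * cnj (q t)) = \<bar>LINT t|circle. h t * cmod (q t)\<bar>"
        by (simp only: norm_of_real)
      then have "(LINT t|circle. h t * cmod (q t)) \<le> C * m"
        using le_of_forall_eps[OF le] by simp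
      moreover have "(\<integral>\<^sup>+t. ennreal (h t * cmod (q t)) \<partial>circle) = ennreal (LINT t|circle. h t * cmod (q t))"
        using h0 by (intro nn_integral_eq_integral hq) auto
      ultimately show "(\<integral>\<^sup>+t. ennreal (h t) * ennreal (cmod (q t)) \<partial>circle) \<le> ennreal (C * m)"
        using h0 by (simp add: ennreal_mult[symmetric] ennreal_leI)
    qed measurable
    also have "\<dots> = ennreal C * bfs_norm (associate_norm \<rho>) p"
      using m X.C(1) by (simp add: ennreal_mult)
    finally show "bfs_norm (associate_norm \<rho>) (laurent_plus n \<alpha>) \<le> ennreal C * bfs_norm (associate_norm \<rho>) (laurent n \<alpha>)"
      by (simp only: p_def q_def)
  qed (rule X.C(1))
qed

section \<open>The Lorentz--Luxemburg theorem\<close>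

text \<open>The infima over the tails increase to the lower limit, and each is dominated by a member
  of the sequence.\<close>

lemma liminf_le_norm:
  assumes "function_norm \<rho>" and m: "\<And>n::nat. F n \<in> L0_plus" and le: "\<And>n. \<rho> (F n) \<le> c"
  shows "\<rho> (\<lambda>t. liminf (\<lambda>n. F n t)) \<le> c"
proof -
  interpret function_norm \<rho> by fact
  note m[measurable]
  have "(\<lambda>n. \<rho> (\<lambda>t. INF k\<in>{n..}. F k t)) \<longlonglongrightarrow> \<rho> (\<lambda>t. liminf (\<lambda>n. F n t))"
  proof (rule Fatou)
    show "AE t in circle. incseq (\<lambda>n. INF k\<in>{n..}. F k t) \<and> (\<lambda>n. INF k\<in>{n..}. F k t) \<longlonglongrightarrow> liminf (\<lambda>n. F n t)"
    proof (intro AE_I2 conjI)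
      fix t
      show inc: "incseq (\<lambda>n. INF k\<in>{n..}. F k t)"
        by (auto simp: incseq_def intro!: INF_superset_mono)
      show "(\<lambda>n. INF k\<in>{n..}. F k t) \<longlonglongrightarrow> liminf (\<lambda>n. F n t)"
        unfolding liminf_SUP_INF by (rule LIMSEQ_SUP[OF inc])
    qed
  qed measurable
  then show ?thesis
  proof (rule LIMSEQ_le_const2)
    have "\<rho> (\<lambda>t. INF k\<in>{n..}. F k t) \<le> c" for n
      by (rule order_trans[OF mono le[of n]]) (auto intro!: INF_lower)
    then show "\<exists>N. \<forall>n\<ge>N. \<rho> (\<lambda>t. INF k\<in>{n..}. F k t) \<le> c" by blast
  qed
qed

text \<open>The geometric rate makes the sum of the absolute increments integrable, hence finite
  almost everywhere, and there the telescoping series converges.\<close>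

lemma convergent_of_summable_L1:
  fixes h :: "nat \<Rightarrow> complex \<Rightarrow> real"
  assumes i: "\<And>n. integrable circle (h n)"
    and s: "\<And>n. (LINT t|circle. \<bar>h (Suc n) t - h n t\<bar>) \<le> c * (1 / 2) ^ n" and c: "0 \<le> c"
  shows "AE t in circle. convergent (\<lambda>n. h n t)"
proof -
  have m [measurable]: "h n \<in> borel_measurable circle" for n
    using i by (rule borel_measurable_integrable)
  have "(\<integral>\<^sup>+t. (\<Sum>n. ennreal \<bar>h (Suc n) t - h n t\<bar>) \<partial>circle) = (\<Sum>n. \<integral>\<^sup>+t. ennreal \<bar>h (Suc n) t - h n t\<bar> \<partial>circle)"
    by (rule nn_integral_suminf) measurable
  also have "\<dots> \<le> (\<Sum>n. ennreal (c * (1 / 2) ^ n))"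
  proof (intro suminf_le)
    fix n
    have "(\<integral>\<^sup>+t. ennreal \<bar>h (Suc n) t - h n t\<bar> \<partial>circle) = ennreal (LINT t|circle. \<bar>h (Suc n) t - h n t\<bar>)"
      using i by (intro nn_integral_eq_integral) auto
    also have "\<dots> \<le> ennreal (c * (1 / 2) ^ n)" by (intro ennreal_leI s)
    finally show "(\<integral>\<^sup>+t. ennreal \<bar>h (Suc n) t - h n t\<bar> \<partial>circle) \<le> ennreal (c * (1 / 2) ^ n)" .
  qed auto
  also have "\<dots> = ennreal (\<Sum>n. c * (1 / 2) ^ n)"
    using c by (intro suminf_ennreal2) (auto intro!: summable_mult summable_geometric)
  also have "\<dots> < \<infinity>" by simp
  finally have "AE t in circle. (\<Sum>n. ennreal \<bar>h (Suc n) t - h n t\<bar>) \<noteq> \<infinity>"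
    by (intro nn_integral_PInf_AE) auto
  then show ?thesis
  proof eventually_elim
    case (elim t)
    have "summable (\<lambda>n. \<bar>h (Suc n) t - h n t\<bar>)"
      by (rule summable_suminf_not_top) (use elim in auto)
    then have "summable (\<lambda>n. h (Suc n) t - h n t)" by (rule summable_rabs_cancel)
    then have "convergent (\<lambda>n. \<Sum>k<n. h (Suc k) t - h k t)" by (simp add: summable_iff_convergent)
    moreover have "(\<lambda>n. \<Sum>k<n. h (Suc k) t - h k t) = (\<lambda>n. h n t - h 0 t)"
      by (rule ext) (rule sum_lessThan_telescope[of "\<lambda>k. h k t"])
    ultimately have "convergent (\<lambda>n. h n t - h 0 t)" by (simp only:)
    from convergent_add[OF this convergent_const[of "h 0 t"]] show ?case by (simp only: diff_add_cancel)
  qed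
qed

text \<open>The first-order condition at a minimum, obtained by dividing by s and letting s tend to
  0. For a > 0 the value s = a / b is already contradictory, and s = 1 shows that this choice is
  admissible.\<close>

lemma le_of_quadratic:
  fixes a b :: real
  assumes "\<And>s. 0 < s \<Longrightarrow> s \<le> 1 \<Longrightarrow> 2 * s * a \<le> s\<^sup>2 * b"
  shows "a \<le> 0"
proof (rule ccontr)
  assume "\<not> a \<le> 0"
  then have a: "0 < a" by simp
  have "2 * a \<le> b" using assms[of 1] by simp
  then have b: "0 < b" using a by linarith
  define s where "s = a / b"
  have "0 < s" "s \<le> 1" using a b \<open>2 * a \<le> b\<close> by (auto simp: s_def)
  then have "2 * s * a \<le> s\<^sup>2 * b" by (rule assms)
  then have "2 * a \<le> s * b" using \<open>0 < s\<close> by (simp add: power2_eq_square)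
  then show False using a b by (simp add: s_def)
qed

text \<open>A minimizing sequence is Cauchy by the parallelogram law, and the Fatou property keeps its
  almost everywhere limit in the unit ball.\<close>

lemma L2_projection:
  fixes f :: "complex \<Rightarrow> real"
  assumes \<rho>: "function_norm \<rho>" and fm: "f \<in> borel_measurable circle" and f: "\<And>t. 0 \<le> f t" "\<And>t. f t \<le> B"
  obtains h where "h \<in> borel_measurable circle" "\<And>t. 0 \<le> h t" "\<And>t. h t \<le> f t" "\<rho> (\<lambda>t. ennreal (h t)) \<le> 1"
    "\<And>k. k \<in> borel_measurable circle \<Longrightarrow> (\<And>t. 0 \<le> k t) \<Longrightarrow> (\<And>t. k t \<le> f t) \<Longrightarrow> \<rho> (\<lambda>t. ennreal (k t)) \<le> 1 \<Longrightarrow>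
      (LINT t|circle. (f t - h t)\<^sup>2) \<le> (LINT t|circle. (f t - k t)\<^sup>2)"
proof -
  interpret function_norm \<rho> by fact
  note fm[measurable]
  have B0: "0 \<le> B" using f order_trans by blast
  define S where "S = {h \<in> borel_measurable circle. (\<forall>t. 0 \<le> h t) \<and> (\<forall>t. h t \<le> f t) \<and> \<rho> (\<lambda>t. ennreal (h t)) \<le> 1}"
  define J where "J h = (LINT t|circle. (f t - h t)\<^sup>2)" for h
  define d where "d = (INF h\<in>S. J h)"
  have bi: "integrable circle h" if "h \<in> borel_measurable circle" "\<And>t. \<bar>h t\<bar> \<le> b" for h :: "complex \<Rightarrow> real" and b
    using that by (intro circle.integrable_const_bound[of _ b]) auto
  have S: "h \<in> borel_measurable circle" "0 \<le> h t" "h t \<le> f t" "\<rho> (\<lambda>t. ennreal (h t)) \<le> 1" if "h \<in> S" for h t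
    using that by (auto simp: S_def)
  have sq: "(f t - h t)\<^sup>2 \<le> B\<^sup>2" if "h \<in> S" for h t
    using S(2,3)[OF that, of t] f(2)[of t] by (intro power_mono) auto
  have Ji: "integrable circle (\<lambda>t. (f t - h t)\<^sup>2)" if "h \<in> S" for h
    using S(1)[OF that] sq[OF that] by (intro bi[of _ "B\<^sup>2"]) auto
  have bdd: "bdd_below (J ` S)"
    by (intro bdd_belowI2[of _ 0]) (auto simp: J_def)
  have "\<rho> (\<lambda>t. ennreal 0) \<le> 1" using N_const[of 0] by simp
  then have "(\<lambda>_. 0) \<in> S" using f(1) by (simp add: S_def)
  then have ne: "S \<noteq> {}" by blast
  have d_le: "d \<le> J h" if "h \<in> S" for h
    unfolding d_def using bdd that by (rule cINF_lower)
  \<comment> \<open>The rate 4^(-n) for squared distances yields steps of order 2^(-n) in L^2, and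
    so summable steps in L^1.\<close>
  have "\<exists>h\<in>S. J h < d + (1 / 4) ^ n" for n :: nat
  proof -
    have "(INF h\<in>S. J h) < d + (1 / 4) ^ n" by (simp add: d_def)
    then show ?thesis using cINF_less_iff[OF ne bdd] by blast
  qed
  then obtain h where hS: "\<And>n::nat. h n \<in> S" and hJ: "\<And>n. J (h n) < d + (1 / 4) ^ n" by metis
  have hm [measurable]: "h n \<in> borel_measurable circle" for n using S(1)[OF hS] .
  have step: "(LINT t|circle. \<bar>h (Suc n) t - h n t\<bar>) \<le> 3 * (1 / 2) ^ n" for n
  proof -
    \<comment> \<open>The midpoint is admissible by convexity of the unit ball, so
      \<open>J k\<close> \<ge> d in the parallelogram identity \<open>id\<close>.\<close>
    define k where "k t = (h (Suc n) t + h n t) / 2" for t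
    have [measurable]: "k \<in> borel_measurable circle" unfolding k_def by measurable
    have "\<rho> (\<lambda>t. ennreal (k t)) = \<rho> (\<lambda>t. ennreal (1 / 2) * ennreal (h (Suc n) t) + ennreal (1 / 2) * ennreal (h n t))"
    proof (intro arg_cong[of _ _ \<rho>] ext)
      fix t
      have "0 \<le> (1 / 2 :: real)" by simp
      then have "ennreal (1 / 2 * h (Suc n) t + 1 / 2 * h n t) = ennreal (1 / 2) * ennreal (h (Suc n) t) + ennreal (1 / 2) * ennreal (h n t)"
        by (simp only: ennreal_plus ennreal_mult mult_nonneg_nonneg S(2)[OF hS])
      then show "ennreal (k t) = ennreal (1 / 2) * ennreal (h (Suc n) t) + ennreal (1 / 2) * ennreal (h n t)"
        by (simp only: k_def add_divide_distrib mult_1 times_divide_eq_left)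
    qed
    also have "\<dots> \<le> \<rho> (\<lambda>t. ennreal (1 / 2) * ennreal (h (Suc n) t)) + \<rho> (\<lambda>t. ennreal (1 / 2) * ennreal (h n t))"
      by (rule add) measurable
    also have "\<dots> = ennreal (1 / 2) * \<rho> (\<lambda>t. ennreal (h (Suc n) t)) + ennreal (1 / 2) * \<rho> (\<lambda>t. ennreal (h n t))"
      by (subst (1 2) cmult) auto
    also have "\<dots> \<le> ennreal (1 / 2) * 1 + ennreal (1 / 2) * 1"
      by (intro add_mono mult_left_mono S(4)[OF hS]) auto
    also have "\<dots> = ennreal (1 / 2 + 1 / 2)" by (subst ennreal_plus) auto
    finally have "\<rho> (\<lambda>t. ennreal (k t)) \<le> 1" by simp
    then have kS: "k \<in> S"
      using S(2,3)[OF hS] by (auto simp: S_def k_def intro!: add_nonneg_nonneg) (smt (verit) field_sum_of_halves)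
    have id: "(h (Suc n) t - h n t)\<^sup>2 = 2 * (f t - h (Suc n) t)\<^sup>2 + 2 * (f t - h n t)\<^sup>2 - 4 * (f t - k t)\<^sup>2" for t
      by (simp add: k_def power2_eq_square field_simps)
    have sqi: "integrable circle (\<lambda>t. (h (Suc n) t - h n t)\<^sup>2)"
      unfolding id using Ji[OF hS] Ji[OF kS] by auto
    have "(LINT t|circle. (h (Suc n) t - h n t)\<^sup>2) = 2 * J (h (Suc n)) + 2 * J (h n) - 4 * J k"
      unfolding id J_def using Ji[OF hS] Ji[OF kS] by simp
    also have "\<dots> \<le> 4 * (1 / 4) ^ n"
    proof -
      have "0 \<le> (1 / 4 :: real) ^ n" "(1 / 4 :: real) ^ Suc n = (1 / 4) ^ n / 4" by simp_all
      then show ?thesis using hJ[of n] hJ[of "Suc n"] d_le[OF kS] by linarith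
    qed
    finally have L2: "(LINT t|circle. (h (Suc n) t - h n t)\<^sup>2) \<le> 4 * (1 / 4) ^ n" .
    \<comment> \<open>Takes the place of the Cauchy-Schwarz inequality: with weight 2^n, the bound 4
      * 4^(-n) for the squares becomes (4 + 1) / 2 * 2^(-n) for the absolute values.\<close>
    have amgm: "\<bar>x\<bar> \<le> (2 ^ n * x\<^sup>2 + (1 / 2) ^ n) / 2" for x :: real
    proof -
      have "0 \<le> (2 ^ n * \<bar>x\<bar> - 1)\<^sup>2 * (1 / 2) ^ n" by simp
      also have "\<dots> = 2 ^ n * x\<^sup>2 - 2 * \<bar>x\<bar> + (1 / 2) ^ n"
        by (simp add: power2_eq_square field_simps)
      finally show ?thesis by simp
    qed
    have "(LINT t|circle. \<bar>h (Suc n) t - h n t\<bar>) \<le> (LINT t|circle. (2 ^ n * (h (Suc n) t - h n t)\<^sup>2 + (1 / 2) ^ n) / 2)"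
    proof (rule integral_mono)
      show "integrable circle (\<lambda>t. \<bar>h (Suc n) t - h n t\<bar>)"
      proof (intro bi[of _ B])
        show "\<bar>\<bar>h (Suc n) t - h n t\<bar>\<bar> \<le> B" for t
          using S(2,3)[OF hS, of n t] S(2,3)[OF hS, of "Suc n" t] f(2)[of t] by linarith
      qed measurable
    qed (use sqi amgm in auto)
    also have "\<dots> = (2 ^ n * (LINT t|circle. (h (Suc n) t - h n t)\<^sup>2) + (1 / 2) ^ n) / 2"
      using sqi by simp
    also have "\<dots> \<le> (2 ^ n * (4 * (1 / 4) ^ n) + (1 / 2) ^ n) / 2"
      by (intro divide_right_mono add_right_mono mult_left_mono L2) auto
    also have "2 ^ n * (4 * (1 / 4) ^ n) = 4 * (1 / 2 :: real) ^ n"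
      by (simp add: power_mult_distrib[symmetric])
    also have "(4 * (1 / 2 :: real) ^ n + (1 / 2) ^ n) / 2 \<le> 3 * (1 / 2) ^ n" by simp
    finally show ?thesis .
  qed
  have hB: "\<bar>h n t\<bar> \<le> B" for n t
    using S(2,3)[OF hS, of n t] f(2)[of t] by linarith
  have conv: "AE t in circle. convergent (\<lambda>n. h n t)"
    by (rule convergent_of_summable_L1[OF _ step]) (auto intro: bi[OF hm hB])
  \<comment> \<open>The lower limit in \<open>ennreal\<close> exists at every point, so the
    candidate is measurable and lies between 0 and f everywhere; where the sequence converges, it is
    the limit.\<close>
  define H where "H t = liminf (\<lambda>n. ennreal (h n t))" for t
  define h0 where "h0 t = enn2real (H t)" for t
  have Hm [measurable]: "H \<in> borel_measurable circle" unfolding H_def by measurable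
  have [measurable]: "h0 \<in> borel_measurable circle" unfolding h0_def by measurable
  have Hf: "H t \<le> ennreal (f t)" for t
    unfolding H_def using S(3)[OF hS]
    by (intro Liminf_le) (auto intro!: eventuallyI ennreal_leI)
  have h0H: "ennreal (h0 t) = H t" for t
    unfolding h0_def using Hf[of t] by (simp add: le_less_trans)
  have h0S: "h0 \<in> S"
  proof -
    have "\<rho> (\<lambda>t. ennreal (h0 t)) \<le> 1"
      unfolding h0H unfolding H_def by (rule liminf_le_norm[OF \<rho> _ S(4)[OF hS]]) measurable
    moreover have "h0 t \<le> f t" for t
      using Hf[of t] f(1)[of t] by (metis ennreal_le_iff h0H)
    ultimately show ?thesis by (simp add: S_def) (simp add: h0_def)
  qed
  have "(\<lambda>n. J (h n)) \<longlonglongrightarrow> J h0"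
    unfolding J_def
  proof (rule integral_dominated_convergence[where w = "\<lambda>_. B\<^sup>2"])
    show "AE t in circle. (\<lambda>n. (f t - h n t)\<^sup>2) \<longlonglongrightarrow> (f t - h0 t)\<^sup>2"
      using conv
    proof eventually_elim
      case (elim t)
      then obtain x where x: "(\<lambda>n. h n t) \<longlonglongrightarrow> x" by (auto simp: convergent_def)
      have x0: "0 \<le> x" using S(2)[OF hS] by (intro LIMSEQ_le_const[OF x]) auto
      have "H t = ennreal x"
        unfolding H_def by (rule lim_imp_Liminf[OF _ tendsto_ennrealI[OF x]]) simp
      then have "h0 t = x" using x0 by (simp add: h0_def)
      then show ?case using x by (auto intro!: tendsto_intros)
    qed
    show "AE t in circle. norm ((f t - h n t)\<^sup>2) \<le> B\<^sup>2" for n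
      using sq[OF hS] by simp
  qed auto
  moreover have "(\<lambda>n. d + (1 / 4) ^ n) \<longlonglongrightarrow> d + 0"
    by (intro tendsto_intros LIMSEQ_realpow_zero) auto
  ultimately have "J h0 \<le> d + 0"
    using hJ by (intro LIMSEQ_le) (auto intro: less_imp_le)
  then have min: "J h0 \<le> J k" if "k \<in> S" for k
    using d_le[OF that] by simp
  show thesis
  proof (rule that)
    fix k assume "k \<in> borel_measurable circle" "\<And>t. 0 \<le> k t" "\<And>t. k t \<le> f t" "\<rho> (\<lambda>t. ennreal (k t)) \<le> 1"
    then have "k \<in> S" by (simp add: S_def)
    from min[OF this] show "(LINT t|circle. (f t - h0 t)\<^sup>2) \<le> (LINT t|circle. (f t - k t)\<^sup>2)"
      by (simp add: J_def)
  qed (use S[OF h0S] in auto)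
qed

text \<open>The Lorentz--Luxemburg theorem: \<open>f\<close> is separated from the unit ball by \<open>f - h\<close>, where
  \<open>h\<close> is the projection of \<open>f\<close>.\<close>

lemma Lorentz_Luxemburg_bounded:
  fixes f :: "complex \<Rightarrow> real"
  assumes \<rho>: "function_norm \<rho>" and fm: "f \<in> borel_measurable circle" and f: "\<And>t. 0 \<le> f t" "\<And>t. f t \<le> B"
    and f1: "1 < \<rho> (\<lambda>t. ennreal (f t))"
  obtains g D where "g \<in> borel_measurable circle" "\<And>t. 0 \<le> g t" "\<And>t. g t \<le> D"
    "associate_norm \<rho> (\<lambda>t. ennreal (g t)) \<le> 1" "1 < (LINT t|circle. f t * g t)"
proof -
  interpret function_norm \<rho> by fact
  note fm[measurable]
  have B0: "0 \<le> B" using f order_trans by blast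
  obtain h where hm [measurable]: "h \<in> borel_measurable circle" and h: "\<And>t. 0 \<le> h t" "\<And>t. h t \<le> f t" "\<rho> (\<lambda>t. ennreal (h t)) \<le> 1"
    and min: "\<And>k. k \<in> borel_measurable circle \<Longrightarrow> (\<And>t. 0 \<le> k t) \<Longrightarrow> (\<And>t. k t \<le> f t) \<Longrightarrow> \<rho> (\<lambda>t. ennreal (k t)) \<le> 1 \<Longrightarrow>
      (LINT t|circle. (f t - h t)\<^sup>2) \<le> (LINT t|circle. (f t - k t)\<^sup>2)"
    using L2_projection[OF \<rho> fm f] by blast
  have bi: "integrable circle u" if "u \<in> borel_measurable circle" "\<And>t. \<bar>u t\<bar> \<le> b" for u :: "complex \<Rightarrow> real" and b
    using that by (intro circle.integrable_const_bound[of _ b]) auto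
  define g where "g t = f t - h t" for t
  have gm [measurable]: "g \<in> borel_measurable circle" unfolding g_def by measurable
  have g: "0 \<le> g t" "g t \<le> B" for t
    using h(1,2)[of t] f(2)[of t] by (auto simp: g_def)
  have gi: "integrable circle (\<lambda>t. g t * u t)" if "u \<in> borel_measurable circle" "\<And>t. \<bar>u t\<bar> \<le> b" for u b
  proof (rule bi[of _ "B * b"])
    show "\<bar>g t * u t\<bar> \<le> B * b" for t
      unfolding abs_mult using g[of t] that(2)[of t] B0 by (intro mult_mono) auto
  qed (use that in measurable)
  define \<gamma> where "\<gamma> = (LINT t|circle. g t * h t)"
  have \<gamma>0: "0 \<le> \<gamma>" unfolding \<gamma>_def using g h by (intro integral_nonneg_AE AE_I2) auto
  have hB: "\<bar>h t\<bar> \<le> B" for t using h(1,2)[of t] f(2)[of t] by linarith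
  \<comment> \<open>The variational inequality of the projection: over bounded nonnegative k in the
    unit ball, \<integral> g k does not exceed its value \<gamma> at h. It becomes the bound on the
    associate norm of g / c.\<close>
  have var: "(LINT t|circle. g t * k t) \<le> \<gamma>"
    if [measurable]: "k \<in> borel_measurable circle" and k: "\<And>t. 0 \<le> k t" "\<And>t. k t \<le> b" "\<rho> (\<lambda>t. ennreal (k t)) \<le> 1" for k b
  proof -
    have kb: "\<bar>k t\<bar> \<le> b" for t using k(1,2)[of t] by simp
    have khb: "\<bar>k t - h t\<bar> \<le> b + B" for t using kb[of t] hB[of t] by linarith
    have i1: "integrable circle (\<lambda>t. (g t)\<^sup>2)"
      unfolding power2_eq_square using g by (intro gi[of _ B]) auto
    have i2: "integrable circle (\<lambda>t. g t * (k t - h t))"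
      by (rule gi[OF _ khb]) measurable
    have i3: "integrable circle (\<lambda>t. (k t - h t)\<^sup>2)"
    proof (rule bi[of _ "(b + B)\<^sup>2"])
      show "\<bar>(k t - h t)\<^sup>2\<bar> \<le> (b + B)\<^sup>2" for t
        using khb[of t] by (metis abs_power2 power2_abs abs_ge_zero power_mono)
    qed measurable
    have "(LINT t|circle. g t * (k t - h t)) \<le> 0"
    proof (rule le_of_quadratic)
      fix s :: real assume s: "0 < s" "s \<le> 1"
      define u where "u t = (1 - s) * h t + s * k t" for t
      have [measurable]: "u \<in> borel_measurable circle" unfolding u_def by measurable
      have u0: "0 \<le> u t" for t using s h k by (simp add: u_def)
      \<comment> \<open>The convex combination u may exceed f and is then no competitor in
        \<open>min\<close>; cutting it down to f raises neither its norm nor its distance from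
        f.\<close>
      define v where "v t = min (u t) (f t)" for t
      have [measurable]: "v \<in> borel_measurable circle" unfolding v_def by measurable
      have "\<rho> (\<lambda>t. ennreal (v t)) \<le> \<rho> (\<lambda>t. ennreal (1 - s) * ennreal (h t) + ennreal s * ennreal (k t))"
      proof (intro mono AE_I2)
        fix t
        have "ennreal (v t) \<le> ennreal ((1 - s) * h t + s * k t)"
          by (intro ennreal_leI) (simp add: v_def u_def)
        also have "\<dots> = ennreal (1 - s) * ennreal (h t) + ennreal s * ennreal (k t)"
          using s h k by (simp add: ennreal_mult)
        finally show "ennreal (v t) \<le> ennreal (1 - s) * ennreal (h t) + ennreal s * ennreal (k t)" .
      qed measurable
      also have "\<dots> \<le> \<rho> (\<lambda>t. ennreal (1 - s) * ennreal (h t)) + \<rho> (\<lambda>t. ennreal s * ennreal (k t))"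
        by (rule add) measurable
      also have "\<dots> = ennreal (1 - s) * \<rho> (\<lambda>t. ennreal (h t)) + ennreal s * \<rho> (\<lambda>t. ennreal (k t))"
        using s by (subst (1 2) cmult) auto
      also have "\<dots> \<le> ennreal (1 - s) * 1 + ennreal s * 1"
        by (intro add_mono mult_left_mono h k) auto
      also have "\<dots> = 1" using s by (simp add: ennreal_plus[symmetric] del: ennreal_plus)
      finally have v1: "\<rho> (\<lambda>t. ennreal (v t)) \<le> 1" .
      have v0: "0 \<le> v t" "v t \<le> f t" for t using u0 f by (auto simp: v_def)
      have "(LINT t|circle. (g t)\<^sup>2) \<le> (LINT t|circle. (f t - v t)\<^sup>2)"
        unfolding g_def by (rule min[OF _ v0 v1]) measurable
      also have "\<dots> \<le> (LINT t|circle. (g t)\<^sup>2 - 2 * s * (g t * (k t - h t)) + s\<^sup>2 * (k t - h t)\<^sup>2)"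
      proof (rule integral_mono)
        show "integrable circle (\<lambda>t. (f t - v t)\<^sup>2)"
        proof (rule bi[of _ "B\<^sup>2"])
          show "\<bar>(f t - v t)\<^sup>2\<bar> \<le> B\<^sup>2" for t
            using v0[of t] f(2)[of t] by (auto intro!: power_mono)
        qed measurable
        show "(f t - v t)\<^sup>2 \<le> (g t)\<^sup>2 - 2 * s * (g t * (k t - h t)) + s\<^sup>2 * (k t - h t)\<^sup>2" for t
        proof -
          have "\<bar>f t - v t\<bar> \<le> \<bar>f t - u t\<bar>" by (auto simp: v_def min_def)
          then have "(f t - v t)\<^sup>2 \<le> (f t - u t)\<^sup>2" by (simp add: abs_le_square_iff)
          also have "\<dots> = (g t)\<^sup>2 - 2 * s * (g t * (k t - h t)) + s\<^sup>2 * (k t - h t)\<^sup>2"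
            by (simp add: u_def g_def power2_eq_square algebra_simps)
          finally show ?thesis .
        qed
      qed (use i1 i2 i3 in auto)
      also have "\<dots> = (LINT t|circle. (g t)\<^sup>2) - 2 * s * (LINT t|circle. g t * (k t - h t)) + s\<^sup>2 * (LINT t|circle. (k t - h t)\<^sup>2)"
        using i1 i2 i3 by simp
      finally show "2 * s * (LINT t|circle. g t * (k t - h t)) \<le> s\<^sup>2 * (LINT t|circle. (k t - h t)\<^sup>2)"
        by simp
    qed
    moreover have "(LINT t|circle. g t * (k t - h t)) = (LINT t|circle. g t * k t) - \<gamma>"
      unfolding \<gamma>_def right_diff_distrib
      by (rule Bochner_Integration.integral_diff) (rule gi[OF _ kb] gi[OF _ hB], measurable)+
    ultimately show ?thesis by simp
  qed
  define a where "a = (LINT t|circle. f t * g t)"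
  have sqi: "integrable circle (\<lambda>t. g t * g t)" using g by (intro gi[of _ B]) auto
  have "a = (LINT t|circle. g t * g t + g t * h t)"
    unfolding a_def by (intro Bochner_Integration.integral_cong refl) (simp add: g_def algebra_simps)
  also have "\<dots> = (LINT t|circle. g t * g t) + \<gamma>"
    unfolding \<gamma>_def by (rule Bochner_Integration.integral_add[OF sqi gi[OF hm hB]])
  finally have a: "a = (LINT t|circle. g t * g t) + \<gamma>" .
  have "(LINT t|circle. g t * g t) \<noteq> 0"
  proof
    assume "(LINT t|circle. g t * g t) = 0"
    then have "AE t in circle. g t * g t = 0"
      using integral_nonneg_eq_0_iff_AE[OF sqi] by auto
    then have "\<rho> (\<lambda>t. ennreal (f t)) \<le> \<rho> (\<lambda>t. ennreal (h t))"
      by (intro mono) (auto simp: g_def elim!: eventually_mono)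
    then show False using f1 h(3) by (simp add: not_le[symmetric])
  qed
  moreover have "0 \<le> (LINT t|circle. g t * g t)" by (intro integral_nonneg_AE AE_I2) auto
  ultimately have "0 < (LINT t|circle. g t * g t)" by (simp only: less_le not_sym simp_thms)
  then have "\<gamma> < a" unfolding a by simp
  \<comment> \<open>With c strictly between \<gamma> and a, g / c has associate norm at most 1 but
    pairs with f to a / c > 1; the midpoint is positive also if \<gamma> = 0.\<close>
  define c where "c = (\<gamma> + a) / 2"
  have c: "0 < c" "\<gamma> < c" "c < a" using \<gamma>0 \<open>\<gamma> < a\<close> by (auto simp: c_def)
  show thesis
  proof (rule that)
    show "(\<lambda>t. g t / c) \<in> borel_measurable circle" by measurable
    show "0 \<le> g t / c" "g t / c \<le> B / c" for t using g[of t] c by (auto simp: divide_right_mono)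
    have "(LINT t|circle. f t * (g t / c)) = a / c" by (simp add: a_def)
    then show "1 < (LINT t|circle. f t * (g t / c))" using c by simp
    show "associate_norm \<rho> (\<lambda>t. ennreal (g t / c)) \<le> 1"
    proof (rule associate_norm_leI[OF \<rho>])
      fix k :: "complex \<Rightarrow> real" and b
      assume k [measurable]: "k \<in> borel_measurable circle" and k': "\<And>t. 0 \<le> k t" "\<And>t. k t \<le> b" "\<rho> (\<lambda>t. ennreal (k t)) \<le> 1"
      have gk: "integrable circle (\<lambda>t. g t * k t)"
        using k' by (intro gi[of _ b] k) auto
      have "(\<integral>\<^sup>+t. ennreal (k t) * ennreal (g t / c) \<partial>circle) = (\<integral>\<^sup>+t. ennreal (g t * k t / c) \<partial>circle)"
        using k'(1) g(1) c(1) by (intro nn_integral_cong) (simp add: ennreal_mult[symmetric] mult.commute)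
      also have "\<dots> = ennreal (LINT t|circle. g t * k t / c)"
        using k'(1) g(1) c(1) gk by (intro nn_integral_eq_integral) auto
      also have "\<dots> = ennreal ((LINT t|circle. g t * k t) / c)" by simp
      also have "\<dots> \<le> ennreal 1"
        using var[OF k k'] c by (intro ennreal_leI) simp
      finally show "(\<integral>\<^sup>+t. ennreal (k t) * ennreal (g t / c) \<partial>circle) \<le> 1" by simp
    qed measurable
  qed
qed

text \<open>By the Fatou property some truncation min (|f|, j) already has norm above r; divided by
  r it is a bounded function of norm above 1, the case treated before.\<close>

lemma Lorentz_Luxemburg:
  assumes \<rho>: "function_norm \<rho>" and f [measurable]: "f \<in> borel_measurable circle"
    and fi: "integrable circle f" and r: "0 < r" "ennreal r < bfs_norm \<rho> f"
  obtains g D where "g \<in> borel_measurable circle" "\<And>t. 0 \<le> g t" "\<And>t. g t \<le> D"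
    "associate_norm \<rho> (\<lambda>t. ennreal (g t)) \<le> 1" "r < (LINT t|circle. cmod (f t) * g t)"
proof -
  interpret function_norm \<rho> by fact
  define F where "F j t = min (cmod (f t)) (real j)" for j t
  have Fm [measurable]: "F j \<in> borel_measurable circle" for j unfolding F_def by measurable
  have "(\<lambda>j. \<rho> (\<lambda>t. ennreal (F j t))) \<longlonglongrightarrow> bfs_norm \<rho> f"
    unfolding bfs_norm_def
  proof (rule Fatou)
    show "AE t in circle. incseq (\<lambda>j. ennreal (F j t)) \<and> (\<lambda>j. ennreal (F j t)) \<longlonglongrightarrow> ennreal (cmod (f t))"
    proof (intro AE_I2 conjI)
      fix t
      show "incseq (\<lambda>j. ennreal (F j t))"
        by (intro incseq_SucI ennreal_leI) (auto simp: F_def)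
      obtain n :: nat where n: "cmod (f t) \<le> real n" using real_arch_simple by blast
      have "F j t = cmod (f t)" if "j \<ge> n" for j using n that by (simp add: F_def)
      then have "eventually (\<lambda>j. ennreal (F j t) = ennreal (cmod (f t))) sequentially"
        unfolding eventually_sequentially by metis
      then show "(\<lambda>j. ennreal (F j t)) \<longlonglongrightarrow> ennreal (cmod (f t))" by (rule tendsto_eventually)
    qed
  qed measurable
  then have "eventually (\<lambda>j. ennreal r < \<rho> (\<lambda>t. ennreal (F j t))) sequentially"
    by (rule order_tendstoD(1)) (rule r)
  then obtain j where j: "ennreal r < \<rho> (\<lambda>t. ennreal (F j t))"
    by (auto simp: eventually_sequentially)
  have one: "ennreal (1 / r) * ennreal r = 1"
    using r by (simp add: ennreal_mult'[symmetric])
  have "\<rho> (\<lambda>t. ennreal (F j t / r)) = ennreal (1 / r) * \<rho> (\<lambda>t. ennreal (F j t))"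
    using r by (subst cmult[symmetric]) (auto simp: F_def ennreal_mult'[symmetric])
  moreover have "ennreal (1 / r) * ennreal r < ennreal (1 / r) * \<rho> (\<lambda>t. ennreal (F j t))"
    using j r by (intro ennreal_mult_strict_left_mono) auto
  ultimately have "1 < \<rho> (\<lambda>t. ennreal (F j t / r))" using one by simp
  then obtain g D where gm [measurable]: "g \<in> borel_measurable circle" and g: "\<And>t. 0 \<le> g t" "\<And>t. g t \<le> D"
    "associate_norm \<rho> (\<lambda>t. ennreal (g t)) \<le> 1" "1 < (LINT t|circle. F j t / r * g t)"
    using Lorentz_Luxemburg_bounded[OF \<rho>, of "\<lambda>t. F j t / r" "real j / r"] r
    by (auto simp: F_def divide_right_mono)
  have D0: "0 \<le> D" using g(1,2) order_trans by blast
  have i2: "integrable circle (\<lambda>t. cmod (f t) * g t)"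
  proof (rule Bochner_Integration.integrable_bound)
    show "integrable circle (\<lambda>t. cmod (f t) * D)" using fi by simp
    show "AE t in circle. norm (cmod (f t) * g t) \<le> norm (cmod (f t) * D)"
      using g(1,2) D0 by (intro AE_I2) (auto simp: abs_mult intro!: mult_left_mono)
  qed measurable
  have i1: "integrable circle (\<lambda>t. F j t * g t)"
  proof (rule Bochner_Integration.integrable_bound[OF i2])
    show "AE t in circle. norm (F j t * g t) \<le> norm (cmod (f t) * g t)"
      using g(1) by (intro AE_I2) (auto simp: abs_mult F_def intro!: mult_right_mono)
  qed measurable
  have "r < (LINT t|circle. F j t * g t)"
    using g(4) r by (simp add: field_simps)
  also have "\<dots> \<le> (LINT t|circle. cmod (f t) * g t)"
    by (rule integral_mono[OF i1 i2]) (auto simp: F_def intro!: mult_right_mono g)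
  finally show thesis using that gm g by blast
qed

section \<open>The norm as a supremum over trigonometric polynomials\<close>

theorem corollary3p8:
  fixes \<rho> :: "(complex \<Rightarrow> ennreal) \<Rightarrow> ennreal" and f :: "complex \<Rightarrow> complex"
  assumes "banach_function_norm \<rho>"
    and "bounded_on_bfs riesz_projection \<rho>"
    and "f \<in> bfs \<rho>"
  shows "bfs_norm \<rho> f =
    (SUP p\<in>{p \<in> trig_polynomials. bfs_norm (associate_norm \<rho>) p \<le> 1}.
       ennreal (cmod (pairing f p)))"
proof -
  note \<rho> = function_norm_of_banach_function_norm[OF assms(1)]
  interpret X: function_norm \<rho> by (rule \<rho>)
  obtain C where "riesz_bounded_norm \<rho> C"
    using riesz_bounded_norm_of_bounded_on_bfs[OF \<rho> assms(2)] .
  then interpret X': riesz_bounded_norm "associate_norm \<rho>" C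
    by (rule riesz_bounded_norm_associate[OF assms(1)])
  have fm [measurable]: "f \<in> borel_measurable circle" and ffin: "bfs_norm \<rho> f < \<infinity>"
    using assms(3) by (auto simp: bfs_def)
  have fi: "integrable circle f"
  proof (rule integrableI_bounded[OF fm])
    obtain c :: real where c: "\<And>f. f \<in> L0_plus \<Longrightarrow> (\<integral>\<^sup>+t. f t \<partial>circle) \<le> ennreal c * \<rho> f"
      using banach_function_norm_L1[OF assms(1)] by blast
    have "(\<integral>\<^sup>+t. ennreal (cmod (f t)) \<partial>circle) \<le> ennreal c * bfs_norm \<rho> f"
      unfolding bfs_norm_def by (rule c) measurable
    also have "\<dots> < \<infinity>" using ffin by (simp add: ennreal_mult_less_top)
    finally show "(\<integral>\<^sup>+t. ennreal (cmod (f t)) \<partial>circle) < \<infinity>" .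
  qed
  have lm [measurable]: "laurent n \<alpha> \<in> borel_measurable circle" for n \<alpha>
    by (rule continuous_measurable_circle[OF laurent_continuous])
  define P where "P = {p \<in> trig_polynomials. bfs_norm (associate_norm \<rho>) p \<le> 1}"
  define S where "S = (SUP p\<in>P. ennreal (cmod (pairing f p)))"
  have "S \<le> bfs_norm \<rho> f"
    unfolding S_def
  proof (rule SUP_least)
    fix p assume p: "p \<in> P"
    then have [measurable]: "p \<in> borel_measurable circle" and p1: "bfs_norm (associate_norm \<rho>) p \<le> 1"
      by (auto simp: P_def trig_polynomials_eq)
    obtain R where R: "0 \<le> R" "bfs_norm \<rho> f = ennreal R"
      using ffin by (cases "bfs_norm \<rho> f") auto
    show "ennreal (cmod (pairing f p)) \<le> bfs_norm \<rho> f"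
    \<comment> \<open>If the product is not integrable, \<open>pairing\<close> is 0 by the default
      value of the Bochner integral.\<close>
    proof (cases "integrable circle (\<lambda>t. f t * cnj (p t))")
      case True
      show ?thesis
      proof (rule ennreal_le_epsilon)
        fix e :: real assume e: "0 < e"
        have "ennreal (cmod (pairing f p)) \<le> (\<integral>\<^sup>+t. ennreal (cmod (f t * cnj (p t))) \<partial>circle)"
          unfolding pairing_def by (rule integral_norm_bound_ennreal[OF True])
        also have "\<dots> = (\<integral>\<^sup>+t. ennreal (cmod (f t)) * ennreal (cmod (p t)) \<partial>circle)"
          by (simp add: norm_mult ennreal_mult)
        \<comment> \<open>R + e in place of R, because the Hoelder inequality asks for a positive
          majorant of the norm.\<close>
        also have "\<dots> \<le> ennreal (R + e) * bfs_norm (associate_norm \<rho>) p"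
          unfolding bfs_norm_def
        proof (rule associate_norm_Hoelder[OF \<rho>])
          show "\<rho> (\<lambda>t. ennreal (cmod (f t))) \<le> ennreal (R + e)"
            using R e unfolding bfs_norm_def by (auto intro: ennreal_leI)
        qed (use R e in auto)
        also have "\<dots> \<le> ennreal (R + e) * 1" by (intro mult_left_mono p1) simp
        also have "\<dots> = bfs_norm \<rho> f + ennreal e" using R e by simp
        finally show "ennreal (cmod (pairing f p)) \<le> bfs_norm \<rho> f + ennreal e" .
      qed
    qed (simp add: pairing_def not_integrable_integral_eq)
  qed
  moreover have "bfs_norm \<rho> f \<le> S"
  proof (rule ccontr)
    assume "\<not> bfs_norm \<rho> f \<le> S"
    then have "S < bfs_norm \<rho> f" by simp
    then obtain r' where r': "S < r'" "r' < bfs_norm \<rho> f" using dense by blast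
    then have "r' < top" by (simp add: less_trans[OF _ ffin[simplified]])
    then obtain r where r: "r' = ennreal r" "0 \<le> r" by (cases r') auto
    have r0: "0 < r" using r r'(1) by (metis ennreal_0 less_eq_real_def not_less_zero)
    obtain s where s: "S = ennreal s" "0 \<le> s" using r'(1) \<open>r' < top\<close> by (cases S) auto
    have sr: "s < r" using r'(1) r s by (simp add: ennreal_less_iff)
    obtain g D where gm [measurable]: "g \<in> borel_measurable circle" and g: "\<And>t. 0 \<le> g t" "\<And>t. g t \<le> D"
      "associate_norm \<rho> (\<lambda>t. ennreal (g t)) \<le> 1" "r < (LINT t|circle. cmod (f t) * g t)"
      using Lorentz_Luxemburg[OF \<rho> fm fi r0] r'(2) r(1) by blast
    have D0: "0 \<le> D" using g(1,2) order_trans by blast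
    \<comment> \<open>The phase of f turns the pairing with f into \<integral> |f| g, while |G|
      \<le> g keeps the associate norm at most 1.\<close>
    define G where "G t = of_real (g t) * sgn (f t)" for t
    have Gm [measurable]: "G \<in> borel_measurable circle" unfolding G_def sgn_eq by measurable
    have Gg: "cmod (G t) \<le> g t" for t using g(1)[of t] by (simp add: G_def norm_mult norm_sgn)
    have GD: "cmod (G t) \<le> D" for t using Gg g(2) order_trans by blast
    have "bfs_norm (associate_norm \<rho>) G \<le> associate_norm \<rho> (\<lambda>t. ennreal (g t))"
      unfolding bfs_norm_def using Gg by (intro X'.mono AE_I2 ennreal_leI) auto
    with g(3) have G1: "bfs_norm (associate_norm \<rho>) G \<le> 1" by (rule order_trans[rotated])
    obtain n \<alpha> where
      nb: "\<And>j t. cmod t = 1 \<Longrightarrow> cmod (laurent (n j) (\<alpha> j) t) \<le> D + 1" and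
      nlim: "AE t in circle. (\<lambda>j. laurent (n j) (\<alpha> j) t) \<longlonglongrightarrow> G t" and
      nN: "\<And>e. 0 < e \<Longrightarrow> eventually (\<lambda>j. bfs_norm (associate_norm \<rho>) (laurent (n j) (\<alpha> j)) \<le> bfs_norm (associate_norm \<rho>) G + ennreal e) sequentially"
      using X'.laurent_seq[OF Gm GD] by blast
    have "(\<lambda>j. pairing f (laurent (n j) (\<alpha> j))) \<longlonglongrightarrow> pairing f G"
      unfolding pairing_def
    proof (rule integral_dominated_convergence[where w = "\<lambda>t. cmod (f t) * (D + 1)"])
      show "AE t in circle. (\<lambda>j. f t * cnj (laurent (n j) (\<alpha> j) t)) \<longlonglongrightarrow> f t * cnj (G t)"
        using nlim by eventually_elim (intro tendsto_intros)
      show "AE t in circle. cmod (f t * cnj (laurent (n j) (\<alpha> j) t)) \<le> cmod (f t) * (D + 1)" for j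
        using nb by (intro AE_I2) (auto simp: norm_mult intro!: mult_left_mono)
    qed (use fi in auto)
    then have conv: "(\<lambda>j. cmod (pairing f (laurent (n j) (\<alpha> j)))) \<longlonglongrightarrow> cmod (pairing f G)"
      by (rule tendsto_norm)
    have "cmod (pairing f G) \<le> s + e * s" if e: "0 < e" for e
    proof (rule tendsto_upperbound[OF conv])
      show "eventually (\<lambda>j. cmod (pairing f (laurent (n j) (\<alpha> j))) \<le> s + e * s) sequentially"
        using nN[OF e]
      proof eventually_elim
        case (elim j)
        \<comment> \<open>The approximant is only known to have associate norm at most 1 + e.
          Dividing by 1 + e puts it into the unit ball, and the factor returns in the bound s + e *
          s.\<close>
        define c where "c = 1 / (1 + e)"
        have c: "0 < c" "c * (1 + e) = 1" using e by (auto simp: c_def)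
        define p where "p = laurent (n j) (\<lambda>k. of_real c * \<alpha> j k)"
        have p: "p t = of_real c * laurent (n j) (\<alpha> j) t" for t
          by (simp add: p_def laurent_def sum_distrib_left mult.assoc)
        have "bfs_norm (associate_norm \<rho>) p = ennreal c * bfs_norm (associate_norm \<rho>) (laurent (n j) (\<alpha> j))"
          unfolding bfs_norm_def using c by (subst X'.cmult[symmetric]) (auto simp: p norm_mult ennreal_mult)
        also have "\<dots> \<le> ennreal c * (1 + ennreal e)"
          by (rule mult_left_mono) (use elim G1 in \<open>auto intro: order_trans add_right_mono\<close>)
        also have "1 + ennreal e = ennreal (1 + e)"
          using e by simp
        also have "ennreal c * \<dots> = ennreal (c * (1 + e))"
          using c e by (intro ennreal_mult[symmetric]) auto
        also have "\<dots> = 1" using c by simp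
        finally have "p \<in> P" by (auto simp: P_def trig_polynomials_eq p_def)
        then have "ennreal (cmod (pairing f p)) \<le> S" unfolding S_def by (rule SUP_upper)
        then have le: "cmod (pairing f p) \<le> s" using s by simp
        have "pairing f p = of_real c * pairing f (laurent (n j) (\<alpha> j))"
          unfolding pairing_def p by (simp add: mult.left_commute)
        then have "c * cmod (pairing f (laurent (n j) (\<alpha> j))) \<le> s"
          using le c by (simp add: norm_mult)
        then have "(1 + e) * (c * cmod (pairing f (laurent (n j) (\<alpha> j)))) \<le> (1 + e) * s"
          using e by (intro mult_left_mono) auto
        moreover have "(1 + e) * (c * x) = x" for x :: real
          using c(2) by (metis mult.assoc mult.commute mult_1)
        ultimately have "cmod (pairing f (laurent (n j) (\<alpha> j))) \<le> (1 + e) * s" by (simp only:)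
        then show ?case by (simp add: algebra_simps)
      qed
    qed simp
    then have le: "cmod (pairing f G) \<le> s" by (rule le_of_forall_eps)
    have fG: "f t * cnj (G t) = of_real (cmod (f t) * g t)" for t
    proof -
      have "f t * cnj (sgn (f t)) = cnj (sgn (f t) * cnj (f t))" by simp
      also have "\<dots> = of_real (cmod (f t))" unfolding sgn_mult_cnj by simp
      finally show ?thesis by (simp add: G_def)
    qed
    have "pairing f G = of_real (LINT t|circle. cmod (f t) * g t)"
      unfolding pairing_def fG by (rule integral_complex_of_real)
    then have "(LINT t|circle. cmod (f t) * g t) \<le> cmod (pairing f G)" by (simp only: norm_of_real abs_ge_self)
    then show False using le sr g(4) by simp
  qed
  ultimately show ?thesis unfolding S_def P_def by (rule antisym[rotated])
qed

end
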